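(* Each of the following sets is a basis of the $\mathbb{Q}(q)$-vector space $\mathbf{U}^{\imath}$: (1) $\mathbf{B}_{\mathcal{GL}}=\{B_{l_1l_2\cdots l_m}\mid m\ge 0,\ l_1,\ldots,l_m\in \mathcal{GL}(\mathbf{U}^{\imath}),\ l_1\geq \cdots\geq l_m\}$; (2) $\mathbf{B}_{\mathcal{L}}=\{B_{[l_1][l_2]\cdots [l_m]}\mid m\ge 0,\ l_1,\ldots,l_m\in \mathcal{GL}(\mathbf{U}^{\imath}),\ l_1\geq \cdots\geq l_m\}$. (Here $\geq$ refers to the lexicographic order on words, and the elements are indexed by the sequences $(l_1,\dots,l_m)$.)
   Context: Algebra. Let $\mathfrak g$ be a complex simple Lie algebra of rank $n$ with fixed simple roots $\alpha_1,\dots,\alpha_n$, and let $(\cdot,\cdot)$ be the symmetric Weyl-invariant bilinear form on the root lattice, normalised so that short roots satisfy $(\alpha,\alpha)=2$. Put $a_{ij}=2(\alpha_i,\alpha_j)/(\alpha_i,\alpha_i)$, $d_i=(\alpha_i,\alpha_i)/2$. Let $q\in\mathbb C$, $q\ne 0$, not a root of unity, $q_i=q^{d_i}$, $[k]_i=(q_i^k-q_i^{-k})/(q_i-q_i^{-1})$, with the usual quantum factorials and binomials. $\mathbf U=U_q(\mathfrak g)$ is the $\mathbb Q(q)$-algebra with generators $E_i,F_i,K_i^{\pm1}$ and relations $K_iK_i^{-1}=K_i^{-1}K_i=1$, $K_iK_j=K_jK_i$, $K_iE_jK_i^{-1}=q_i^{a_{ij}}E_j$, $K_iF_jK_i^{-1}=q_i^{-a_{ij}}F_j$,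 $E_iF_j-F_jE_i=\delta_{ij}\frac{K_i-K_i^{-1}}{q_i-q_i^{-1}}$, and, for $i\neq j$, the quantum Serre relations $\sum_{k=0}^{1-a_{ij}}(-1)^k\begin{bmatrix}1-a_{ij}\\k\end{bmatrix}_i x_i^{1-a_{ij}-k}x_jx_i^k=0$ for $x=E$ and $x=F$. Fix parameters $\xi_i\in\mathbb Q(q)^\times$. The split $\imath$quantum group $\mathbf U^\imath=\mathbf U^\imath(\mathfrak g)$ is the $\mathbb Q(q)$-subalgebra of $\mathbf U$ generated by $B_i=F_i+\xi_iE_iK_i^{-1}$, $1\le i\le n$. Words. Let $T(V)$ be the tensor (free associative) $\mathbb Q(q)$-algebra on letters $v_1,\dots,v_n$. $\mathcal W$ is the set of nonempty words in the letters; the empty word is $\emptyset$; $\ell(w)$ is the length of $w$; $|v_{i_1}\cdots v_{i_k}|=\alpha_{i_1}+\cdots+\alpha_{i_k}$. The order $<$ on words is the lexicographic order with $v_1<\cdots<v_n$, a proper prefix of a word being smaller than the word. Define $x\prec y$ if $\ell(x)<\ell(y)$, or $\ell(x)=\ell(y)$ and $x>y$. A word $v_{i_1}\cdots v_{i_k}$ is Lyndon if $k=1$ or it is $<$ each of its proper suffixes $v_{i_j}\cdots v_{i_k}$, $2\le j\le k$. $\mathcal L$ is the set of Lyndon words. For $w=v_{i_1}\cdots v_{i_k}$ put $B_w=B_{i_1}\cdots B_{i_k}$ ($B_\emptyset=1$), extended linearly to $B_x$ for $x\in T(V)$. A word $g\in\mathcal W$ is $\mathbf U^\imath$-good if $B_g$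 is not a $\mathbb Q(q)$-linear combination of elements $B_w$ with $w\prec g$. $\mathcal{GL}(\mathbf U^\imath)$ is the set of $\mathbf U^\imath$-good Lyndon words. Bracketing. Extend bilinearly $[x,y]_{q^{-1}}=xy-q^{-(|x|,|y|)}yx$ for words $x,y$. For $l\in\mathcal L$ put $[l]=l$ if $l$ is a letter; otherwise write $l=l_1l_2$ where $l_1$ is the longest proper prefix of $l$ that is Lyndon (then $l_2$ is Lyndon too) and put $[l]=[[l_1],[l_2]]_{q^{-1}}\in T(V)$. *)

theory Defs
  imports
    "HOL-Analysis.Analysis"
    "HOL-Library.Poly_Mapping"
    "HOL-Algebra.QuotRing"
    "HOL-Algebra.Embedded_Algebras"
    "HOL-Algebra.Generated_Fields"
    "HOL-Algebra.Algebraic_Closure_Type"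
begin

section \<open>Root systems\<close>

definition reflection :: "'v::euclidean_space \<Rightarrow> 'v \<Rightarrow> 'v"
  where "reflection \<alpha> \<beta> = \<beta> - (2 * (\<beta> \<bullet> \<alpha>) / (\<alpha> \<bullet> \<alpha>)) *\<^sub>R \<alpha>"

definition root_system :: "'v::euclidean_space set \<Rightarrow> bool"
  where "root_system \<Phi> \<longleftrightarrow>
    finite \<Phi> \<and> 0 \<notin> \<Phi> \<and> span \<Phi> = UNIV \<and>
    (\<forall>\<alpha>\<in>\<Phi>. \<forall>\<beta>\<in>\<Phi>. reflection \<alpha> \<beta> \<in> \<Phi>) \<and>
    (\<forall>\<alpha>\<in>\<Phi>. \<forall>\<beta>\<in>\<Phi>. 2 * (\<beta> \<bullet> \<alpha>) / (\<alpha> \<bullet> \<alpha>) \<in> \<int>) \<and>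
    (\<forall>\<alpha>\<in>\<Phi>. \<forall>c. c *\<^sub>R \<alpha> \<in> \<Phi> \<longrightarrow> c = 1 \<or> c = - 1)"

definition irreducible_root_system :: "'v::euclidean_space set \<Rightarrow> bool"
  where "irreducible_root_system \<Phi> \<longleftrightarrow>
    root_system \<Phi> \<and> \<Phi> \<noteq> {} \<and>
    \<not> (\<exists>A B. A \<noteq> {} \<and> B \<noteq> {} \<and> A \<union> B = \<Phi> \<and> A \<inter> B = {} \<and> (\<forall>a\<in>A. \<forall>b\<in>B. a \<bullet> b = 0))"

definition simple_roots :: "'v::euclidean_space set \<Rightarrow> ('i::finite \<Rightarrow> 'v) \<Rightarrow> bool"
  where "simple_roots \<Phi> \<alpha> \<longleftrightarrow>
    range \<alpha> \<subseteq> \<Phi> \<and> inj \<alpha> \<and> independent (range \<alpha>) \<and>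
    (\<forall>\<beta>\<in>\<Phi>. \<exists>c :: 'i \<Rightarrow> int.
       \<beta> = (\<Sum>i\<in>UNIV. of_int (c i) *\<^sub>R \<alpha> i) \<and> ((\<forall>i. 0 \<le> c i) \<or> (\<forall>i. c i \<le> 0)))"

text \<open>The inner product of the ambient space plays the role of the Weyl-invariant form.\<close>

definition short_roots_normalised :: "'v::euclidean_space set \<Rightarrow> bool"
  where "short_roots_normalised \<Phi> \<longleftrightarrow> (\<forall>\<beta>\<in>\<Phi>. 2 \<le> \<beta> \<bullet> \<beta>) \<and> (\<exists>\<beta>\<in>\<Phi>. \<beta> \<bullet> \<beta> = 2)"

text \<open>
  For a normalised irreducible root system the arguments of \<open>floor\<close> below are integers;
  \<open>floor\<close> only converts them to type \<^typ>\<open>int\<close>.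
\<close>

definition cartan_int :: "('i \<Rightarrow> 'v::euclidean_space) \<Rightarrow> 'i \<Rightarrow> 'i \<Rightarrow> int"
  where "cartan_int \<alpha> i j = \<lfloor>2 * (\<alpha> i \<bullet> \<alpha> j) / (\<alpha> i \<bullet> \<alpha> i)\<rfloor>"

definition half_norm :: "('i \<Rightarrow> 'v::euclidean_space) \<Rightarrow> 'i \<Rightarrow> int"
  where "half_norm \<alpha> i = \<lfloor>(\<alpha> i \<bullet> \<alpha> i) / 2\<rfloor>"


section \<open>Quantum integers and the field $\mathbb{Q}(q)$\<close>

definition Qq :: "complex \<Rightarrow> complex set"
  where "Qq q = generate_field (ring_of_type_algebra :: complex ring) {q}"

definition qint :: "complex \<Rightarrow> nat \<Rightarrow> complex"
  where "qint p k = (p ^ k - inverse p ^ k) / (p - inverse p)"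

definition qfact :: "complex \<Rightarrow> nat \<Rightarrow> complex"
  where "qfact p m = (\<Prod>k=1..m. qint p k)"

definition qbinom :: "complex \<Rightarrow> nat \<Rightarrow> nat \<Rightarrow> complex"
  where "qbinom p m k = qfact p m / (qfact p k * qfact p (m - k))"


section \<open>Free associative algebras\<close>

text \<open>
  The free algebra is the monoid algebra of the free monoid. The type of finitely supported
  functions takes the convolution product with respect to \<open>+\<close> on the exponents, so
  concatenation of words is written additively.
\<close>

datatype 'a word = Word (letters: "'a list")

instantiation word :: (type) monoid_add
begin

definition zero_word :: "'a word" where "0 = Word []"
definition plus_word :: "'a word \<Rightarrow> 'a word \<Rightarrow> 'a word" where "u + v = Word (letters u @ letters v)"

instance by standard (simp_all add: zero_word_def plus_word_def)

end

type_synonym 'a falg = "'a word \<Rightarrow>\<^sub>0 complex"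

definition const :: "complex \<Rightarrow> 'a falg"
  where "const c = Poly_Mapping.single 0 c"

definition monomial :: "'a list \<Rightarrow> 'a falg"
  where "monomial w = Poly_Mapping.single (Word w) 1"

definition free_algebra :: "complex set \<Rightarrow> 'a falg ring"
  where "free_algebra K = ring_of_type_algebra \<lparr> carrier := {p. \<forall>w. Poly_Mapping.lookup p w \<in> K} \<rparr>"


section \<open>Words\<close>

text \<open>Prefixes are smaller in \<^const>\<open>ord_class.lexordp\<close>.\<close>

definition lyndon :: "'i::linorder list \<Rightarrow> bool"
  where "lyndon w \<longleftrightarrow> w \<noteq> [] \<and> (\<forall>j. 0 < j \<and> j < length w \<longrightarrow> ord_class.lexordp w (drop j w))"

definition word_prec :: "'i::linorder list \<Rightarrow> 'i list \<Rightarrow> bool"  (infix \<open>\<prec>\<^sub>w\<close> 50)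
  where "x \<prec>\<^sub>w y \<longleftrightarrow> length x < length y \<or> length x = length y \<and> ord_class.lexordp y x"

definition longest_lyndon_prefix :: "'i::linorder list \<Rightarrow> nat"
  where "longest_lyndon_prefix l = Max {k. 0 < k \<and> k < length l \<and> lyndon (take k l)}"

lemma longest_lyndon_prefix_bounds:
  assumes "2 \<le> length l"
  shows "0 < longest_lyndon_prefix l \<and> longest_lyndon_prefix l < length l"
proof -
  let ?S = "{k. 0 < k \<and> k < length l \<and> lyndon (take k l)}"
  have "finite ?S" by simp
  moreover have "1 \<in> ?S" using assms by (auto simp: lyndon_def)
  ultimately have "Max ?S \<in> ?S" by (intro Max_in) auto
  then show ?thesis unfolding longest_lyndon_prefix_def by simp
qed

definition weight :: "('i \<Rightarrow> 'v::euclidean_space) \<Rightarrow> 'i list \<Rightarrow> 'v"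
  where "weight \<alpha> w = sum_list (map \<alpha> w)"

definition qcommutator ::
    "('i \<Rightarrow> 'v::euclidean_space) \<Rightarrow> complex \<Rightarrow> 'i falg \<Rightarrow> 'i falg \<Rightarrow> 'i falg"
  where "qcommutator \<alpha> q x y =
    (\<Sum>u\<in>Poly_Mapping.keys x. \<Sum>v\<in>Poly_Mapping.keys y. const (Poly_Mapping.lookup x u * Poly_Mapping.lookup y v) *
       (monomial (letters u) * monomial (letters v)
         - const (q powi (- \<lfloor>weight \<alpha> (letters u) \<bullet> weight \<alpha> (letters v)\<rfloor>))
             * (monomial (letters v) * monomial (letters u))))"

text \<open>Only the values on Lyndon words matter.\<close>

function bracketing ::
    "('i::linorder \<Rightarrow> 'v::euclidean_space) \<Rightarrow> complex \<Rightarrow> 'i list \<Rightarrow> 'i falg"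
  where "bracketing \<alpha> q l =
    (if length l < 2 then monomial l
     else qcommutator \<alpha> q
       (bracketing \<alpha> q (take (longest_lyndon_prefix l) l))
       (bracketing \<alpha> q (drop (longest_lyndon_prefix l) l)))"
  by auto
termination
proof (relation "Wellfounded.measure (\<lambda>(\<alpha>, q, l). length l)", goal_cases)
  case (2 \<alpha> q l)
  with longest_lyndon_prefix_bounds[of l] show ?case by auto
next
  case (3 \<alpha> q l)
  with longest_lyndon_prefix_bounds[of l] show ?case by auto
qed simp

declare bracketing.simps [simp del]


section \<open>The quantum group\<close>

datatype 'i qgen = GenE 'i | GenF 'i | GenK 'i | GenKinv 'i

definition gen :: "'a \<Rightarrow> 'a falg" where "gen g = monomial [g]"

definition qi :: "('i \<Rightarrow> 'v::euclidean_space) \<Rightarrow> complex \<Rightarrow> 'i \<Rightarrow> complex"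
  where "qi \<alpha> q i = q powi half_norm \<alpha> i"

definition serre ::
    "('i \<Rightarrow> 'v::euclidean_space) \<Rightarrow> complex \<Rightarrow> ('i \<Rightarrow> 'i qgen) \<Rightarrow> 'i \<Rightarrow> 'i \<Rightarrow> 'i qgen falg"
  where "serre \<alpha> q x i j =
    (let m = nat (1 - cartan_int \<alpha> i j) in
      \<Sum>k=0..m. const ((- 1) ^ k * qbinom (qi \<alpha> q i) m k)
        * gen (x i) ^ (m - k) * gen (x j) * gen (x i) ^ k)"

definition U_relations :: "('i \<Rightarrow> 'v::euclidean_space) \<Rightarrow> complex \<Rightarrow> 'i qgen falg set"
  where "U_relations \<alpha> q =
    (\<Union>i. {gen (GenK i) * gen (GenKinv i) - 1, gen (GenKinv i) * gen (GenK i) - 1}) \<union>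
    (\<Union>i j. {gen (GenK i) * gen (GenK j) - gen (GenK j) * gen (GenK i),
       gen (GenK i) * gen (GenE j) * gen (GenKinv i)
         - const (qi \<alpha> q i powi cartan_int \<alpha> i j) * gen (GenE j),
       gen (GenK i) * gen (GenF j) * gen (GenKinv i)
         - const (qi \<alpha> q i powi (- cartan_int \<alpha> i j)) * gen (GenF j),
       gen (GenE i) * gen (GenF j) - gen (GenF j) * gen (GenE i)
         - (if i = j then const (inverse (qi \<alpha> q i - inverse (qi \<alpha> q i)))
              * (gen (GenK i) - gen (GenKinv i)) else 0)}) \<union>
    (\<Union>i. \<Union>j\<in>-{i}. {serre \<alpha> q GenE i j, serre \<alpha> q GenF i j})"

definition U_ideal :: "('i \<Rightarrow> 'v::euclidean_space) \<Rightarrow> complex \<Rightarrow> 'i qgen falg set"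
  where "U_ideal \<alpha> q = genideal (free_algebra (Qq q)) (U_relations \<alpha> q)"

definition U :: "('i \<Rightarrow> 'v::euclidean_space) \<Rightarrow> complex \<Rightarrow> 'i qgen falg set ring"
  where "U \<alpha> q = free_algebra (Qq q) Quot U_ideal \<alpha> q"

definition U_proj ::
    "('i \<Rightarrow> 'v::euclidean_space) \<Rightarrow> complex \<Rightarrow> 'i qgen falg \<Rightarrow> 'i qgen falg set"
  where "U_proj \<alpha> q p = U_ideal \<alpha> q +>\<^bsub>free_algebra (Qq q)\<^esub> p"

text \<open>
  The copy of $\mathbb{Q}(q)$ inside \<^const>\<open>U\<close>; spans and linear independence over
  $\mathbb{Q}(q)$ are taken with respect to it.
\<close>

definition U_scalars :: "('i \<Rightarrow> 'v::euclidean_space) \<Rightarrow> complex \<Rightarrow> 'i qgen falg set set"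
  where "U_scalars \<alpha> q = (\<lambda>c. U_proj \<alpha> q (const c)) ` Qq q"


section \<open>The split iquantum group\<close>

definition B_gen ::
    "('i \<Rightarrow> 'v::euclidean_space) \<Rightarrow> complex \<Rightarrow> ('i \<Rightarrow> complex) \<Rightarrow> 'i \<Rightarrow> 'i qgen falg set"
  where "B_gen \<alpha> q \<xi> i =
    U_proj \<alpha> q (gen (GenF i) + const (\<xi> i) * gen (GenE i) * gen (GenKinv i))"

text \<open>
  Adjoining the scalars makes the generated subring the generated unital subalgebra.
\<close>

definition U_iota ::
    "('i \<Rightarrow> 'v::euclidean_space) \<Rightarrow> complex \<Rightarrow> ('i \<Rightarrow> complex) \<Rightarrow> 'i qgen falg set set"
  where "U_iota \<alpha> q \<xi> = generate_ring (U \<alpha> q) (U_scalars \<alpha> q \<union> range (B_gen \<alpha> q \<xi>))"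

definition B_word ::
    "('i \<Rightarrow> 'v::euclidean_space) \<Rightarrow> complex \<Rightarrow> ('i \<Rightarrow> complex) \<Rightarrow> 'i list \<Rightarrow> 'i qgen falg set"
  where "B_word \<alpha> q \<xi> w = foldr (\<lambda>i x. B_gen \<alpha> q \<xi> i \<otimes>\<^bsub>U \<alpha> q\<^esub> x) w \<one>\<^bsub>U \<alpha> q\<^esub>"

definition B_lin ::
    "('i \<Rightarrow> 'v::euclidean_space) \<Rightarrow> complex \<Rightarrow> ('i \<Rightarrow> complex) \<Rightarrow> 'i falg \<Rightarrow> 'i qgen falg set"
  where "B_lin \<alpha> q \<xi> x =
    (\<Oplus>\<^bsub>U \<alpha> q\<^esub>w\<in>Poly_Mapping.keys x. U_proj \<alpha> q (const (Poly_Mapping.lookup x w)) \<otimes>\<^bsub>U \<alpha> q\<^esub> B_word \<alpha> q \<xi> (letters w))"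

definition iota_good ::
    "('i::linorder \<Rightarrow> 'v::euclidean_space) \<Rightarrow> complex \<Rightarrow> ('i \<Rightarrow> complex) \<Rightarrow> 'i list \<Rightarrow> bool"
  where "iota_good \<alpha> q \<xi> g \<longleftrightarrow> g \<noteq> [] \<and>
    \<not> (\<exists>ws. (\<forall>w\<in>set ws. w \<prec>\<^sub>w g) \<and>
         B_word \<alpha> q \<xi> g \<in> ring.Span (U \<alpha> q) (U_scalars \<alpha> q) (map (B_word \<alpha> q \<xi>) ws))"

definition GL ::
    "('i::linorder \<Rightarrow> 'v::euclidean_space) \<Rightarrow> complex \<Rightarrow> ('i \<Rightarrow> complex) \<Rightarrow> 'i list set"
  where "GL \<alpha> q \<xi> = {l. lyndon l \<and> iota_good \<alpha> q \<xi> l}"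

definition GL_sequences ::
    "('i::linorder \<Rightarrow> 'v::euclidean_space) \<Rightarrow> complex \<Rightarrow> ('i \<Rightarrow> complex) \<Rightarrow> 'i list list set"
  where "GL_sequences \<alpha> q \<xi> =
    {ls. set ls \<subseteq> GL \<alpha> q \<xi> \<and> sorted_wrt (\<lambda>l l'. ord_class.lexordp_eq l' l) ls}"


section \<open>Bases\<close>

definition indexed_basis ::
    "('a, 'b) ring_scheme \<Rightarrow> 'a set \<Rightarrow> 'a set \<Rightarrow> 's set \<Rightarrow> ('s \<Rightarrow> 'a) \<Rightarrow> bool"
  where "indexed_basis R K V S b \<longleftrightarrow>
    b ` S \<subseteq> V \<and>
    (\<forall>ss. distinct ss \<and> set ss \<subseteq> S \<longrightarrow> ring.independent R K (map b ss)) \<and>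
    (\<forall>x\<in>V. \<exists>ss. set ss \<subseteq> S \<and> x \<in> ring.Span R K (map b ss))"

end

theory Submission
  imports Defs "HOL-Library.Function_Algebras"
begin

text \<open>
  Write \<open>K\<close> for the base field \<open>Qq q\<close>, \<open>B\<^sub>w\<close> for the image of a word \<open>w\<close> in the iquantum group, and
  \<open>deg\<close> for the length of words. Both families have the form \<open>B\<^sub>\<beta>\<close> where \<open>\<beta>\<close> is a word
  \<open>l\<^sub>1 \<dots> l\<^sub>m\<close> plus lexicographically larger words of the same length; for the bracketings this holds
  because a Lyndon word \<open>uv\<close> with Lyndon factors satisfies \<open>uv < vu\<close>. Everything is proved for such
  families.

  Spanning is rewriting along the well-founded order \<open>\<prec>\<close>. Every word has a unique nonincreasing
  factorisation into Lyndon words. If a factor is not good, it is a combination of \<open>\<prec>\<close>-smaller words and,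
  as \<open>\<prec>\<close> is compatible with concatenation, so is the whole word. If all factors are good,
  the word is an index and its \<open>\<beta>\<close> differs from it by \<open>\<prec>\<close>-smaller words
  (lemma \<open>Bw_reachable\<close>).

  Independence comes from functionals. Call a complex function on words a Serre functional if, extended
  linearly to the free algebra, it vanishes on the two-sided ideal generated by the quantum Serre
  elements. Two facts connect these functionals with the iquantum group.

  First, if a combination \<open>p\<close> of words of length at most \<open>k\<close> satisfies \<open>B\<^sub>p = 0\<close>, then every Serre
  functional supported on words of length \<open>k\<close> vanishes on \<open>p\<close> (lemma
  \<open>serre_dual_annihilates_leading_part\<close>). For the quantum group acts on the Serre functionals as on the dual of
  \<open>U\<^sup>-\<close>, regarded as a quotient of a Verma module. The value of \<open>F\<^sub>i f\<close> at a word \<open>w\<close> is that of \<open>f\<close> at the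
  longer word \<open>i w\<close>, whereas \<open>E\<^sub>i f\<close> involves \<open>f\<close> only at words obtained from \<open>w\<close> by removing a letter.

  Second, for each good Lyndon word \<open>l\<close> there is a Serre functional supported on words of length
  \<open>deg l\<close> that are at most \<open>l\<close>, and nonzero at \<open>l\<close> (lemma \<open>good_lyndon_functional\<close>). By goodness a
  functional on the quantum group separates \<open>B\<^sub>l\<close> from all \<open>B\<^sub>w\<close> with \<open>w \<prec> l\<close>; restricting
  \<open>w \<mapsto> B\<^sub>w\<close> to words of length \<open>deg l\<close> gives the function. It is a Serre functional because the Serre
  element in the \<open>B\<^sub>i\<close> equals a combination of shorter words (lemma \<open>iserre_relation\<close>). This last relation
  comes from a three-term recursion for iterated q-commutators with \<open>B = F + Y\<close>,
  \<open>Y = \<xi> E K\<^sup>-\<^sup>1\<close>: it expresses the Serre element as a continuant in left and right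
  multiplication by \<open>B\<close>. Exchanging \<open>F\<close> and \<open>Y\<close> reverses the order of the recursion, and continuants are
  invariant under reversal; so one and the same continuant annihilates both summands of \<open>B\<^sub>j\<close>.

  Serre functionals are closed under the quantum shuffle product, because the Serre elements are
  primitive up to a twist. If \<open>l \<ge> l\<^sub>2 \<ge> \<dots> \<ge> l\<^sub>m\<close> are Lyndon words, the largest shuffle of \<open>l\<close> with
  \<open>l\<^sub>2 \<dots> l\<^sub>m\<close> is \<open>l l\<^sub>2 \<dots> l\<^sub>m\<close>, and it arises once for each number \<open>t\<close> of leading factors equal
  to \<open>l\<close> that \<open>l\<close> is moved across, with weight \<open>q^(t (l,l))\<close>. The geometric sum of these weights is
  not zero since \<open>q\<close> is not a root of unity. Hence every index \<open>l\<^sub>1 \<dots> l\<^sub>m\<close> is the largest word in the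
  support of a Serre functional (lemma \<open>good_product_functional\<close>). Applied to a linear relation, the
  functional of the lexicographically smallest word of maximal length isolates one coefficient, which is
  therefore zero.

  The functionals take complex values whereas goodness and independence refer to \<open>K\<close>; lemma
  \<open>flatness\<close> mediates between the two fields.
\<close>

section \<open>Lyndon words\<close>

interpretation lex: linorder "ord_class.lexordp_eq :: 'i::linorder list \<Rightarrow> 'i list \<Rightarrow> bool" "ord_class.lexordp"
  by (rule lexordp_linorder)

abbreviation lex_le :: "'i::linorder list \<Rightarrow> 'i list \<Rightarrow> bool" (infix "\<le>\<^sub>l" 50) where "x \<le>\<^sub>l y \<equiv> ord_class.lexordp_eq x y"
abbreviation lex_less :: "'i::linorder list \<Rightarrow> 'i list \<Rightarrow> bool" (infix "<\<^sub>l" 50) where "x <\<^sub>l y \<equiv> ord_class.lexordp x y"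

text \<open>
  The case of strict comparison that is decided by a letter, as opposed to one word being a proper prefix
  of the other; it survives appending arbitrary words on the right.
\<close>

definition lex_diff :: "'i::linorder list \<Rightarrow> 'i list \<Rightarrow> bool"
  where "lex_diff x y \<longleftrightarrow> (\<exists>us a b vs ws. a < b \<and> x = us @ a # vs \<and> y = us @ b # ws)"

lemma lex_less_cases:
  assumes "x <\<^sub>l y"
  shows "(\<exists>z. z \<noteq> [] \<and> y = x @ z) \<or> lex_diff x y"
  using assms unfolding lexordp_iff lex_diff_def by blast

lemma lex_diff_append: "lex_diff x y \<Longrightarrow> x @ p <\<^sub>l y @ q"
  unfolding lex_diff_def lexordp_iff by fastforce

lemma lex_append_cancel: "us @ x <\<^sub>l us @ y \<longleftrightarrow> x <\<^sub>l y"
  by (induction us) auto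

lemma lex_le_append_cancel: "us @ x \<le>\<^sub>l us @ y \<longleftrightarrow> x \<le>\<^sub>l y"
  by (induction us) auto

lemma lex_less_same_length_append:
  "x <\<^sub>l y \<Longrightarrow> length x = length y \<Longrightarrow> x @ p <\<^sub>l y @ q"
  using lex_less_cases[of x y] lex_diff_append by fastforce

lemma lex_le_same_length_append:
  assumes "x \<le>\<^sub>l y" "length x = length y" "p \<le>\<^sub>l q" shows "x @ p \<le>\<^sub>l y @ q"
  using assms lex_less_same_length_append[of x y p q] lex_le_append_cancel[of x p q]
  by (auto simp: lex.le_less)

lemma lex_take_mono: "x \<le>\<^sub>l y \<Longrightarrow> take n x \<le>\<^sub>l take n y"
proof (induction x arbitrary: y n)
  case (Cons a x)
  then show ?case by (cases y; cases n) auto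
qed simp

text \<open>
  A Lyndon word is longer than its proper suffixes, hence not a prefix of any of them.
\<close>

lemma lyndon_suffix_diff:
  assumes "lyndon (u @ v)" "u \<noteq> []" "v \<noteq> []"
  shows "lex_diff (u @ v) v"
proof -
  have "u @ v <\<^sub>l v"
    using assms unfolding lyndon_def
    by (metis append_eq_conv_conj length_append length_greater_0_conv less_add_same_cancel1)
  moreover have "\<not> (\<exists>z. v = (u @ v) @ z)"
  proof
    assume "\<exists>z. v = (u @ v) @ z"
    then obtain z where "v = (u @ v) @ z" ..
    then have "length v = length ((u @ v) @ z)" by (rule arg_cong)
    then show False using assms(2) by simp
  qed
  ultimately show ?thesis using lex_less_cases by blast
qed

lemma lyndon_suffix_less:
  assumes "lyndon (u @ v)" "u \<noteq> []" "v \<noteq> []"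
  shows "u @ v <\<^sub>l v"
  using lex_diff_append[OF lyndon_suffix_diff[OF assms], of "[]" "[]"] by simp

lemma lyndonI:
  assumes "w \<noteq> []" "\<And>u v. w = u @ v \<Longrightarrow> u \<noteq> [] \<Longrightarrow> v \<noteq> [] \<Longrightarrow> w <\<^sub>l v"
  shows "lyndon w"
  unfolding lyndon_def
proof (intro conjI allI impI)
  fix j assume j: "0 < j \<and> j < length w"
  show "w <\<^sub>l drop j w"
    by (rule assms(2)[of "take j w" "drop j w"]) (use j in auto)
qed (fact assms(1))

text \<open>
  The point is \<open>u @ v < v\<close>: if \<open>v = u @ z\<close>, cancel \<open>u\<close> and use \<open>v < z\<close>; otherwise a letter decides. Suffixes
  that start inside \<open>u\<close> are then larger by a letter of \<open>u\<close>, those inside \<open>v\<close> are larger than \<open>v\<close>.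
\<close>

lemma lyndon_append:
  assumes "lyndon u" "lyndon v" "u <\<^sub>l v"
  shows "lyndon (u @ v)"
proof (rule lyndonI)
  show "u @ v \<noteq> []" using assms(1) by (simp add: lyndon_def)
  have uv: "u \<noteq> []" "v \<noteq> []" using assms by (auto simp: lyndon_def)
  have less_v: "u @ v <\<^sub>l v"
    using lex_less_cases[OF assms(3)]
  proof
    assume "\<exists>z. z \<noteq> [] \<and> v = u @ z"
    then obtain z where z: "z \<noteq> []" "v = u @ z" by blast
    then have "v <\<^sub>l z" using lyndon_suffix_less[of u z] assms(2) uv by simp
    then have "u @ v <\<^sub>l u @ z" by (simp add: lex_append_cancel)
    with z show ?thesis by simp
  next
    assume "lex_diff u v"
    from lex_diff_append[OF this, of v "[]"] show ?thesis by simp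
  qed
  fix a b assume ab: "u @ v = a @ b" "a \<noteq> []" "b \<noteq> []"
  then consider (1) c where "u = a @ c" "c \<noteq> []" "b = c @ v" | (2) "b = v" | (3) c where "c \<noteq> []" "v = c @ b"
    by (auto simp: append_eq_append_conv2)
  then show "u @ v <\<^sub>l b"
  proof cases
    case 1
    then show ?thesis using lyndon_suffix_diff[of a c] assms(1) ab lex_diff_append by blast
  next
    case 2 then show ?thesis using less_v by simp
  next
    case 3
    then show ?thesis using lyndon_suffix_less[of c b] assms(2) ab less_v by auto
  qed
qed

abbreviation nonincreasing :: "'i::linorder list list \<Rightarrow> bool"
  where "nonincreasing ls \<equiv> sorted_wrt (\<lambda>l l'. l' \<le>\<^sub>l l) ls"

text \<open>
  As long as the new factor is smaller than its successor, the two merge into a Lyndon word.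
\<close>

lemma lyndon_factor_Cons:
  assumes "lyndon l" "list_all lyndon ls" "nonincreasing ls"
  shows "\<exists>ls'. list_all lyndon ls' \<and> nonincreasing ls' \<and> concat ls' = l @ concat ls"
  using assms
proof (induction ls arbitrary: l)
  case Nil
  then show ?case by (intro exI[of _ "[l]"]) simp
next
  case (Cons k ls)
  show ?case
  proof (cases "k \<le>\<^sub>l l")
    case True
    with Cons.prems show ?thesis
      by (intro exI[of _ "l # k # ls"]) (auto intro: lex.order_trans)
  next
    case False
    then have "lyndon (l @ k)" using Cons.prems by (intro lyndon_append) auto
    from Cons.IH[OF this] Cons.prems show ?thesis by auto
  qed
qed

lemma lyndon_factorization_exists:
  "\<exists>ls. list_all lyndon ls \<and> nonincreasing ls \<and> concat ls = w"
proof (induction w)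
  case Nil
  then show ?case by (intro exI[of _ "[]"]) simp
next
  case (Cons a w)
  then obtain ls where "list_all lyndon ls" "nonincreasing ls" "concat ls = w" by blast
  moreover have "lyndon [a]" by (auto simp: lyndon_def)
  ultimately show ?case using lyndon_factor_Cons[of "[a]" ls] by auto
qed

lemma prefix_of_concat_ends_in_prefix:
  assumes "t @ x = concat r" "t \<noteq> []"
  shows "\<exists>s p y. t = s @ p \<and> p \<noteq> [] \<and> p @ y \<in> set r"
  using assms
proof (induction r arbitrary: t)
  case (Cons k r)
  then obtain us where "t = k @ us \<and> us @ x = concat r \<or> t @ us = k"
    by (auto simp: append_eq_append_conv2)
  then consider (1) "\<exists>y. k = t @ y" | (2) s where "s \<noteq> []" "t = k @ s" "s @ x = concat r"
    by (cases "us = []") auto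
  then show ?case
  proof cases
    case 1
    then obtain y where "k = t @ y" ..
    then show ?thesis using Cons.prems by (intro exI[of _ "[]"] exI[of _ t] exI[of _ y]) auto
  next
    case 2
    from Cons.IH[OF this(3,1)] obtain s' p y where "s = s' @ p" "p \<noteq> []" "p @ y \<in> set r" by blast
    with 2 show ?thesis by (intro exI[of _ "k @ s'"] exI[of _ p] exI[of _ y]) auto
  qed
qed simp

text \<open>
  A longer Lyndon prefix \<open>l'\<close> would end in a nonempty prefix \<open>p\<close> of a later factor \<open>k\<close>, and then
  \<open>l' < p \<le> k \<le> l \<le> l'\<close>.
\<close>

lemma lyndon_prefix_le_first_factor:
  assumes "lyndon l'" "l' @ x = concat (l # r)" "nonincreasing (l # r)" "l \<noteq> []"
  shows "length l' \<le> length l"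
proof (rule ccontr)
  assume "\<not> ?thesis"
  with assms(2) obtain t where t: "l' = l @ t" "t \<noteq> []" "t @ x = concat r"
    by (auto simp: append_eq_append_conv2)
  obtain s p y where p: "t = s @ p" "p \<noteq> []" "p @ y \<in> set r"
    using prefix_of_concat_ends_in_prefix[OF t(3,2)] by blast
  have "l' <\<^sub>l p" using lyndon_suffix_less[of "l @ s" p] assms(1,4) t p by auto
  also have "p \<le>\<^sub>l p @ y" using lexordp_eq_pref by blast
  also have "p @ y \<le>\<^sub>l l" using assms(3) p(3) by auto
  also have "l \<le>\<^sub>l l'" using t lexordp_eq_pref by blast
  finally show False by simp
qed

text \<open>
  The first factor is forced: it is the longest Lyndon prefix of the concatenation.
\<close>

lemma lyndon_factorization_unique:
  assumes "concat ls = concat ls'" "list_all lyndon ls" "list_all lyndon ls'"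
    "nonincreasing ls" "nonincreasing ls'"
  shows "ls = ls'"
  using assms
proof (induction ls arbitrary: ls')
  case Nil
  then show ?case by (cases ls') (auto simp: lyndon_def)
next
  case (Cons l ls)
  from Cons.prems obtain l' r where ls': "ls' = l' # r" by (cases ls') (auto simp: lyndon_def)
  have "l \<noteq> []" "l' \<noteq> []" using Cons.prems ls' by (auto simp: lyndon_def)
  moreover have "l @ concat ls = l' @ concat r" using Cons.prems ls' by simp
  moreover from this have "length l \<le> length l'"
    by (intro lyndon_prefix_le_first_factor[of l "concat ls" l' r])
       (use Cons.prems ls' \<open>l' \<noteq> []\<close> in auto)
  moreover have "length l' \<le> length l"
    by (rule lyndon_prefix_le_first_factor[of l' "concat r" l ls])
       (use Cons.prems ls' \<open>l \<noteq> []\<close> in auto)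
  ultimately have "length l = length l'" by simp
  with \<open>l @ concat ls = l' @ concat r\<close> have "l = l'" "concat ls = concat r" by auto
  with Cons.IH[of r] Cons.prems ls' show ?case by simp
qed

text \<open>
  Factor the remainder after the longest proper Lyndon prefix \<open>p\<close> into nonincreasing Lyndon words, with first
  factor \<open>m\<close>. With two or more factors, either \<open>p < m\<close> and \<open>p @ m\<close> is a longer proper Lyndon prefix, or the
  last factor is \<open>\<le> m \<le> p \<le> l\<close> although \<open>l\<close> is smaller than each of its proper suffixes.
\<close>

lemma lyndon_standard_factor:
  assumes "lyndon l" "2 \<le> length l"
  shows "lyndon (take (longest_lyndon_prefix l) l)" "lyndon (drop (longest_lyndon_prefix l) l)"
proof -
  let ?S = "{k. 0 < k \<and> k < length l \<and> lyndon (take k l)}"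
  let ?k = "longest_lyndon_prefix l"
  have fin: "finite ?S" by simp
  have "1 \<in> ?S" using assms by (auto simp: lyndon_def)
  with fin have k: "?k \<in> ?S" unfolding longest_lyndon_prefix_def by (intro Max_in) auto
  then show l1: "lyndon (take ?k l)" by simp
  obtain ms where ms: "list_all lyndon ms" "nonincreasing ms" "concat ms = drop ?k l"
    using lyndon_factorization_exists by blast
  then obtain m ms' where m: "ms = m # ms'" using k by (cases ms) auto
  have l: "l = take ?k l @ m @ concat ms'" using ms m by simp
  have "ms' = []"
  proof (rule ccontr)
    assume ne: "ms' \<noteq> []"
    show False
    proof (cases "take ?k l <\<^sub>l m")
      case True
      then have ly: "lyndon (take ?k l @ m)" using l1 ms m by (intro lyndon_append) auto
      have ne': "concat ms' \<noteq> []" using ne ms m by (cases ms') (auto simp: lyndon_def)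
      let ?j = "length (take ?k l @ m)"
      have tk: "take ?j l = take ?k l @ m" using l by (metis append.assoc append_eq_conv_conj)
      have "length l = ?j + length (concat ms')" using l by (metis append.assoc length_append)
      then have "?j \<in> ?S" using ne' ly tk k by auto
      then have "?j \<le> ?k" unfolding longest_lyndon_prefix_def by (intro Max_ge fin)
      moreover have "m \<noteq> []" using ms m by (auto simp: lyndon_def)
      ultimately show False using k by simp
    next
      case False
      have "last ms' \<in> set ms'" using ne by simp
      then have "last ms' \<le>\<^sub>l m" "last ms' \<noteq> []" using ms m by (auto simp: list_all_iff lyndon_def)
      have "l = (take ?k l @ m @ concat (butlast ms')) @ last ms'"
      proof -
        have "concat ms' = concat (butlast ms' @ [last ms'])" using ne by simp
        then have "concat ms' = concat (butlast ms') @ last ms'" by (simp only: concat_append) simp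
        with l show ?thesis by simp
      qed
      then have "l <\<^sub>l last ms'"
        using lyndon_suffix_less[of "take ?k l @ m @ concat (butlast ms')" "last ms'"] assms(1) \<open>last ms' \<noteq> []\<close> k
        by auto
      also note \<open>last ms' \<le>\<^sub>l m\<close>
      also have "m \<le>\<^sub>l take ?k l" using False by simp
      also have "take ?k l \<le>\<^sub>l l" by (metis append_take_drop_id lexordp_eq_pref)
      finally show False by simp
    qed
  qed
  with ms m show "lyndon (drop ?k l)" by auto
qed

text \<open>
  While the factors are equal to \<open>l\<close> or differ from it in a letter this is immediate. A factor \<open>x\<close> that is a
  proper prefix of \<open>l = x @ t\<close> is handled by induction, since \<open>l \<le> t\<close>.
\<close>

lemma concat_take_le:
  assumes "lyndon l" "\<forall>x\<in>set ls. x \<le>\<^sub>l l" "j \<le> length l" "j \<le> length (concat ls)"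
  shows "take j (concat ls) \<le>\<^sub>l take j l"
  using assms(2-)
proof (induction ls arbitrary: j)
  case Nil then show ?case by simp
next
  case (Cons x ls)
  then have "x \<le>\<^sub>l l" by simp
  then consider "x = l" | t where "t \<noteq> []" "l = x @ t" | "lex_diff x l"
    using lex_less_cases[of x l] by (auto simp: lex.le_less)
  then show ?case
  proof cases
    case 1 with Cons.prems show ?thesis by simp
  next
    case 3
    from lex_take_mono[OF lex.less_imp_le[OF lex_diff_append[OF this, of "concat ls" "[]"]], of j]
    show ?thesis by simp
  next
    case 2
    show ?thesis
    proof (cases "j \<le> length x \<or> x = []")
      case True with 2 Cons show ?thesis by auto
    next
      case False
      let ?j = "j - length x"
      have "take ?j (concat ls) \<le>\<^sub>l take ?j l" using Cons by auto
      also have "l \<le>\<^sub>l t" using lyndon_suffix_less[of x t] 2 assms(1) False by auto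
      then have "take ?j l \<le>\<^sub>l take ?j t" by (rule lex_take_mono)
      finally show ?thesis using 2 False by (simp add: lex_le_append_cancel)
    qed
  qed
qed

section \<open>Shuffles\<close>

text \<open>
  A shuffle of two words, encoded by the list of choices between them. Splitting this list splits the shuffle, which
  is how the extremal shuffles are found below.
\<close>

fun interleave :: "bool list \<Rightarrow> 'a list \<Rightarrow> 'a list \<Rightarrow> 'a list" where
  "interleave (True # S) (x # a) b = x # interleave S a b"
| "interleave (False # S) a (y # b) = y # interleave S a b"
| "interleave _ _ _ = []"

abbreviation "trues S \<equiv> count_list S True"
abbreviation "falses S \<equiv> count_list S False"

lemma trues_falses: "trues S + falses S = length S"
  by (induction S) auto

lemma no_trues_no_falses: "trues S = 0 \<Longrightarrow> falses S = 0 \<Longrightarrow> S = []"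
  using trues_falses[of S] by auto

lemma length_interleave: "length a = trues S \<Longrightarrow> length b = falses S \<Longrightarrow> length (interleave S a b) = length S"
  by (induction S a b rule: interleave.induct) (auto dest: no_trues_no_falses)

lemma interleave_append:
  "length a = trues S \<Longrightarrow> length b = falses S \<Longrightarrow> interleave (S @ S') (a @ a') (b @ b') = interleave S a b @ interleave S' a' b'"
  by (induction S a b rule: interleave.induct) (auto dest: no_trues_no_falses)

lemma interleave_split:
  assumes "length a = trues (S @ S')" "length b = falses (S @ S')"
  shows "interleave (S @ S') a b = interleave S (take (trues S) a) (take (falses S) b) @ interleave S' (drop (trues S) a) (drop (falses S) b)"
  using interleave_append[of "take (trues S) a" S "take (falses S) b" S' "drop (trues S) a" "drop (falses S) b"] assms
  by simp

lemma interleave_swap: "interleave (map Not S) b a = interleave S a b"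
  by (induction S a b rule: interleave.induct) auto

lemma count_map_Not [simp]: "trues (map Not S) = falses S" "falses (map Not S) = trues S"
  by (induction S) auto

lemma interleave_mono:
  assumes "length a = trues S" "length b = falses S" "length a' = length a" "length b' = length b"
    "a \<le>\<^sub>l a'" "b \<le>\<^sub>l b'"
  shows "interleave S a b \<le>\<^sub>l interleave S a' b' \<and> (interleave S a b = interleave S a' b' \<longrightarrow> a = a' \<and> b = b')"
  using assms
proof (induction S a b arbitrary: a' b' rule: interleave.induct)
  case (1 S x a b)
  then show ?case by (cases a') auto
next
  case (2 S a y b)
  then show ?case by (cases b') auto
qed (auto)

lemma lyndon_suffix_first_difference:
  assumes "lyndon l" "0 < r" "r < length l"
  obtains p where "p < length l - r" "take p (drop r l) = take p l" "l ! p < drop r l ! p"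
proof -
  have "lex_diff (take r l @ drop r l) (drop r l)"
    by (rule lyndon_suffix_diff) (use assms in auto)
  then obtain us a b vs ws where *: "a < b" "l = us @ a # vs" "drop r l = us @ b # ws"
    unfolding lex_diff_def by auto
  show ?thesis
  proof (rule that[of "length us"])
    have "length (drop r l) = length (us @ b # ws)" using *(3) by (rule arg_cong)
    then show "length us < length l - r" by simp
    show "take (length us) (drop r l) = take (length us) l" using *(2,3) by simp
    have "l ! length us = a" using *(2) by simp
    moreover have "drop r l ! length us = b" using *(3) by simp
    ultimately show "l ! length us < drop r l ! length us" using *(1) by simp
  qed
qed

text \<open>
  A factor \<open>l[r, r+i)\<close> of a Lyndon word shuffled with the prefix \<open>l[0, j)\<close> cannot exceed the factor
  \<open>l[r, r+i+j)\<close> that simply continues the first one. Let \<open>p\<close> be the first position at which the suffix at \<open>r\<close> is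
  larger than \<open>l\<close>. Up to \<open>p\<close> the suffix and \<open>l\<close> agree, so that the bound for \<open>r = 0\<close> applies, and at
  \<open>p\<close> the suffix wins. For \<open>r = 0\<close> the first letter is \<open>l ! 0\<close> whichever word it is taken from; after exchanging the words if necessary, the
  situation is the one for \<open>r = 1\<close> and a shorter \<open>S\<close>.
  The strictness clause is needed below only for shuffles that exhaust \<open>l\<close>.
\<close>

lemma interleave_suffix_prefix:
  assumes "lyndon l"
  shows "r + length S \<le> length l \<Longrightarrow>
    interleave S (take (trues S) (drop r l)) (take (falses S) l) \<le>\<^sub>l take (length S) (drop r l) \<and>
    (r + length S = length l \<and> 0 < falses S \<and> (0 < r \<or> 0 < trues S) \<longrightarrow>
      interleave S (take (trues S) (drop r l)) (take (falses S) l) \<noteq> take (length S) (drop r l))"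
proof (induction "(r, S)" arbitrary: r S rule: wf_induct_rule[OF wf_measures[of "[\<lambda>(r, S). r + length S, \<lambda>(r, S). length S]"]])
  case (1 r S)
  note IH = 1(1) and le = 1(2)
  have tf: "trues S + falses S = length S" by (rule trues_falses)
  show ?case
  proof (cases S)
    case Nil then show ?thesis by simp
  next
    case S: (Cons s S')
    with le have r: "r < length l" by simp
    have dr: "drop r l = l ! r # drop (Suc r) l" using r by (simp add: Cons_nth_drop_Suc)
    show ?thesis
    proof (cases s)
      case True
      from IH[of "Suc r" S'] le S True dr show ?thesis by auto
    next
      case s: False
      show ?thesis
      proof (cases "r = 0")
        case True
        let ?T = "map Not S'"
        have l: "l = l ! 0 # drop (Suc 0) l" using dr True by simp
        have eq: "interleave S (take (trues S) l) (take (falses S) l) = l ! 0 # interleave ?T (take (trues ?T) (drop (Suc 0) l)) (take (falses ?T) l)"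
        proof -
          have "take (falses S) l = l ! 0 # take (falses S') (drop (Suc 0) l)"
            by (subst l) (simp add: S s)
          then show ?thesis by (simp add: S s interleave_swap)
        qed
        have tk: "take (length S) l = l ! 0 # take (length ?T) (drop (Suc 0) l)"
          by (subst l) (simp add: S)
        have "interleave ?T (take (trues ?T) (drop (Suc 0) l)) (take (falses ?T) l) \<le>\<^sub>l take (length ?T) (drop (Suc 0) l) \<and>
          (Suc 0 + length ?T = length l \<and> 0 < falses ?T \<and> (0 < Suc 0 \<or> 0 < trues ?T) \<longrightarrow>
            interleave ?T (take (trues ?T) (drop (Suc 0) l)) (take (falses ?T) l) \<noteq> take (length ?T) (drop (Suc 0) l))"
          by (rule IH) (use le S s True in auto)
        moreover have "falses ?T = trues S" "length S = Suc (length ?T)" using S s by auto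
        ultimately show ?thesis
          unfolding True drop_0 eq tk lexordp_eq_simps list.inject by auto
      next
        case r0: False
        obtain p where p: "p < length l - r" "take p (drop r l) = take p l" "l ! p < drop r l ! p"
          using lyndon_suffix_first_difference[OF assms _ r] r0 by blast
        show ?thesis
        proof (cases "length S \<le> p")
          case True
          have "take n (drop r l) = take n l" if "n \<le> length S" for n
            using arg_cong[OF p(2), of "take n"] True that by (simp add: min_def split: if_splits)
          then have "take (trues S) (drop r l) = take (trues S) l" "take (length S) (drop r l) = take (length S) l"
            using tf by auto
          with IH[of 0 S] r0 le p True show ?thesis by auto
        next
          case False
          let ?A = "take (Suc p) S" and ?B = "drop (Suc p) S"
          let ?a = "take (trues S) (drop r l)" and ?b = "take (falses S) l"
          have cnt: "trues S = trues ?A + trues ?B" "falses S = falses ?A + falses ?B"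
            by (metis append_take_drop_id count_list_append)+
          have lenA: "length ?A = Suc p" using False by simp
          have fA: "trues ?A \<le> p"
            using trues_falses[of ?A] lenA S s by simp
          have lens: "length ?a = trues S" "length ?b = falses S" using tf le by auto
          have split: "interleave S ?a ?b = interleave ?A (take (trues ?A) ?a) (take (falses ?A) ?b) @ interleave ?B (drop (trues ?A) ?a) (drop (falses ?A) ?b)"
            using interleave_split[of ?a ?A ?B ?b] lens by simp
          have ta: "take (trues ?A) ?a = take (trues ?A) l"
            using arg_cong[OF p(2), of "take (trues ?A)"] fA cnt by (simp add: min_def split: if_splits)
          have tb: "take (falses ?A) ?b = take (falses ?A) l" using cnt by simp
          have lenM: "length (interleave ?A (take (trues ?A) l) (take (falses ?A) l)) = Suc p"
            using trues_falses[of ?A] lenA le tf cnt by (subst length_interleave) auto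
          have pl: "p < length l" "p < length (drop r l)" using p by auto
          have "interleave ?A (take (trues ?A) l) (take (falses ?A) l) \<le>\<^sub>l take (Suc p) l"
            using IH[of 0 ?A] r0 False le lenA by auto
          also have "take (Suc p) l = take p l @ [l ! p]" using pl by (simp add: take_Suc_conv_app_nth)
          also have "\<dots> <\<^sub>l take p (drop r l) @ [drop r l ! p]" using p by (simp add: lex_append_cancel)
          also have "\<dots> = take (Suc p) (drop r l)" using pl(2) by (simp only: take_Suc_conv_app_nth)
          finally have lt: "interleave ?A (take (trues ?A) l) (take (falses ?A) l) <\<^sub>l take (Suc p) (drop r l)" .
          have tk: "take (length S) (drop r l) = take (Suc p) (drop r l) @ take (length S - Suc p) (drop (Suc p) (drop r l))"
            using take_add[of "Suc p" "length S - Suc p" "drop r l"] False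
            by (metis add_diff_inverse_nat linorder_not_less less_Suc_eq_le not_less_eq_eq Suc_le_eq)
          have "interleave S ?a ?b <\<^sub>l take (length S) (drop r l)"
            unfolding split ta tb tk
            by (rule lex_less_same_length_append[OF lt]) (use lenM pl in auto)
          then show ?thesis by (auto simp: lex.less_imp_le)
        qed
      qed
    qed
  qed
qed

text \<open>
  The shuffle that inserts a word of length \<open>L\<close> as one block after the first \<open>t\<close> blocks of length \<open>L\<close> of a word of length \<open>n\<close>.
\<close>

definition block_pattern :: "nat \<Rightarrow> nat \<Rightarrow> nat \<Rightarrow> bool list"
  where "block_pattern L n t = replicate (t * L) False @ replicate L True @ replicate (n - t * L) False"

lemma count_list_eq_length: "count_list S a = length S \<longleftrightarrow> S = replicate (length S) a"
proof (induction S)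
  case (Cons b S)
  have "count_list S a \<le> length S" by (rule count_le_length)
  then show ?case using Cons by auto
qed simp

text \<open>
  Look at the first \<open>|l|\<close> choices. If they use letters of both words, the first \<open>|l|\<close> letters of the shuffle are
  already smaller than \<open>l\<close>. If they all take from \<open>l\<close>, the shuffle is the concatenation. If they all take from the
  second word, the shuffle can only compete when that word begins with \<open>l\<close>, which forces its first factor
  to be \<open>l\<close>; this block is then split off.
\<close>

lemma interleave_lyndon_le:
  assumes "lyndon l"
  shows "list_all lyndon ls \<Longrightarrow> nonincreasing ls \<Longrightarrow> \<forall>x\<in>set ls. x \<le>\<^sub>l l \<Longrightarrow>
    trues S = length l \<Longrightarrow> falses S = length (concat ls) \<Longrightarrow>
    interleave S l (concat ls) \<le>\<^sub>l l @ concat ls \<and>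
    (interleave S l (concat ls) = l @ concat ls \<longrightarrow>
      (\<exists>t\<le>length (takeWhile ((=) l) ls). S = block_pattern (length l) (length (concat ls)) t))"
proof (induction ls arbitrary: S)
  case Nil
  then have "length S = trues S" using trues_falses[of S] by simp
  then have S: "S = replicate (length l) True" using count_list_eq_length[of S True] Nil by simp
  have "interleave (replicate (length x) True) x [] = x" for x :: "'a list" by (induction x) auto
  then show ?case by (auto simp: S block_pattern_def)
next
  case (Cons k ls S)
  let ?u = "concat (k # ls)" and ?L = "length l"
  let ?A = "take ?L S" and ?B = "drop ?L S"
  have lenS: "length S = ?L + length ?u" using trues_falses[of S] Cons.prems by simp
  have lenA: "length ?A = ?L" using lenS by simp
  have cnt: "trues S = trues ?A + trues ?B" "falses S = falses ?A + falses ?B"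
    by (metis append_take_drop_id count_list_append)+
  have tfA: "trues ?A + falses ?A = ?L" using trues_falses[of ?A] lenA by simp
  have split: "interleave S l ?u = interleave ?A (take (trues ?A) l) (take (falses ?A) ?u) @ interleave ?B (drop (trues ?A) l) (drop (falses ?A) ?u)"
    using interleave_split[of l ?A ?B ?u] Cons.prems by simp
  have le: "take (falses ?A) ?u \<le>\<^sub>l take (falses ?A) l"
    by (rule concat_take_le) (use assms Cons.prems cnt tfA in auto)
  have interleave_all_F: "interleave (replicate (length y) False) x y = y" for x y :: "'a list"
    by (induction y) auto
  have interleave_all_T: "interleave (replicate (length x) True) x y = x" for x y :: "'a list"
    by (induction x) auto
  have Lpos: "0 < ?L" using assms by (simp add: lyndon_def)
  show ?case
  proof (cases "falses ?A = 0 \<or> trues ?A = 0")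
    case False
    have "interleave ?A (take (trues ?A) l) (take (falses ?A) ?u) \<le>\<^sub>l interleave ?A (take (trues ?A) l) (take (falses ?A) l)"
      by (rule conjunct1[OF interleave_mono]) (use le tfA cnt Cons.prems in \<open>auto simp del: concat.simps\<close>)
    also have "\<dots> <\<^sub>l l"
      using interleave_suffix_prefix[OF assms, of 0 ?A] lenA False by (auto simp: lex.less_le)
    finally have lt: "interleave ?A (take (trues ?A) l) (take (falses ?A) ?u) <\<^sub>l l" .
    have "interleave S l ?u <\<^sub>l l @ ?u"
      unfolding split
      by (rule lex_less_same_length_append[OF lt], subst length_interleave) (use lenA tfA cnt Cons.prems in auto)
    then show ?thesis by (auto simp: lex.less_imp_le)
  next
    case True
    then show ?thesis
    proof
      assume f: "falses ?A = 0"
      then have A: "?A = replicate ?L True" using count_list_eq_length[of ?A True] tfA lenA by simp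
      have "falses ?B = length ?B" using trues_falses[of ?B] cnt f tfA Cons.prems by simp
      then have B: "?B = replicate (length ?u) False" using count_list_eq_length[of ?B False] lenS by simp
      have "S = block_pattern ?L (length ?u) 0" unfolding block_pattern_def
        by (metis A B append_Nil append_take_drop_id diff_zero mult_0 replicate_0)
      moreover have "interleave S l ?u = l @ ?u"
        unfolding split using interleave_all_T[of l "[]"] interleave_all_F[of ?u "[]"] f tfA
        by (simp add: A B del: concat.simps)
      ultimately show ?thesis by auto
    next
      assume t: "trues ?A = 0"
      then have A: "?A = replicate ?L False" using count_list_eq_length[of ?A False] tfA lenA by simp
      have Lu: "?L \<le> length ?u" using t tfA cnt Cons.prems by simp
      have m: "interleave S l ?u = take ?L ?u @ interleave ?B l (drop ?L ?u)"
        unfolding split using interleave_all_F[of "take ?L ?u"] t tfA A Lu by (simp del: concat.simps)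
      have "take ?L ?u \<le>\<^sub>l l" using le t tfA by simp
      then consider "take ?L ?u <\<^sub>l l" | "take ?L ?u = l" by (auto simp: lex.le_less)
      then show ?thesis
      proof cases
        case 1
        have "interleave S l ?u <\<^sub>l l @ ?u" unfolding m
          by (rule lex_less_same_length_append[OF 1]) (use Lu in simp)
        then show ?thesis by (auto simp: lex.less_imp_le)
      next
        case 2
        have "?L \<le> length k"
          using lyndon_prefix_le_first_factor[OF assms, of "drop ?L ?u" k ls] Cons.prems 2
          by (metis append_take_drop_id list.pred_inject(2) lyndon_def)
        then have "take ?L k = l" using 2 by simp
        then have "k = l @ drop ?L k" by (metis append_take_drop_id)
        then have "l \<le>\<^sub>l k" using lexordp_eq_pref by metis
        with Cons.prems have k: "k = l" by auto
        have du: "drop ?L ?u = concat ls" using k by simp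
        have IH: "interleave ?B l (concat ls) \<le>\<^sub>l l @ concat ls \<and>
          (interleave ?B l (concat ls) = l @ concat ls \<longrightarrow>
          (\<exists>t\<le>length (takeWhile ((=) l) ls). ?B = block_pattern ?L (length (concat ls)) t))"
          by (rule Cons.IH) (use Cons.prems cnt t tfA k in auto)
        have le': "interleave S l ?u \<le>\<^sub>l l @ ?u" unfolding m 2 du using IH k by (simp add: lex_le_append_cancel)
        have "\<exists>t\<le>length (takeWhile ((=) l) (k # ls)). S = block_pattern ?L (length ?u) t"
          if eq: "interleave S l ?u = l @ ?u"
        proof -
          have "interleave ?B l (concat ls) = l @ concat ls" using eq unfolding m 2 du using k by simp
          with IH obtain t where t: "t \<le> length (takeWhile ((=) l) ls)" "?B = block_pattern ?L (length (concat ls)) t"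
            by blast
          have "S = ?A @ ?B" by simp
          also have "\<dots> = block_pattern ?L (length ?u) (Suc t)"
            unfolding A t(2) by (simp add: block_pattern_def k replicate_add)
          finally show ?thesis using t(1) k by (intro exI[of _ "Suc t"]) auto
        qed
        with le' show ?thesis by blast
      qed
    qed
  qed
qed

section \<open>Quantum binomial coefficients\<close>

definition generic_param :: "complex \<Rightarrow> bool"
  where "generic_param v \<longleftrightarrow> v \<noteq> 0 \<and> (\<forall>n>0. v ^ n \<noteq> 1)"

lemma generic_param_inverse: "generic_param v \<Longrightarrow> generic_param (inverse v)"
  by (auto simp: generic_param_def power_inverse)

lemma generic_param_diff:
  assumes "generic_param v" shows "v - inverse v \<noteq> 0"
proof
  assume "v - inverse v = 0"
  then have "v ^ 2 = 1" using assms by (simp add: generic_param_def power2_eq_square field_simps)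
  then show False using assms by (auto simp: generic_param_def)
qed

lemma qint_nonzero:
  assumes "generic_param v" "0 < k" shows "qint v k \<noteq> 0"
proof
  assume "qint v k = 0"
  then have "v ^ k = inverse v ^ k" using generic_param_diff[OF assms(1)] by (simp add: qint_def)
  from arg_cong[OF trans[OF this power_inverse], of "\<lambda>x. v ^ k * x"]
  have "v ^ k * v ^ k = v ^ k * inverse (v ^ k)" .
  also have "\<dots> = 1" by (rule right_inverse) (use assms(1) in \<open>simp add: generic_param_def\<close>)
  finally have "v ^ (k + k) = 1" unfolding power_add .
  moreover have "\<forall>n>0. v ^ n \<noteq> 1" using assms(1) by (simp add: generic_param_def)
  from this[rule_format, of "k + k"] have "v ^ (k + k) \<noteq> 1" using assms(2) by simp
  ultimately show False by contradiction
qed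

lemma qint_inverse: "qint (inverse v) k = qint v k"
  unfolding qint_def by (simp add: divide_simps) (auto simp: algebra_simps)

lemma qbinom_inverse: "qbinom (inverse v) m k = qbinom v m k"
  by (simp add: qbinom_def qfact_def qint_inverse)

lemma qfact_nonzero: "generic_param v \<Longrightarrow> qfact v m \<noteq> 0"
  by (auto simp: qfact_def qint_nonzero)

lemma qfact_Suc: "qfact v (Suc m) = qfact v m * qint v (Suc m)"
  by (simp add: qfact_def)

lemma qbinom_0 [simp]: "generic_param v \<Longrightarrow> qbinom v m 0 = 1"
  using qfact_nonzero by (simp add: qbinom_def qfact_def)

lemma qbinom_self [simp]: "generic_param v \<Longrightarrow> qbinom v m m = 1"
  using qfact_nonzero by (simp add: qbinom_def qfact_def)

lemma qint_add:
  assumes "generic_param v"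
  shows "v ^ k * qint v (k + j) = qint v j + v ^ (k + j) * qint v k"
proof -
  have "v \<noteq> 0" using assms by (simp add: generic_param_def)
  then have "v ^ k * (v ^ (k + j) - inverse v ^ (k + j))
      = (v ^ j - inverse v ^ j) + v ^ (k + j) * (v ^ k - inverse v ^ k)"
    by (simp add: power_add power_inverse field_simps)
  then show ?thesis
    unfolding qint_def by (metis add_divide_distrib times_divide_eq_right)
qed

text \<open>
  The q-Pascal rule, in the form that matches the recursion for iterated q-commutators.
\<close>

lemma qbinom_Suc_Suc:
  assumes "generic_param v" "k < n"
  shows "v ^ Suc k * qbinom v (Suc n) (Suc k) = qbinom v n (Suc k) + v ^ Suc n * qbinom v n k"
proof -
  obtain j where n: "n = Suc k + j" using assms(2) less_iff_Suc_add by auto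
  have nz: "qfact v i \<noteq> 0" "qint v (Suc i) \<noteq> 0" for i
    using qfact_nonzero[OF assms(1)] qint_nonzero[OF assms(1)] by auto
  have "v ^ Suc k * qbinom v (Suc n) (Suc k)
      = qfact v n * (v ^ Suc k * qint v (Suc k + Suc j)) / (qfact v k * qint v (Suc k) * (qfact v j * qint v (Suc j)))"
    by (simp add: qbinom_def n qfact_Suc)
  also have "v ^ Suc k * qint v (Suc k + Suc j) = qint v (Suc j) + v ^ Suc n * qint v (Suc k)"
    using qint_add[OF assms(1), of "Suc k" "Suc j"] n by simp
  also have "qfact v n * (qint v (Suc j) + v ^ Suc n * qint v (Suc k)) / (qfact v k * qint v (Suc k) * (qfact v j * qint v (Suc j)))
      = qfact v n / (qfact v k * qint v (Suc k) * qfact v j) + v ^ Suc n * (qfact v n / (qfact v k * (qfact v j * qint v (Suc j))))"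
    using nz by (simp add: field_simps)
  also have "\<dots> = qbinom v n (Suc k) + v ^ Suc n * qbinom v n k"
    by (simp add: qbinom_def n qfact_Suc)
  finally show ?thesis .
qed

section \<open>Recursion coefficients\<close>

text \<open>
  Closed form of the solution of \<open>d\<^sub>0 = 0\<close>, \<open>d\<^sub>n\<^sub>+\<^sub>1 = v\<^sup>2 (d\<^sub>n + c (1 - (t v\<^sup>2\<^sup>n)\<^sup>2))\<close>, the coefficients that appear
  when \<open>Y\<close> is moved past an iterated q-commutator in \<open>qad_recursion\<close>.
\<close>

definition dcoef :: "complex \<Rightarrow> complex \<Rightarrow> complex \<Rightarrow> nat \<Rightarrow> complex"
  where "dcoef v t c n = c * (v ^ (2 * n) - 1) * (v\<^sup>2 - t\<^sup>2 * v ^ (2 * n)) / (v\<^sup>2 - 1)"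

lemma dcoef_0 [simp]: "dcoef v t c 0 = 0"
  by (simp add: dcoef_def)

lemma dcoef_Suc:
  assumes "generic_param v"
  shows "dcoef v t c (Suc n) = v\<^sup>2 * (dcoef v t c n + c * (1 - (t * v ^ (2 * n))\<^sup>2))"
proof -
  have "v\<^sup>2 - 1 \<noteq> 0" using assms by (auto simp: generic_param_def)
  then show ?thesis
    by (simp add: dcoef_def field_simps power2_eq_square power_add)
qed

text \<open>
  Passing to \<open>v\<^sup>-\<^sup>1\<close> reverses the sequence of coefficients; this is the numerical half of the symmetry between
  the two summands of a generator of the iquantum group.
\<close>

lemma dcoef_reverse:
  assumes "generic_param v" "k \<le> n"
  shows "dcoef (inverse v) (v ^ n) (- (v\<^sup>2 * c)) k = dcoef v (inverse v ^ n) c (Suc n - k)"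
proof -
  have v: "v \<noteq> 0" "v\<^sup>2 \<noteq> 1" using assms by (auto simp: generic_param_def)
  obtain l where n: "n = k + l" using assms(2) le_iff_add by blast
  define a where "a = v ^ k"
  define b where "b = v ^ l"
  have ab: "a \<noteq> 0" "b \<noteq> 0" using v by (simp_all add: a_def b_def)
  have 1: "dcoef (inverse v) (v ^ n) (- (v\<^sup>2 * c)) k
      = - (v\<^sup>2 * c) * (inverse a ^ 2 - 1) * (inverse v ^ 2 - (a * b)\<^sup>2 * inverse a ^ 2) / (inverse v ^ 2 - 1)"
    by (simp add: dcoef_def n a_def b_def power_add power_even_eq power_inverse power_mult_distrib mult.commute[of 2] power_mult)
  have 2: "dcoef v (inverse v ^ n) c (Suc n - k)
      = c * ((b * v)\<^sup>2 - 1) * (v\<^sup>2 - (inverse (a * b))\<^sup>2 * (b * v)\<^sup>2) / (v\<^sup>2 - 1)"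
    by (simp add: dcoef_def n a_def b_def power_add power_inverse power_mult_distrib mult.commute[of 2] power_mult power2_eq_square ac_simps)
  have 3: "(inverse v)\<^sup>2 - 1 = - (v\<^sup>2 - 1) / v\<^sup>2" using v by (simp add: field_simps)
  have 4: "(inverse v)\<^sup>2 - (a * b)\<^sup>2 * inverse a ^ 2 = (1 - (b * v)\<^sup>2) / v\<^sup>2" using v ab by (simp add: field_simps)
  have 5: "v\<^sup>2 - (inverse (a * b))\<^sup>2 * (b * v)\<^sup>2 = v\<^sup>2 * (1 - inverse a ^ 2)" using v ab by (simp add: field_simps)
  have "v\<^sup>2 - 1 \<noteq> 0" using v by simp
  then show ?thesis unfolding 1 2 3 4 5 using v by (simp add: divide_simps) (simp add: algebra_simps)
qed

text \<open>
  The recursion terminates exactly at the length of the quantum Serre element.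
\<close>

lemma dcoef_vanishes:
  assumes "v \<noteq> 0" shows "dcoef v (inverse v ^ n) c (Suc n) = 0"
proof -
  have "v ^ (2 * Suc n) = (v ^ n)\<^sup>2 * v\<^sup>2"
    by (simp add: power2_eq_square mult_2_right power_add ac_simps)
  then have "(inverse v ^ n)\<^sup>2 * v ^ (2 * Suc n) = (inverse v ^ n * v ^ n)\<^sup>2 * v\<^sup>2"
    by (simp only: power_mult_distrib mult.assoc)
  also have "inverse v ^ n * v ^ n = 1" using assms by (simp add: power_mult_distrib[symmetric])
  finally show ?thesis by (simp add: dcoef_def)
qed

section \<open>Quantum Serre elements\<close>

text \<open>
  Central complex scalars, given by a map instead of a type class: the same calculations are used in the free
  algebra, in rings of operators on functions, and in the complex numbers.
\<close>

locale scalars =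
  fixes s :: "complex \<Rightarrow> 'a::ring_1"
  assumes s_1 [simp]: "s 1 = 1"
    and s_add: "s (c + d) = s c + s d"
    and s_mult: "s (c * d) = s c * s d"
    and s_central: "x * s c = s c * x"
begin

lemma s_0 [simp]: "s 0 = 0"
  using s_add[of 0 0] by simp

lemma s_uminus: "s (- c) = - s c"
  using s_add[of c "- c"] by (simp add: eq_neg_iff_add_eq_0 add.commute)

lemma s_diff: "s (c - d) = s c - s d"
  using s_add[of c "- d"] by (simp add: s_uminus)

lemma s_sum: "s (sum f A) = (\<Sum>x\<in>A. s (f x))"
  by (induction A rule: infinite_finite_induct) (simp_all add: s_add)

lemma s_left_commute: "x * (s c * y) = s c * (x * y)"
  by (metis mult.assoc s_central)

lemma s_left_cancel: "c \<noteq> 0 \<Longrightarrow> s c * x = s c * y \<Longrightarrow> x = y"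
proof -
  assume c: "c \<noteq> 0" "s c * x = s c * y"
  then have "s (inverse c) * (s c * x) = s (inverse c) * (s c * y)" by simp
  then have "s (inverse c * c) * x = s (inverse c * c) * y" by (simp add: s_mult mult.assoc)
  with c(1) show "x = y" by simp
qed

definition serre_sum :: "complex \<Rightarrow> nat \<Rightarrow> 'a \<Rightarrow> 'a \<Rightarrow> 'a"
  where "serre_sum v m F G = (\<Sum>k=0..m. s ((- 1) ^ k * qbinom v m k) * F ^ (m - k) * G * F ^ k)"

text \<open>
  Iterated q-commutators with \<open>F\<close>; the deformation parameter is multiplied by \<open>v\<^sup>2\<close> at each step, since every \<open>F\<close>
  shifts the weight.
\<close>

fun qad :: "complex \<Rightarrow> complex \<Rightarrow> 'a \<Rightarrow> 'a \<Rightarrow> nat \<Rightarrow> 'a" where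
  "qad v t F G 0 = G"
| "qad v t F G (Suc n) = F * qad v t F G n - s (t * v ^ (2 * n)) * qad v t F G n * F"

lemma qad_expand:
  assumes "generic_param v"
  shows "qad v t F G n
    = (\<Sum>k=0..n. s ((- 1) ^ k * (t ^ k * v ^ (n * k) * inverse v ^ k * qbinom v n k)) * F ^ (n - k) * G * F ^ k)"
proof (induction n)
  case 0
  then show ?case using assms by simp
next
  case (Suc n)
  have v: "v \<noteq> 0" using assms by (simp add: generic_param_def)
  define c where "c n k = (- 1) ^ k * (t ^ k * v ^ (n * k) * inverse v ^ k * qbinom v n k)" for n k
  define T where "T n k = F ^ (n - k) * G * F ^ k" for n k :: nat
  have c0: "c n 0 = 1" "c (Suc n) 0 = 1" using assms by (simp_all add: c_def)
  have top: "c (Suc n) (Suc n) = - (t * v ^ (2 * n)) * c n n"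
  proof -
    have "v ^ (Suc n * Suc n) * inverse v ^ Suc n = v ^ (2 * n) * (v ^ (n * n) * inverse v ^ n)"
      using v by (simp add: power_add power_mult_distrib field_simps mult_2_right)
    then show ?thesis using assms by (simp add: c_def algebra_simps)
  qed
  have mid: "c (Suc n) (Suc k) = c n (Suc k) - t * v ^ (2 * n) * c n k" if "k < n" for k
  proof -
    have "c (Suc n) (Suc k) = (- 1) ^ Suc k * t ^ Suc k * v ^ (n * Suc k) * inverse v ^ Suc k * (v ^ Suc k * qbinom v (Suc n) (Suc k))"
      by (simp add: c_def power_add algebra_simps)
    also have "\<dots> = c n (Suc k) + (- 1) ^ Suc k * t ^ Suc k * v ^ (n * Suc k) * inverse v ^ Suc k * v ^ Suc n * qbinom v n k"
      unfolding qbinom_Suc_Suc[OF assms that] by (simp add: c_def algebra_simps)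
    also have "(- 1) ^ Suc k * t ^ Suc k * v ^ (n * Suc k) * inverse v ^ Suc k * v ^ Suc n * qbinom v n k = - (t * v ^ (2 * n) * c n k)"
      using v by (simp add: c_def power_add field_simps mult_2_right)
    finally show ?thesis by simp
  qed
  have ends: "(\<Sum>k=0..Suc n. f k) = f 0 + (\<Sum>k<n. f (Suc k)) + f (Suc n)" for f :: "nat \<Rightarrow> 'a"
    by (induction n) (simp_all add: add.assoc)
  have FT: "F * T n k = T (Suc n) k" if "k \<le> n" for k
    using that by (simp add: T_def mult.assoc Suc_diff_le)
  have TF: "T n k * F = T (Suc n) (Suc k)" for k
    by (simp add: T_def mult.assoc power_commutes)
  have IH: "qad v t F G n = (\<Sum>k=0..n. s (c n k) * T n k)"
    unfolding Suc.IH by (simp add: c_def T_def mult.assoc)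
  have "qad v t F G (Suc n) = (\<Sum>k=0..n. s (c n k) * T (Suc n) k) - (\<Sum>k=0..n. s (t * v ^ (2 * n) * c n k) * T (Suc n) (Suc k))"
  proof -
    have 1: "F * (\<Sum>k=0..n. s (c n k) * T n k) = (\<Sum>k=0..n. s (c n k) * T (Suc n) k)"
      unfolding sum_distrib_left by (intro sum.cong refl) (simp add: s_left_commute FT)
    have 2: "s (t * v ^ (2 * n)) * (\<Sum>k=0..n. s (c n k) * T n k) * F = (\<Sum>k=0..n. s (t * v ^ (2 * n) * c n k) * T (Suc n) (Suc k))"
      unfolding sum_distrib_left sum_distrib_right
      by (intro sum.cong refl) (simp add: s_mult mult.assoc TF)
    show ?thesis unfolding qad.simps IH 1 2 ..
  qed
  also have "(\<Sum>k=0..n. s (c n k) * T (Suc n) k) = T (Suc n) 0 + (\<Sum>k<n. s (c n (Suc k)) * T (Suc n) (Suc k))"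
    by (subst sum.atLeast0_atMost_Suc_shift[symmetric] sum.atLeast_Suc_atMost, simp)
       (simp add: c0 sum.shift_bounds_cl_Suc_ivl atLeast0AtMost lessThan_Suc_atMost[symmetric] sum.atLeast1_atMost_eq)
  also have "(\<Sum>k=0..n. s (t * v ^ (2 * n) * c n k) * T (Suc n) (Suc k))
      = (\<Sum>k<n. s (t * v ^ (2 * n) * c n k) * T (Suc n) (Suc k)) + s (t * v ^ (2 * n) * c n n) * T (Suc n) (Suc n)"
    by (simp add: atLeast0AtMost lessThan_Suc_atMost[symmetric])
  also have "T (Suc n) 0 + (\<Sum>k<n. s (c n (Suc k)) * T (Suc n) (Suc k)) - ((\<Sum>k<n. s (t * v ^ (2 * n) * c n k) * T (Suc n) (Suc k)) + s (t * v ^ (2 * n) * c n n) * T (Suc n) (Suc n))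
      = T (Suc n) 0 + (\<Sum>k<n. s (c (Suc n) (Suc k)) * T (Suc n) (Suc k)) + s (c (Suc n) (Suc n)) * T (Suc n) (Suc n)"
    unfolding top by (simp add: mid s_diff s_uminus left_diff_distrib sum_subtractf)
  also have "\<dots> = (\<Sum>k=0..Suc n. s (c (Suc n) k) * T (Suc n) k)"
    unfolding ends by (simp add: c0)
  finally show ?case by (simp add: c_def T_def mult.assoc)
qed

text \<open>
  For \<open>t = v\<^sup>-\<^sup>n\<close> the powers of \<open>t\<close> and \<open>v\<close> in the q-binomial expansion cancel.
\<close>

lemma serre_sum_eq_qad:
  assumes "generic_param v"
  shows "serre_sum v (Suc n) F G = qad v (inverse v ^ n) F G (Suc n)"
proof -
  have v: "v \<noteq> 0" using assms by (simp add: generic_param_def)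
  have "(inverse v ^ n) ^ k * v ^ (Suc n * k) * inverse v ^ k = 1" for k
  proof -
    have "(inverse v ^ n) ^ k * v ^ (Suc n * k) * inverse v ^ k = (inverse v ^ (n * k) * v ^ (n * k)) * (v ^ k * inverse v ^ k)"
      by (simp add: power_add power_mult[symmetric] algebra_simps)
    also have "\<dots> = 1" using v by (simp add: power_mult_distrib[symmetric])
    finally show ?thesis .
  qed
  then show ?thesis unfolding serre_sum_def qad_expand[OF assms] by simp
qed

lemma serre_sum_inverse: "serre_sum (inverse v) m F G = serre_sum v m F G"
  by (simp add: serre_sum_def qbinom_inverse)

text \<open>
  Quantum binomials do not change under \<open>v \<mapsto> v\<^sup>-\<^sup>1\<close>, so the Serre element is also an iterated commutator for the
  inverse parameter.
\<close>

lemma serre_sum_eq_qad':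
  assumes "generic_param v"
  shows "serre_sum v (Suc n) F G = qad (inverse v) (v ^ n) F G (Suc n)"
  using serre_sum_eq_qad[OF generic_param_inverse[OF assms], of n F G] by (simp add: serre_sum_inverse)

section \<open>The three-term recursion\<close>

text \<open>
  In the model case \<open>k = K\<^sub>i\<^sup>-\<^sup>2\<close>, \<open>F = F\<^sub>i\<close>, \<open>G = F\<^sub>j\<close>, and \<open>Y\<close> is a multiple of \<open>E\<^sub>i K\<^sub>i\<^sup>-\<^sup>1\<close>: moving \<open>Y\<close> past an
  \<open>F\<close> costs a term \<open>1 - k\<close>, and these costs accumulate to one multiple of the preceding iterated commutator.
\<close>

lemma qad_recursion:
  assumes v: "generic_param v"
    and kF: "k * F = s (v ^ 4) * F * k"
    and YF: "Y * F = s (v\<^sup>2) * (F * Y + s c * (1 - k))"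
    and YG: "Y * G = s t * G * Y"
    and kG: "k * G = s (t\<^sup>2) * G * k"
  shows "k * qad v t F G n = s ((t * v ^ (2 * n))\<^sup>2) * qad v t F G n * k"
    and "Y * qad v t F G n = s (t * v ^ (2 * n)) * qad v t F G n * Y
      + s (dcoef v t c n) * (case n of 0 \<Rightarrow> 0 | Suc j \<Rightarrow> qad v t F G j)"
proof -
  let ?g = "qad v t F G"
  show kg: "k * ?g n = s ((t * v ^ (2 * n))\<^sup>2) * ?g n * k" for n
  proof (induction n)
    case 0
    then show ?case by (simp add: kG)
  next
    case (Suc n)
    define r where "r = t * v ^ (2 * n)"
    have kg: "k * ?g n = s (r\<^sup>2) * (?g n * k)" using Suc by (simp add: r_def mult.assoc)
    have kF': "k * (F * x) = s (v ^ 4) * (F * (k * x))" for x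
      using kF by (metis mult.assoc)
    have kg': "k * (?g n * x) = s (r\<^sup>2) * (?g n * (k * x))" for x
      using arg_cong[OF kg, of "\<lambda>y. y * x"] by (simp only: mult.assoc)
    have r': "(t * v ^ (2 * Suc n))\<^sup>2 = v ^ 4 * r\<^sup>2"
      by (simp add: r_def power2_eq_square power_add algebra_simps power4_eq_xxxx)
    have "k * ?g (Suc n) = s (v ^ 4) * (F * (s (r\<^sup>2) * (?g n * k))) - s r * (s (r\<^sup>2) * (?g n * (s (v ^ 4) * (F * k))))"
      using kF' kg kg' kF by (simp add: r_def[symmetric] right_diff_distrib mult.assoc s_left_commute[of k])
    also have "\<dots> = s (v ^ 4 * r\<^sup>2) * ?g (Suc n) * k"
    proof -
      have c: "s a * (s b * x) = s (a * b) * x" for a b x by (simp add: s_mult mult.assoc)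
      show ?thesis
        by (simp add: r_def[symmetric] s_left_commute[of F] s_left_commute[of "qad v t F G n"] mult.assoc left_diff_distrib right_diff_distrib c)
           (simp add: ac_simps)
    qed
    finally show ?case unfolding r' .
  qed
  show "Y * ?g n = s (t * v ^ (2 * n)) * ?g n * Y + s (dcoef v t c n) * (case n of 0 \<Rightarrow> 0 | Suc j \<Rightarrow> ?g j)"
  proof (induction n)
    case 0
    then show ?case by (simp add: YG)
  next
    case (Suc n)
    define r where "r = t * v ^ (2 * n)"
    define d where "d = dcoef v t c n"
    define g where "g = ?g n"
    define g' where "g' = (case n of 0 \<Rightarrow> 0 | Suc j \<Rightarrow> ?g j)"
    have IH: "Y * g = s r * (g * Y) + s d * g'"
      using Suc by (simp add: r_def d_def g_def g'_def mult.assoc)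
    have IH': "Y * (g * x) = s r * (g * (Y * x)) + s d * (g' * x)" for x
      using IH by (metis (no_types, lifting) mult.assoc distrib_right)
    have YF': "Y * (F * x) = s (v\<^sup>2) * (F * (Y * x) + s c * (x - k * x))" for x
    proof -
      have "Y * (F * x) = s (v\<^sup>2) * (F * Y + s c * (1 - k)) * x" using YF by (metis mult.assoc)
      then show ?thesis by (simp add: distrib_right left_diff_distrib mult.assoc)
    qed
    have kg': "k * g = s (r\<^sup>2) * (g * k)" using kg[of n] by (simp add: r_def g_def mult.assoc)
    have g: "s d * (s (v\<^sup>2) * (F * g') - s r * (g' * F)) = s d * (s (v\<^sup>2) * g)"
    proof (cases n)
      case 0 then show ?thesis by (simp add: d_def)
    next
      case (Suc j)
      have "r = v\<^sup>2 * (t * v ^ (2 * j))" unfolding r_def Suc by (simp add: power2_eq_square)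
      then show ?thesis
        unfolding g_def g'_def Suc by (simp add: right_diff_distrib s_mult mult.assoc)
    qed
    have "Y * ?g (Suc n) = Y * (F * g) - s r * (Y * (g * F))"
      by (simp add: g_def r_def right_diff_distrib s_left_commute[of Y] mult.assoc)
    also have "Y * (F * g) = s (v\<^sup>2) * (s r * (F * (g * Y)) + s d * (F * g') + s c * (g - s (r\<^sup>2) * (g * k)))"
      unfolding YF' IH kg' by (simp add: distrib_left s_left_commute[of F])
    also have "Y * (g * F) = s r * (s (v\<^sup>2) * (g * (F * Y) + s c * (g - g * k))) + s d * (g' * F)"
      unfolding IH' YF by (simp add: distrib_left right_diff_distrib s_left_commute[of g] s_central[of g])
    also have "s (v\<^sup>2) * (s r * (F * (g * Y)) + s d * (F * g') + s c * (g - s (r\<^sup>2) * (g * k)))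
         - s r * (s r * (s (v\<^sup>2) * (g * (F * Y) + s c * (g - g * k))) + s d * (g' * F))
       = s (v\<^sup>2 * r) * (F * g - s r * (g * F)) * Y + s d * (s (v\<^sup>2) * (F * g') - s r * (g' * F)) + s (v\<^sup>2 * c - v\<^sup>2 * c * r\<^sup>2) * g"
    proof -
      have c: "s a * (s b * x) = s (a * b) * x" for a b x by (simp add: s_mult mult.assoc)
      have e: "(F * g - s r * (g * F)) * Y = F * (g * Y) - s r * (g * (F * Y))"
        by (simp add: left_diff_distrib mult.assoc)
      have p: "s (v\<^sup>2 * r) * (F * g - s r * (g * F)) * Y = s (v\<^sup>2 * r) * (F * (g * Y) - s r * (g * (F * Y)))"
        unfolding mult.assoc[of "s (v\<^sup>2 * r)"] e ..
      show ?thesis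
        unfolding p distrib_left right_diff_distrib s_diff left_diff_distrib c
        by (simp add: power2_eq_square ac_simps)
    qed
    also have "\<dots> = s (v\<^sup>2 * r) * (F * g - s r * (g * F)) * Y + s (v\<^sup>2 * (d + c * (1 - r\<^sup>2))) * g"
    proof -
      have "v\<^sup>2 * (d + c * (1 - r\<^sup>2)) = d * v\<^sup>2 + (v\<^sup>2 * c - v\<^sup>2 * c * r\<^sup>2)" by (simp add: algebra_simps)
      then show ?thesis unfolding g by (simp only: s_add distrib_right s_mult mult.assoc add.assoc)
    qed
    finally have X: "Y * ?g (Suc n) = s (v\<^sup>2 * r) * (F * g - s r * (g * F)) * Y + s (v\<^sup>2 * (d + c * (1 - r\<^sup>2))) * g" .
    have "t * v ^ (2 * Suc n) = v\<^sup>2 * r" by (simp add: r_def power2_eq_square)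
    moreover have "dcoef v t c (Suc n) = v\<^sup>2 * (d + c * (1 - r\<^sup>2))"
      unfolding dcoef_Suc[OF v] d_def r_def ..
    moreover have "F * g - s r * (g * F) = ?g (Suc n)" by (simp add: g_def r_def mult.assoc)
    ultimately show ?case using X by (simp only: nat.case g_def)
  qed
qed

lemma qad_add: "qad v t F (G + H) n = qad v t F G n + qad v t F H n"
  by (induction n) (simp_all add: algebra_simps)

lemma qad_diff: "qad v t F (G - H) n = qad v t F G n - qad v t F H n"
  using qad_add[of v t F "G - H" H n] by simp

lemma qad_scale: "qad v t F (s c * G) n = s c * qad v t F G n"
proof (induction n)
  case (Suc n)
  have "s a * (s c * x) = s c * (s a * x)" for a x by (simp flip: s_mult mult.assoc add: mult.commute)
  with Suc show ?case by (simp add: right_diff_distrib mult.assoc s_left_commute[of F])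
qed simp

text \<open>
  The part of the recursion that involves \<open>Y\<close> on the right cancels when \<open>F\<close> is replaced by \<open>F + Y\<close>; what remains
  mentions only multiplication by \<open>F + Y\<close>.
\<close>

lemma qad_three_term:
  assumes v: "generic_param v"
    and "k * F = s (v ^ 4) * F * k" "Y * F = s (v\<^sup>2) * (F * Y + s c * (1 - k))"
    and "Y * G = s t * G * Y" "k * G = s (t\<^sup>2) * G * k"
  shows "(F + Y) * qad v t F G n - s (t * v ^ (2 * n)) * qad v t F G n * (F + Y)
    = qad v t F G (Suc n) + s (dcoef v t c n) * (case n of 0 \<Rightarrow> 0 | Suc j \<Rightarrow> qad v t F G j)"
  using qad_recursion(2)[OF assms, of n] by (simp add: distrib_left distrib_right)

text \<open>
  The Serre element is additive here. In the three-term recursion with \<open>c = 0\<close> all coefficients vanish, so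
  adding \<open>Y\<close> to \<open>P\<close> does not change the iterated commutators with \<open>G\<close>; read with the inverse parameter,
  adding \<open>P\<close> to \<open>Y\<close> does not change those with \<open>H\<close>.
\<close>

lemma serre_sum_coproduct:
  assumes v: "generic_param v"
    and "Y * P = s (v\<^sup>2) * P * Y" "Y * G = s (inverse v ^ n) * G * Y" "P * H = s (v ^ n) * H * P"
  shows "serre_sum v (Suc n) (P + Y) (G + H) = serre_sum v (Suc n) P G + serre_sum v (Suc n) Y H"
proof -
  have same: "qad u t (F + Z) K j = qad u t F K j"
    if "generic_param u" "Z * F = s (u\<^sup>2) * (F * Z)" "Z * K = s t * K * Z" for u t F Z K j
  proof (induction j)
    case (Suc j)
    have "(F + Z) * qad u t F K j - s (t * u ^ (2 * j)) * qad u t F K j * (F + Z) = qad u t F K (Suc j)"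
      using qad_three_term[of u 0 F Z 0 K t j] that by (simp add: dcoef_def)
    then show ?case by (simp add: Suc.IH)
  qed simp
  have v0: "v \<noteq> 0" using v by (simp add: generic_param_def)
  have PY: "P * Y = s ((inverse v)\<^sup>2) * (Y * P)"
  proof -
    have "(inverse v)\<^sup>2 * v\<^sup>2 = 1" using v0 by (simp add: power_mult_distrib[symmetric])
    moreover have "s ((inverse v)\<^sup>2) * (Y * P) = s ((inverse v)\<^sup>2 * v\<^sup>2) * (P * Y)"
      unfolding assms(2) s_mult mult.assoc ..
    ultimately show ?thesis by simp
  qed
  have "qad v (inverse v ^ n) (P + Y) G (Suc n) = qad v (inverse v ^ n) P G (Suc n)"
    by (rule same) (use v assms(2,3) in \<open>simp_all add: mult.assoc\<close>)
  moreover have "qad (inverse v) (v ^ n) (Y + P) H (Suc n) = qad (inverse v) (v ^ n) Y H (Suc n)"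
    by (rule same) (use v PY assms(4) generic_param_inverse in \<open>simp_all add: mult.assoc\<close>)
  moreover have "serre_sum v (Suc n) (P + Y) (G + H) = serre_sum v (Suc n) (P + Y) G + serre_sum v (Suc n) (P + Y) H"
    unfolding serre_sum_eq_qad[OF v] qad_add ..
  ultimately show ?thesis
    unfolding serre_sum_eq_qad[OF v, of n _ G] serre_sum_eq_qad'[OF v, of n _ H] by (simp add: add.commute)
qed

text \<open>
  Apply the recursion to \<open>Y = E K\<^sup>-\<^sup>1\<close>: its coefficient vanishes at the Serre element, which therefore commutes
  with \<open>E K\<^sup>-\<^sup>1\<close> up to the same scalar as with \<open>K\<^sup>-\<^sup>1\<close>.
\<close>

lemma raising_commutes_with_serre_same:
  assumes v: "generic_param v"
    and K: "K * Ki = 1" "Ki * K = 1"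
    and KF: "Ki * F = s (v\<^sup>2) * F * Ki" and KG: "Ki * G = s (inverse v ^ n) * G * Ki"
    and EF: "E * F - F * E = s (inverse (v - inverse v)) * (K - Ki)" and EG: "E * G = G * E"
  shows "E * serre_sum v (Suc n) F G = serre_sum v (Suc n) F G * E"
proof -
  let ?t = "inverse v ^ n" and ?c = "inverse (v - inverse v)"
  have v0: "v \<noteq> 0" "v\<^sup>2 - 1 \<noteq> 0" using v by (auto simp: generic_param_def)
  let ?g = "qad v ?t F G (Suc n)"
  have KiF: "Ki * (F * x) = s (v\<^sup>2) * (F * (Ki * x))" for x
    using arg_cong[OF KF, of "\<lambda>y. y * x"] by (simp only: mult.assoc)
  \<comment> \<open>The commutation rules of \<open>k = K\<^sup>-\<^sup>2\<close> and \<open>Y = E K\<^sup>-\<^sup>1\<close> that the recursion requires.\<close>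
  have 1: "(Ki * Ki) * F = s (v ^ 4) * F * (Ki * Ki)"
  proof -
    have "(Ki * Ki) * F = s (v\<^sup>2) * (s (v\<^sup>2) * (F * (Ki * Ki)))"
      using KiF[of Ki] KF by (simp add: mult.assoc s_left_commute[of Ki])
    also have "\<dots> = s (v\<^sup>2 * v\<^sup>2) * (F * (Ki * Ki))" by (simp only: s_mult mult.assoc)
    also have "v\<^sup>2 * v\<^sup>2 = v ^ 4" by (simp flip: power_add)
    finally show ?thesis by (simp only: mult.assoc)
  qed
  have EF': "E * F = F * E + s ?c * (K - Ki)" using EF by (simp add: algebra_simps)
  have 2: "(E * Ki) * F = s (v\<^sup>2) * (F * (E * Ki) + s ?c * (1 - Ki * Ki))"
  proof -
    have "(E * Ki) * F = s (v\<^sup>2) * (E * F * Ki)"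
      using KF by (simp add: mult.assoc s_left_commute[of E])
    also have "E * F * Ki = F * (E * Ki) + s ?c * (1 - Ki * Ki)"
      unfolding EF' by (simp add: distrib_right left_diff_distrib mult.assoc K)
    finally show ?thesis .
  qed
  have 3: "(E * Ki) * G = s ?t * G * (E * Ki)"
  proof -
    have "(E * Ki) * G = s ?t * (E * G * Ki)" using KG by (simp add: mult.assoc s_left_commute[of E])
    then show ?thesis unfolding EG by (simp add: mult.assoc)
  qed
  have 4: "(Ki * Ki) * G = s (?t\<^sup>2) * G * (Ki * Ki)"
  proof -
    have "Ki * (G * Ki) = s ?t * (G * (Ki * Ki))"
      using arg_cong[OF KG, of "\<lambda>y. y * Ki"] by (simp only: mult.assoc)
    then have "(Ki * Ki) * G = s ?t * (s ?t * (G * (Ki * Ki)))"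
      using KG by (simp add: mult.assoc s_left_commute[of Ki])
    then show ?thesis by (simp add: power2_eq_square s_mult mult.assoc)
  qed
  have Kig: "Ki * qad v ?t F G j = s (?t * v ^ (2 * j)) * (qad v ?t F G j * Ki)" for j
  proof (induction j)
    case 0 then show ?case using KG by (simp add: mult.assoc)
  next
    case (Suc j)
    define r where "r = ?t * v ^ (2 * j)"
    define g where "g = qad v ?t F G j"
    have c: "s a * (s b * x) = s (a * b) * x" for a b x by (simp add: s_mult mult.assoc)
    have IH: "Ki * g = s r * (g * Ki)" using Suc by (simp add: g_def r_def)
    have IH': "Ki * (g * x) = s r * (g * (Ki * x))" for x
      using arg_cong[OF IH, of "\<lambda>y. y * x"] by (simp only: mult.assoc)
    have r': "?t * v ^ (2 * Suc j) = v\<^sup>2 * r" by (simp add: r_def power2_eq_square)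
    have "Ki * (F * g - s r * (g * F)) = s (v\<^sup>2 * r) * ((F * g - s r * (g * F)) * Ki)"
      using KF by (simp add: right_diff_distrib left_diff_distrib KiF IH IH' s_left_commute[of F] s_left_commute[of g] s_left_commute[of Ki] mult.assoc c)
        (simp add: ac_simps)
    then show ?case unfolding r' by (simp add: g_def r_def mult.assoc)
  qed
  have "dcoef v ?t ?c (Suc n) = 0" by (rule dcoef_vanishes[OF v0(1)])
  then have "(E * Ki) * ?g = s (?t * v ^ (2 * Suc n)) * ?g * (E * Ki)"
    using qad_recursion(2)[OF v 1 2 3 4, of "Suc n"] by simp
  then have "s (?t * v ^ (2 * Suc n)) * (E * (?g * Ki)) = s (?t * v ^ (2 * Suc n)) * (?g * (E * Ki))"
    using Kig[of "Suc n"] by (simp add: mult.assoc s_left_commute[of E] del: qad.simps)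
  then have "E * (?g * Ki) = ?g * (E * Ki)"
    by (rule s_left_cancel[rotated]) (use v0 in simp)
  then have "E * (?g * Ki) * K = ?g * (E * Ki) * K" by simp
  then have "E * ?g = ?g * E" using K by (simp add: mult.assoc del: qad.simps)
  then show ?thesis unfolding serre_sum_eq_qad[OF v] .
qed

text \<open>
  As \<open>E\<close> commutes with \<open>F\<close>, commuting with \<open>E\<close> amounts to replacing \<open>G\<close> by a combination of \<open>K\<close> and \<open>K\<^sup>-\<^sup>1\<close>. The
  iterated commutator of \<open>F\<close> with \<open>K\<close> dies at the first step, the one with \<open>K\<^sup>-\<^sup>1\<close> at the last.
\<close>

lemma raising_commutes_with_serre_other:
  assumes v: "generic_param v"
    and KF: "F * K = s (inverse v ^ n) * K * F" and KiF: "F * Ki = s (v ^ n) * Ki * F"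
    and EG: "E * G - G * E = s c * (K - Ki)" and EF: "E * F = F * E"
  shows "E * serre_sum v (Suc n) F G = serre_sum v (Suc n) F G * E"
proof -
  let ?t = "inverse v ^ n"
  have v0: "v \<noteq> 0" using v by (auto simp: generic_param_def)
  have comm: "E * qad v ?t F G j - qad v ?t F G j * E = qad v ?t F (E * G - G * E) j" for j
  proof (induction j)
    case (Suc j)
    define r where "r = ?t * v ^ (2 * j)"
    define g where "g = qad v ?t F G j"
    have EF': "E * (F * x) = F * (E * x)" for x by (metis EF mult.assoc)
    have "E * (F * g - s r * (g * F)) - (F * g - s r * (g * F)) * E = F * (E * g - g * E) - s r * ((E * g - g * E) * F)"
      using EF by (simp add: right_diff_distrib left_diff_distrib EF' s_left_commute[of E] mult.assoc)
    then show ?case unfolding qad.simps Suc.IH[symmetric] by (simp add: g_def r_def mult.assoc)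
  qed simp
  have K0: "qad v ?t F K (Suc j) = 0" for j
    by (induction j) (simp_all add: KF mult.assoc)
  have Ki: "\<exists>a. qad v ?t F Ki j = s a * (Ki * F ^ j)" for j
  proof (induction j)
    case 0 show ?case by (intro exI[of _ 1]) simp
  next
    case (Suc j)
    then obtain a where a: "qad v ?t F Ki j = s a * (Ki * F ^ j)" ..
    have FKi: "F * (Ki * x) = s (v ^ n) * (Ki * (F * x))" for x
      using arg_cong[OF KiF, of "\<lambda>y. y * x"] by (simp only: mult.assoc)
    have "qad v ?t F Ki (Suc j) = s (a * v ^ n - ?t * v ^ (2 * j) * a) * (Ki * F ^ Suc j)"
      using a by (simp add: FKi s_left_commute[of F] s_diff s_mult left_diff_distrib mult.assoc power_commutes)
    then show ?case by blast
  qed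
  have Ki0: "qad v ?t F Ki (Suc n) = 0"
  proof -
    obtain a where a: "qad v ?t F Ki n = s a * (Ki * F ^ n)" using Ki by blast
    have FKi: "F * (Ki * x) = s (v ^ n) * (Ki * (F * x))" for x
      using arg_cong[OF KiF, of "\<lambda>y. y * x"] by (simp only: mult.assoc)
    have "qad v ?t F Ki (Suc n) = s (a * v ^ n - ?t * v ^ (2 * n) * a) * (Ki * F ^ Suc n)"
      using a by (simp add: FKi s_left_commute[of F] s_diff s_mult left_diff_distrib mult.assoc power_commutes)
    also have "?t * v ^ (2 * n) = v ^ n"
      using v0 by (simp add: mult_2 power_add power_inverse)
    finally show ?thesis by (simp add: mult.commute)
  qed
  have "qad v ?t F (E * G - G * E) (Suc n) = 0"
    unfolding EG qad_scale qad_diff K0 Ki0 by simp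
  with comm[of "Suc n"] have "E * qad v ?t F G (Suc n) = qad v ?t F G (Suc n) * E" by simp
  then show ?thesis unfolding serre_sum_eq_qad[OF v] .
qed

end

section \<open>Continuants\<close>

text \<open>
  Euler's continuants, with operators \<open>b\<^sub>0, b\<^sub>1, \<dots>\<close> on the diagonal and scalars \<open>d\<^sub>1, d\<^sub>2, \<dots>\<close> off it, applied to \<open>z\<close>.
\<close>

fun cont :: "(nat \<Rightarrow> 'a \<Rightarrow> 'a) \<Rightarrow> (nat \<Rightarrow> 'a) \<Rightarrow> nat \<Rightarrow> 'a \<Rightarrow> 'a::ring_1" where
  "cont b d 0 z = z"
| "cont b d (Suc 0) z = b 0 z"
| "cont b d (Suc (Suc n)) z = b (Suc n) (cont b d (Suc n) z) - d (Suc n) * cont b d n z"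

lemma cont_cong:
  "(\<And>k. k < n \<Longrightarrow> b k = b' k) \<Longrightarrow> (\<And>k. k < n \<Longrightarrow> d k = d' k) \<Longrightarrow> cont b d n z = cont b' d' n z"
  by (induction b d n z rule: cont.induct) auto

locale continuant_data =
  fixes b :: "nat \<Rightarrow> 'a \<Rightarrow> 'a::ring_1" and d :: "nat \<Rightarrow> 'a"
  assumes b_diff: "b k (x - y) = b k x - b k y"
    and b_d: "b k (d j * x) = d j * b k x"
    and b_commute: "b i (b j x) = b j (b i x)"
    and d_commute: "d i * (d j * x) = d j * (d i * x)"

lemma continuant_data_shift: "continuant_data b d \<Longrightarrow> continuant_data (\<lambda>k. b (k + m)) (\<lambda>k. d (k + m))"
  by (simp add: continuant_data_def)

text \<open>
  A continuant is the determinant of a tridiagonal matrix, so it can be expanded at either end.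
\<close>

lemma cont_left:
  assumes "continuant_data b d"
  shows "cont b d (Suc (Suc n)) z = cont (\<lambda>k. b (k + 1)) (\<lambda>k. d (k + 1)) (Suc n) (b 0 z) - d 1 * cont (\<lambda>k. b (k + 2)) (\<lambda>k. d (k + 2)) n z"
proof (induction n rule: less_induct)
  case (less n)
  interpret continuant_data b d by fact
  consider "n = 0" | "n = 1" | k where "n = Suc (Suc k)" by (metis One_nat_def not0_implies_Suc)
  then show ?case
  proof cases
    case 1 then show ?thesis by simp
  next
    case 2 then show ?thesis
      using b_diff b_d by (simp add: numeral_2_eq_2)
  next
    case 3
    have IH1: "cont b d (Suc (Suc (Suc k))) z = cont (\<lambda>k. b (k + 1)) (\<lambda>k. d (k + 1)) (Suc (Suc k)) (b 0 z) - d 1 * cont (\<lambda>k. b (k + 2)) (\<lambda>k. d (k + 2)) (Suc k) z"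
      using less[of "Suc k"] 3 by simp
    have IH2: "cont b d (Suc (Suc k)) z = cont (\<lambda>k. b (k + 1)) (\<lambda>k. d (k + 1)) (Suc k) (b 0 z) - d 1 * cont (\<lambda>k. b (k + 2)) (\<lambda>k. d (k + 2)) k z"
      using less[of k] 3 by simp
    have "cont b d (Suc (Suc n)) z = b (Suc n) (cont b d (Suc (Suc (Suc k))) z) - d (Suc n) * cont b d (Suc (Suc k)) z"
      unfolding 3 by (rule cont.simps)
    also have "\<dots> = (b (Suc n) (cont (\<lambda>k. b (k + 1)) (\<lambda>k. d (k + 1)) (Suc (Suc k)) (b 0 z)) - d (Suc n) * cont (\<lambda>k. b (k + 1)) (\<lambda>k. d (k + 1)) (Suc k) (b 0 z))
        - d 1 * (b (Suc n) (cont (\<lambda>k. b (k + 2)) (\<lambda>k. d (k + 2)) (Suc k) z) - d (Suc n) * cont (\<lambda>k. b (k + 2)) (\<lambda>k. d (k + 2)) k z)"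
      unfolding IH1 IH2 b_diff b_d right_diff_distrib using d_commute[of "Suc n" 1] by (simp del: cont.simps)
    also have "b (Suc n) (cont (\<lambda>k. b (k + 1)) (\<lambda>k. d (k + 1)) (Suc (Suc k)) (b 0 z)) - d (Suc n) * cont (\<lambda>k. b (k + 1)) (\<lambda>k. d (k + 1)) (Suc k) (b 0 z)
        = cont (\<lambda>k. b (k + 1)) (\<lambda>k. d (k + 1)) (Suc n) (b 0 z)"
      unfolding 3 by simp
    also have "b (Suc n) (cont (\<lambda>k. b (k + 2)) (\<lambda>k. d (k + 2)) (Suc k) z) - d (Suc n) * cont (\<lambda>k. b (k + 2)) (\<lambda>k. d (k + 2)) k z
        = cont (\<lambda>k. b (k + 2)) (\<lambda>k. d (k + 2)) n z"
      unfolding 3 by simp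
    finally show ?thesis .
  qed
qed

lemma cont_commute:
  assumes "continuant_data b d" "\<And>k x. f (b k x) = b k (f x)" "\<And>x y. f (x - y) = f x - f y" "\<And>k x. f (d k * x) = d k * f x"
  shows "cont b d n (f z) = f (cont b d n z)"
  by (induction n rule: induct_nat_012) (simp_all add: assms)

text \<open>
  Expanding one continuant at the right end and the other at the left end gives the same recursion.
\<close>

lemma cont_reverse:
  assumes "continuant_data b d"
  shows "cont (\<lambda>k. b (m - 1 - k)) (\<lambda>k. d (m - k)) m z = cont b d m z"
  using assms
proof (induction m arbitrary: b d rule: less_induct)
  case (less m)
  interpret continuant_data b d by fact
  consider "m = 0" | "m = 1" | n where "m = Suc (Suc n)" by (metis One_nat_def not0_implies_Suc)
  then show ?case
  proof cases
    case 3
    let ?b1 = "\<lambda>k. b (k + 1)" and ?d1 = "\<lambda>k. d (k + 1)" and ?b2 = "\<lambda>k. b (k + 2)" and ?d2 = "\<lambda>k. d (k + 2)"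
    let ?rb = "\<lambda>k. b (m - 1 - k)" and ?rd = "\<lambda>k. d (m - k)"
    have r1: "cont ?rb ?rd (Suc n) z = cont ?b1 ?d1 (Suc n) z"
    proof -
      have "cont ?rb ?rd (Suc n) z = cont (\<lambda>k. ?b1 (Suc n - 1 - k)) (\<lambda>k. ?d1 (Suc n - k)) (Suc n) z"
        by (rule cont_cong) (auto simp: 3 Suc_diff_le Suc_diff_Suc)
      also have "\<dots> = cont ?b1 ?d1 (Suc n) z"
        using less.IH[of "Suc n" ?b1 ?d1] 3 continuant_data_shift[OF less.prems, of 1] by simp
      finally show ?thesis .
    qed
    have r2: "cont ?rb ?rd n z = cont ?b2 ?d2 n z"
    proof -
      have "cont ?rb ?rd n z = cont (\<lambda>k. ?b2 (n - 1 - k)) (\<lambda>k. ?d2 (n - k)) n z"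
        by (rule cont_cong) (auto simp: 3 Suc_diff_le Suc_diff_Suc)
      also have "\<dots> = cont ?b2 ?d2 n z"
        using less.IH[of n ?b2 ?d2] 3 continuant_data_shift[OF less.prems, of 2] by simp
      finally show ?thesis .
    qed
    have "cont ?rb ?rd m z = b 0 (cont ?rb ?rd (Suc n) z) - d 1 * cont ?rb ?rd n z"
      unfolding 3 by simp
    also have "\<dots> = b 0 (cont ?b1 ?d1 (Suc n) z) - d 1 * cont ?b2 ?d2 n z"
      unfolding r1 r2 ..
    also have "b 0 (cont ?b1 ?d1 (Suc n) z) = cont ?b1 ?d1 (Suc n) (b 0 z)"
      by (rule cont_commute[symmetric, of ?b1 ?d1 "b 0"])
         (use continuant_data_shift[OF less.prems, of 1] b_commute b_diff b_d in simp_all)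
    also have "\<dots> - d 1 * cont ?b2 ?d2 n z = cont b d m z"
      unfolding 3 cont_left[OF less.prems] ..
    finally show ?thesis .
  qed simp_all
qed

context scalars
begin

text \<open>
  The step of \<open>qad\<close>, as an operator on the algebra; these operators commute for fixed \<open>B\<close>, being built from left and right
  multiplication by \<open>B\<close>.
\<close>

definition shiftop :: "complex \<Rightarrow> complex \<Rightarrow> 'a \<Rightarrow> nat \<Rightarrow> 'a \<Rightarrow> 'a"
  where "shiftop v t B k z = B * z - s (t * v ^ (2 * k)) * z * B"

lemma continuant_data_shiftop: "continuant_data (shiftop v t B) (\<lambda>k. s (f k))"
proof
  fix x y :: 'a and i j k
  have c: "s a * (s b * x) = s b * (s a * x)" for a b x by (simp flip: s_mult mult.assoc add: mult.commute)
  show "shiftop v t B k (x - y) = shiftop v t B k x - shiftop v t B k y"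
    by (simp add: shiftop_def algebra_simps)
  show "shiftop v t B k (s (f j) * x) = s (f j) * shiftop v t B k x"
    by (simp add: shiftop_def right_diff_distrib mult.assoc s_left_commute[of B] c[of "t * v ^ (2 * k)"])
  show "shiftop v t B i (shiftop v t B j x) = shiftop v t B j (shiftop v t B i x)"
    by (simp add: shiftop_def right_diff_distrib left_diff_distrib mult.assoc s_left_commute[of B] c[of "t * v ^ (2 * i)"])
  show "s (f i) * (s (f j) * x) = s (f j) * (s (f i) * x)" by (rule c)
qed

lemma cont_eq_qad:
  assumes v: "generic_param v"
    and "k * F = s (v ^ 4) * F * k" "Y * F = s (v\<^sup>2) * (F * Y + s c * (1 - k))"
    and "Y * G = s t * G * Y" "k * G = s (t\<^sup>2) * G * k"
  shows "cont (shiftop v t (F + Y)) (\<lambda>j. s (dcoef v t c j)) n G = qad v t F G n"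
proof -
  have step: "shiftop v t (F + Y) j (qad v t F G j) - s (dcoef v t c j) * (case j of 0 \<Rightarrow> 0 | Suc i \<Rightarrow> qad v t F G i) = qad v t F G (Suc j)" for j
    using qad_three_term[OF assms, of j] by (simp add: shiftop_def)
  show ?thesis
  proof (induction n rule: induct_nat_012)
    case 1
    then show ?case using step[of 0] by (simp del: qad.simps(2))
  next
    case (ge2 n)
    then show ?case using step[of "Suc n"] by (simp del: qad.simps(2))
  qed simp
qed

text \<open>
  The continuant in left and right multiplication by \<open>B = F + Y\<close> turns \<open>G\<close> into a Serre element by
  \<open>cont_eq_qad\<close>. With \<open>F\<close> and \<open>Y\<close> exchanged, \<open>v\<close> inverted and \<open>c\<close> replaced by \<open>- v\<^sup>2 c\<close> the hypotheses have the same
  shape, and the parameters of the new continuant are those of the old one in reverse order. Hence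
  it also turns \<open>H\<close> into a Serre element.
\<close>

lemma iserre:
  assumes v: "generic_param v"
    and kF: "k * F = s (v ^ 4) * F * k" and YF: "Y * F = s (v\<^sup>2) * (F * Y + s c * (1 - k))"
    and YG: "Y * G = s (inverse v ^ n) * G * Y" and kG: "k * G = s ((inverse v ^ n)\<^sup>2) * G * k"
    and kY: "k * Y = s (inverse v ^ 4) * Y * k"
    and FH: "F * H = s (v ^ n) * H * F" and kH: "k * H = s ((v ^ n)\<^sup>2) * H * k"
    and serre: "serre_sum v (Suc n) F G = 0" "serre_sum v (Suc n) Y H = 0"
  shows "cont (shiftop v (inverse v ^ n) (F + Y)) (\<lambda>j. s (dcoef v (inverse v ^ n) c j)) (Suc n) (G + H) = 0"
proof -
  let ?t = "inverse v ^ n"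
  let ?b = "shiftop v ?t (F + Y)" and ?d = "\<lambda>j. s (dcoef v ?t c j)"
  have v0: "v \<noteq> 0" using v by (simp add: generic_param_def)
  interpret continuant_data ?b ?d by (rule continuant_data_shiftop)
  have add: "cont ?b ?d m (x + y) = cont ?b ?d m x + cont ?b ?d m y" for m x y
  proof -
    have "shiftop v ?t (F + Y) j (x + y) = shiftop v ?t (F + Y) j x + shiftop v ?t (F + Y) j y" for j x y
      by (simp add: shiftop_def algebra_simps)
    then show ?thesis by (induction m rule: induct_nat_012) (simp_all add: algebra_simps)
  qed
  have G: "cont ?b ?d (Suc n) G = 0"
    unfolding cont_eq_qad[OF v kF YF YG kG] using serre(1) by (simp only: serre_sum_eq_qad[OF v])
  have vi: "generic_param (inverse v)" by (rule generic_param_inverse[OF v])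
  \<comment> \<open>The relation between \<open>Y\<close> and \<open>F\<close>, solved for \<open>F * Y\<close>, is of the same form.\<close>
  have FY: "F * Y = s ((inverse v)\<^sup>2) * (Y * F + s (- (v\<^sup>2 * c)) * (1 - k))"
  proof -
    have e: "(inverse v)\<^sup>2 * v\<^sup>2 = 1" using v0 by (simp add: power_mult_distrib[symmetric])
    have "s ((inverse v)\<^sup>2) * (Y * F + s (- (v\<^sup>2 * c)) * (1 - k))
        = s ((inverse v)\<^sup>2) * (s (v\<^sup>2) * (F * Y))"
      unfolding YF by (simp add: s_mult s_uminus distrib_left mult.assoc)
    also have "\<dots> = s ((inverse v)\<^sup>2 * v\<^sup>2) * (F * Y)" by (simp only: s_mult mult.assoc)
    also have "\<dots> = F * Y" unfolding e by simp
    finally show ?thesis ..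
  qed
  have "cont ?b ?d (Suc n) H = cont (\<lambda>k. ?b (Suc n - 1 - k)) (\<lambda>k. ?d (Suc n - k)) (Suc n) H"
    by (rule cont_reverse[symmetric, OF continuant_data_shiftop])
  also have "\<dots> = cont (shiftop (inverse v) (v ^ n) (Y + F)) (\<lambda>j. s (dcoef (inverse v) (v ^ n) (- (v\<^sup>2 * c)) j)) (Suc n) H"
  proof (rule cont_cong)
    fix k assume "k < Suc n"
    then obtain l where n: "n = k + l" by (metis le_add_diff_inverse less_Suc_eq_le)
    have "inverse v ^ n * v ^ (2 * (Suc n - 1 - k)) = v ^ n * inverse v ^ (2 * k)"
      unfolding n using v0 by (simp add: power_add mult_2 mult_2_right power_inverse field_simps)
    then show "?b (Suc n - 1 - k) = shiftop (inverse v) (v ^ n) (Y + F) k"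
      by (intro ext) (simp only: shiftop_def add.commute[of Y F])
    show "?d (Suc n - k) = s (dcoef (inverse v) (v ^ n) (- (v\<^sup>2 * c)) k)"
      using dcoef_reverse[OF v, of k n c] n by simp
  qed
  also have "\<dots> = qad (inverse v) (v ^ n) Y H (Suc n)"
    by (rule cont_eq_qad[OF vi kY FY FH kH])
  also have "\<dots> = 0" using serre(2) by (simp only: serre_sum_eq_qad'[OF v])
  finally show ?thesis using G by (simp only: add) simp
qed

end

section \<open>Linear operators on functions, acting from the right\<close>

text \<open>
  Linear operators on complex functions, with multiplication defined below as composition in reverse order. A
  product of operators indexed by the letters of a word then acts letter by letter from the left, and the
  transpose of left multiplication in the free algebra becomes a multiplicative map.
\<close>

typedef 'k rop = "{f :: ('k \<Rightarrow> complex) \<Rightarrow> 'k \<Rightarrow> complex.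
    (\<forall>x y. f (\<lambda>k. x k + y k) = (\<lambda>k. f x k + f y k)) \<and> (\<forall>c x. f (\<lambda>k. c * x k) = (\<lambda>k. c * f x k))}"
  morphisms act Rop
  by (rule exI[of _ id]) simp

lemma act_add: "act f (\<lambda>k. x k + y k) = (\<lambda>k. act f x k + act f y k)"
  and act_scale: "act f (\<lambda>k. c * x k) = (\<lambda>k. c * act f x k)"
  using act[of f] by blast+

lemma act_Rop:
  assumes "\<And>x y k. f (\<lambda>k. x k + y k) k = f x k + f y k" "\<And>c x k. f (\<lambda>k. c * x k) k = c * f x k"
  shows "act (Rop f) = f"
  using assms by (intro Rop_inverse) (auto simp: fun_eq_iff)

lemma rop_eqI: "(\<And>x k. act f x k = act g x k) \<Longrightarrow> f = g"
  by (metis act_inject ext)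

lemma act_0 [simp]: "act f (\<lambda>k. 0) = (\<lambda>k. 0)"
  using act_scale[of f 0 "\<lambda>_. 0"] by simp

instantiation rop :: (type) ring_1
begin

definition "0 = Rop (\<lambda>x k. 0)"
definition "1 = Rop (\<lambda>x. x)"
definition "f + g = Rop (\<lambda>x k. act f x k + act g x k)"
definition "f - g = Rop (\<lambda>x k. act f x k - act g x k)"
definition "- f = Rop (\<lambda>x k. - act f x k)"
definition "f * g = Rop (\<lambda>x. act g (act f x))"

lemma act_simps:
  "act 0 x k = 0" "act 1 x = x" "act (f + g) x k = act f x k + act g x k"
  "act (f - g) x k = act f x k - act g x k" "act (- f) x k = - act f x k"
  "act (f * g) x = act g (act f x)"
  unfolding zero_rop_def one_rop_def plus_rop_def minus_rop_def uminus_rop_def times_rop_def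
  by (subst act_Rop; simp add: act_add act_scale algebra_simps)+

instance
proof
  show "(0 :: 'a rop) \<noteq> 1"
  proof
    assume "(0 :: 'a rop) = 1"
    then have "act 0 (\<lambda>_. 1) undefined = act (1 :: 'a rop) (\<lambda>_. 1) undefined" by simp
    then show False by (simp add: act_simps)
  qed
next
  fix a b c :: "'a rop"
  show "a * b * c = a * (b * c)" by (rule rop_eqI) (simp add: act_simps)
  show "1 * a = a" "a * 1 = a" by (rule rop_eqI, simp add: act_simps)+
  show "a + b + c = a + (b + c)" "a + b = b + a" "0 + a = a" "- a + a = 0" "a - b = a + - b"
    by (rule rop_eqI, simp add: act_simps)+
  have e: "act (a + b) x = (\<lambda>k. act a x k + act b x k)" for a b :: "'a rop" and x by (rule ext) (simp add: act_simps)
  show "(a + b) * c = a * c + b * c" by (rule rop_eqI) (simp add: act_simps e act_add)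
  show "a * (b + c) = a * b + a * c" by (rule rop_eqI) (simp add: act_simps)
qed

end

lemma act_plus: "act (a + b) x = (\<lambda>k. act a x k + act b x k)"
  and act_diff: "act (a - b) x = (\<lambda>k. act a x k - act b x k)"
  and act_zero: "act 0 x = (\<lambda>k. 0)"
  by (rule ext, simp add: act_simps)+

definition rscalar :: "complex \<Rightarrow> 'k rop" where "rscalar c = Rop (\<lambda>x k. c * x k)"

lemma act_rscalar [simp]: "act (rscalar c) x = (\<lambda>k. c * x k)"
  unfolding rscalar_def by (subst act_Rop) (simp_all add: algebra_simps)

interpretation rop: scalars "rscalar :: complex \<Rightarrow> 'k rop"
  by standard (rule rop_eqI, simp add: act_simps act_scale algebra_simps)+

lemma act_rscalar_mult: "act (rscalar c * f) x = (\<lambda>k. c * act f x k)"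
  by (simp add: act_simps act_scale)

lemma act_sum: "act (sum f A) x = (\<lambda>k. \<Sum>a\<in>A. act (f a) x k)"
  by (induction A rule: infinite_finite_induct) (simp_all add: act_zero act_plus)

section \<open>Free algebras\<close>

lemma const_0 [simp]: "const 0 = 0" by (simp add: const_def)
lemma const_1 [simp]: "const 1 = 1" by (simp add: const_def)
lemma const_add: "const (c + d) = const c + const d" by (simp add: const_def single_add)
lemma const_mult: "const (c * d) = const c * const d" by (simp add: const_def mult_single)

lemma monomial_Nil [simp]: "monomial [] = 1"
  by (simp add: monomial_def flip: zero_word_def)

lemma monomial_append: "monomial (u @ v) = monomial u * monomial v"
  by (simp add: monomial_def mult_single plus_word_def)

lemma const_monomial: "const c * monomial w = Poly_Mapping.single (Word w) c"
  by (simp add: const_def monomial_def mult_single)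

lemma lookup_monomial: "Poly_Mapping.lookup (monomial w) k = (if k = Word w then 1 else 0)"
  by (simp add: monomial_def lookup_single when_def)

lemma falg_induct [case_names zero add]:
  assumes "P 0" "\<And>c w p. P p \<Longrightarrow> P (const c * monomial w + p)"
  shows "P (p :: 'g falg)"
proof (induction p rule: update_induct)
  case const
  then show ?case by (fact assms(1))
next
  case (update f a b)
  have "Poly_Mapping.update a b f = Poly_Mapping.single a b + f"
    using update(1) by (intro poly_mapping_eqI) (auto simp: lookup_update lookup_add lookup_single in_keys_iff)
  also have "Poly_Mapping.single a b = const b * monomial (letters a)" by (simp add: const_monomial)
  finally show ?case using assms(2)[OF update(3)] by simp
qed

lemma const_central: "p * const c = const c * p"
proof (induction p rule: falg_induct)
  case (add d w p)
  have "const d * monomial w * const c = const c * (const d * monomial w)"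
    unfolding const_monomial unfolding const_def mult_single by (simp add: mult.commute)
  from arg_cong2[OF this add, of "(+)"] show ?case unfolding distrib_left distrib_right .
qed simp

interpretation falg: scalars "const :: complex \<Rightarrow> 'g falg"
  by standard (rule const_1 const_add const_mult const_central)+

lemma lookup_const_mult: "Poly_Mapping.lookup (const c * p) w = c * Poly_Mapping.lookup p w"
proof (induction p rule: falg_induct)
  case (add d u p)
  have "const c * (const d * monomial u + p) = const (c * d) * monomial u + const c * p"
    by (simp add: distrib_left const_mult mult.assoc)
  with add show ?case by (simp add: lookup_add const_monomial lookup_single when_def algebra_simps)
qed simp

lemma keys_const_mult: "Poly_Mapping.keys (const c * p) \<subseteq> Poly_Mapping.keys p"
  by (auto simp: in_keys_iff lookup_const_mult)

lemma falg_eq_sum: "p = (\<Sum>w\<in>Poly_Mapping.keys p. const (Poly_Mapping.lookup p w) * monomial (letters w))"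
proof (rule poly_mapping_eqI)
  fix k
  have "Poly_Mapping.lookup (\<Sum>w\<in>Poly_Mapping.keys p. const (Poly_Mapping.lookup p w) * monomial (letters w)) k
      = (\<Sum>w\<in>Poly_Mapping.keys p. if k = w then Poly_Mapping.lookup p w else 0)"
    unfolding lookup_sum by (intro sum.cong) (simp_all add: lookup_const_mult lookup_monomial)
  then show "Poly_Mapping.lookup p k = Poly_Mapping.lookup (\<Sum>w\<in>Poly_Mapping.keys p. const (Poly_Mapping.lookup p w) * monomial (letters w)) k"
    by (simp add: in_keys_iff)
qed

subsection \<open>Evaluation\<close>

context scalars
begin

definition ev :: "('g \<Rightarrow> 'a) \<Rightarrow> 'g falg \<Rightarrow> 'a"
  where "ev h p = (\<Sum>w\<in>Poly_Mapping.keys p. s (Poly_Mapping.lookup p w) * prod_list (map h (letters w)))"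

lemma ev_0 [simp]: "ev h 0 = 0"
  by (simp add: ev_def)

lemma ev_add: "ev h (p + q) = ev h p + ev h q"
  unfolding ev_def by (rule setsum_keys_plus_distrib) (simp_all add: s_add distrib_right)

lemma ev_single: "ev h (const c * monomial w) = s c * prod_list (map h w)"
  by (simp add: ev_def const_monomial)

lemma ev_monomial: "ev h (monomial w) = prod_list (map h w)"
  using ev_single[of h 1 w] by simp

lemma ev_gen [simp]: "ev h (gen g) = h g"
  by (simp add: gen_def ev_monomial)

lemma ev_const [simp]: "ev h (const c) = s c"
  using ev_single[of h c "[]"] by simp

lemma ev_1 [simp]: "ev h 1 = 1"
  using ev_const[of h 1] by simp

lemma ev_const_mult: "ev h (const c * p) = s c * ev h p"
proof (induction p rule: falg_induct)
  case (add d w p)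
  have "const c * (const d * monomial w + p) = const (c * d) * monomial w + const c * p"
    by (simp add: distrib_left const_mult mult.assoc)
  with add show ?case by (simp add: ev_add ev_single s_mult distrib_left mult.assoc)
qed simp

lemma ev_mult: "ev h (p * q) = ev h p * ev h q"
proof (induction p rule: falg_induct)
  case (add c u p)
  have "ev h (monomial u * q) = prod_list (map h u) * ev h q"
  proof (induction q rule: falg_induct)
    case (add d w q)
    have "monomial u * (const d * monomial w + q) = const d * monomial (u @ w) + monomial u * q"
      by (simp add: distrib_left falg.s_left_commute[of "monomial u"] monomial_append)
    with add show ?case
      by (simp add: ev_add ev_single distrib_left s_left_commute[of "prod_list (map h u)"] mult.assoc)
  qed simp
  with add show ?case
    by (simp add: distrib_right ev_add mult.assoc ev_const_mult ev_monomial)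
qed simp

lemma ev_uminus: "ev h (- p) = - ev h p"
  using ev_add[of h p "- p"] by (simp add: eq_neg_iff_add_eq_0 add.commute)

lemma ev_diff: "ev h (p - q) = ev h p - ev h q"
  using ev_add[of h p "- q"] by (simp add: ev_uminus)

lemma ev_power: "ev h (p ^ n) = ev h p ^ n"
  by (induction n) (simp_all add: ev_mult)

lemma ev_sum: "ev h (sum f A) = (\<Sum>a\<in>A. ev h (f a))"
  by (induction A rule: infinite_finite_induct) (simp_all add: ev_add)

lemma ev_serre_sum: "ev h (falg.serre_sum v m P Q) = serre_sum v m (ev h P) (ev h Q)"
  by (simp add: falg.serre_sum_def serre_sum_def ev_sum ev_mult ev_power)

lemma ev_ev: "ev h (falg.ev k p) = ev (\<lambda>g. ev h (k g)) p"
proof (induction p rule: falg_induct)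
  case (add c w p)
  have "ev h (prod_list (map k w)) = prod_list (map (\<lambda>g. ev h (k g)) w)"
    by (induction w) (simp_all add: ev_mult)
  with add show ?case
    by (simp add: ev_add falg.ev_add ev_single falg.ev_single ev_const_mult ev_monomial)
qed (simp add: falg.ev_0)

lemma ev_cont:
  "ev h (cont (falg.shiftop v t B) (\<lambda>j. const (d j)) n z) = cont (shiftop v t (ev h B)) (\<lambda>j. s (d j)) n (ev h z)"
  by (induction n rule: induct_nat_012)
     (simp_all add: falg.shiftop_def shiftop_def ev_diff ev_mult ev_const_mult)

end

subsection \<open>Functions on words as functionals\<close>

text \<open>
  Linear functionals on the free algebra are the same thing as arbitrary functions on words.
\<close>

definition pair :: "('g list \<Rightarrow> complex) \<Rightarrow> 'g falg \<Rightarrow> complex"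
  where "pair f p = (\<Sum>w\<in>Poly_Mapping.keys p. Poly_Mapping.lookup p w * f (letters w))"

lemma pair_0 [simp]: "pair f 0 = 0"
  by (simp add: pair_def)

lemma pair_add: "pair f (p + q) = pair f p + pair f q"
  unfolding pair_def by (rule setsum_keys_plus_distrib) (simp_all add: distrib_right)

lemma pair_single: "pair f (const c * monomial w) = c * f w"
  by (simp add: pair_def const_monomial)

lemma pair_monomial [simp]: "pair f (monomial w) = f w"
  using pair_single[of f 1 w] by simp

lemma pair_const_mult: "pair f (const c * p) = c * pair f p"
proof (induction p rule: falg_induct)
  case (add d w p)
  have "const c * (const d * monomial w + p) = const (c * d) * monomial w + const c * p"
    by (simp add: distrib_left const_mult mult.assoc)
  with add show ?case by (simp add: pair_add pair_single algebra_simps)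
qed simp

lemma pair_diff: "pair f (p - q) = pair f p - pair f q"
  using pair_add[of f "p - q" q] by simp

lemma pair_sum: "pair f (sum g A) = (\<Sum>a\<in>A. pair f (g a))"
  by (induction A rule: infinite_finite_induct) (simp_all add: pair_add)

lemma pair_linear_left: "pair (\<lambda>w. f w + g w) p = pair f p + pair g p" "pair (\<lambda>w. c * f w) p = c * pair f p"
  by (simp_all add: pair_def algebra_simps sum.distrib sum_distrib_left)

text \<open>
  The transpose of left multiplication by a letter.
\<close>

definition ltrans :: "'g \<Rightarrow> 'g list rop" where "ltrans x = Rop (\<lambda>f w. f (x # w))"

lemma act_ltrans [simp]: "act (ltrans x) f = (\<lambda>w. f (x # w))"
  unfolding ltrans_def by (subst act_Rop) simp_all

lemma act_prod_ltrans: "act (prod_list (map ltrans u)) f = (\<lambda>w. f (u @ w))"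
  by (induction u arbitrary: f) (simp_all add: act_simps)

lemma act_ev_ltrans: "act (rop.ev ltrans p) f w = pair f (p * monomial w)"
proof (induction p rule: falg_induct)
  case (add c u p)
  have "pair f (const c * monomial u * monomial w) = c * f (u @ w)"
    using pair_single[of f c "u @ w"] by (simp add: monomial_append mult.assoc)
  with add show ?case
    by (simp add: rop.ev_add act_simps rop.ev_single act_rscalar_mult act_prod_ltrans distrib_right pair_add act_scale)
qed (simp add: act_simps)

lemma pair_eq_act: "pair f p = act (rop.ev ltrans p) f []"
  by (simp add: act_ev_ltrans)

lemma pair_act_ev_ltrans: "pair (act (rop.ev ltrans p) f) q = pair f (p * q)"
  by (simp add: pair_eq_act rop.ev_mult act_simps)

section \<open>Extension of scalars\<close>

locale complex_subfield =
  fixes K :: "complex set"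
  assumes K_1: "1 \<in> K" and K_add: "a \<in> K \<Longrightarrow> b \<in> K \<Longrightarrow> a + b \<in> K"
    and K_uminus: "a \<in> K \<Longrightarrow> - a \<in> K" and K_mult: "a \<in> K \<Longrightarrow> b \<in> K \<Longrightarrow> a * b \<in> K"
    and K_inverse: "a \<in> K \<Longrightarrow> inverse a \<in> K"
begin

lemma K_0: "0 \<in> K" using K_add[OF K_1 K_uminus[OF K_1]] by simp
lemma K_diff: "a \<in> K \<Longrightarrow> b \<in> K \<Longrightarrow> a - b \<in> K" using K_add[OF _ K_uminus] by fastforce
lemma K_divide: "a \<in> K \<Longrightarrow> b \<in> K \<Longrightarrow> a / b \<in> K" by (simp add: divide_inverse K_mult K_inverse)
lemma K_prod: "(\<And>a. a \<in> A \<Longrightarrow> f a \<in> K) \<Longrightarrow> prod f A \<in> K"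
  by (induction A rule: infinite_finite_induct) (simp_all add: K_1 K_mult)
lemma K_power: "a \<in> K \<Longrightarrow> a ^ n \<in> K"
  by (induction n) (simp_all add: K_1 K_mult)
lemma K_power_int: "a \<in> K \<Longrightarrow> a powi n \<in> K"
  by (simp add: power_int_def K_power K_inverse)

definition KA :: "'g falg set" where "KA = {p. \<forall>w. Poly_Mapping.lookup p w \<in> K}"

lemma KA_0: "0 \<in> KA" by (simp add: KA_def K_0)
lemma KA_add: "p \<in> KA \<Longrightarrow> q \<in> KA \<Longrightarrow> p + q \<in> KA" by (simp add: KA_def lookup_add K_add)
lemma KA_diff: "p \<in> KA \<Longrightarrow> q \<in> KA \<Longrightarrow> p - q \<in> KA" by (simp add: KA_def lookup_minus K_diff)
lemma KA_const_mult: "c \<in> K \<Longrightarrow> p \<in> KA \<Longrightarrow> const c * p \<in> KA" by (simp add: KA_def lookup_const_mult K_mult)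
lemma KA_monomial: "monomial w \<in> KA" by (simp add: KA_def lookup_monomial K_0 K_1)
lemma KA_sum: "(\<And>a. a \<in> A \<Longrightarrow> f a \<in> KA) \<Longrightarrow> sum f A \<in> KA"
  by (induction A rule: infinite_finite_induct) (simp_all add: KA_0 KA_add)
lemma KA_gen: "gen g \<in> KA" by (simp add: gen_def KA_monomial)
lemma KA_1: "1 \<in> KA" using KA_monomial[of "[]"] by simp
lemma KA_const: "c \<in> K \<Longrightarrow> const c \<in> KA" using KA_const_mult[OF _ KA_1] by simp

lemma KA_induct [consumes 1, case_names zero add]:
  assumes "p \<in> KA" "P 0" "\<And>c w p. c \<in> K \<Longrightarrow> P p \<Longrightarrow> P (const c * monomial w + p)"
  shows "P p"
proof -
  have "finite A \<Longrightarrow> P (\<Sum>w\<in>A. const (Poly_Mapping.lookup p w) * monomial (letters w))" for A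
    by (induction A rule: finite_induct) (use assms in \<open>auto simp: KA_def\<close>)
  from this[OF finite_keys[of p]] show ?thesis by (simp flip: falg_eq_sum)
qed

lemma KA_mult: "p \<in> KA \<Longrightarrow> q \<in> KA \<Longrightarrow> p * q \<in> KA"
proof (induction p rule: KA_induct)
  case (add c u p)
  from add.prems have "monomial u * q \<in> KA"
  proof (induction q rule: KA_induct)
    case (add d w q)
    have "monomial u * (const d * monomial w + q) = const d * monomial (u @ w) + monomial u * q"
      by (simp add: distrib_left falg.s_left_commute[of "monomial u"] monomial_append)
    with add show ?case by (simp add: KA_add KA_const_mult KA_monomial)
  qed (simp add: KA_0)
  with add show ?case by (simp add: distrib_right mult.assoc KA_add KA_const_mult)
qed (simp add: KA_0)

lemma KA_power: "p \<in> KA \<Longrightarrow> p ^ n \<in> KA"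
  by (induction n) (simp_all add: KA_1 KA_mult)

text \<open>
  Choose a word occurring in some \<open>x t\<close> and use \<open>x t\<close> as a pivot: its coefficient differs from an element of \<open>K\<close>
  by a combination of the other coefficients, which amounts to subtracting multiples of \<open>x t\<close> from
  the other \<open>x u\<close>, with one summand fewer.
\<close>

lemma flatness:
  assumes "finite A" "\<And>t. t \<in> A \<Longrightarrow> x t \<in> S" "S \<subseteq> KA" "0 \<in> S"
    and S_add: "\<And>p q. p \<in> S \<Longrightarrow> q \<in> S \<Longrightarrow> p + q \<in> S"
    and S_scale: "\<And>c p. c \<in> K \<Longrightarrow> p \<in> S \<Longrightarrow> const c * p \<in> S"
    and "(\<Sum>t\<in>A. const (c t) * x t) \<in> KA"
  shows "(\<Sum>t\<in>A. const (c t) * x t) \<in> S"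
  using assms(1,2,7)
proof (induction "card A" arbitrary: A x)
  case 0
  then show ?case using assms(4) by simp
next
  case (Suc n)
  let ?p = "\<Sum>t\<in>A. const (c t) * x t"
  show ?case
  proof (cases "\<forall>t\<in>A. x t = 0")
    case True
    then show ?thesis using assms(4) by simp
  next
    case False
    then obtain t w where t: "t \<in> A" "Poly_Mapping.lookup (x t) w \<noteq> 0"
      by (metis lookup_zero poly_mapping_eqI)
    define e where "e u = Poly_Mapping.lookup (x u) w / Poly_Mapping.lookup (x t) w" for u
    define e0 where "e0 = Poly_Mapping.lookup ?p w / Poly_Mapping.lookup (x t) w"
    have xK: "Poly_Mapping.lookup (x u) w \<in> K" if "u \<in> A" for u
      using Suc.prems(2)[OF that] assms(3) by (auto simp: KA_def)
    have eK: "e u \<in> K" if "u \<in> A" for u using xK[OF that] xK[OF t(1)] by (simp add: e_def K_divide)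
    have e0K: "e0 \<in> K" unfolding e0_def by (rule K_divide) (use Suc.prems(3) xK[OF t(1)] in \<open>auto simp: KA_def\<close>)
    let ?A = "A - {t}"
    have fin: "finite ?A" and cd: "card ?A = n" using Suc t by auto
    have "Poly_Mapping.lookup ?p w = (\<Sum>u\<in>A. c u * Poly_Mapping.lookup (x u) w)"
      by (simp add: lookup_sum lookup_const_mult)
    also have "\<dots> = c t * Poly_Mapping.lookup (x t) w + (\<Sum>u\<in>?A. c u * Poly_Mapping.lookup (x u) w)"
      by (rule sum.remove) (use Suc.prems t in auto)
    finally have "e0 = c t + (\<Sum>u\<in>?A. c u * e u)"
      using t(2) by (simp add: e0_def e_def add_divide_distrib sum_divide_distrib)
    then have ct: "c t = e0 - (\<Sum>u\<in>?A. c u * e u)" by simp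
    define y where "y u = x u - const (e u) * x t" for u
    have "?p = const (c t) * x t + (\<Sum>u\<in>?A. const (c u) * x u)"
      by (rule sum.remove) (use Suc.prems t in auto)
    also have "\<dots> = const e0 * x t + (\<Sum>u\<in>?A. const (c u) * y u)"
      unfolding ct y_def
      by (simp add: falg.s_diff falg.s_sum left_diff_distrib right_diff_distrib sum_subtractf sum_distrib_right const_mult mult.assoc)
    finally have p: "?p = const e0 * x t + (\<Sum>u\<in>?A. const (c u) * y u)" .
    have xtS: "const e0 * x t \<in> S" using S_scale[OF e0K Suc.prems(2)[OF t(1)]] .
    have "(\<Sum>u\<in>?A. const (c u) * y u) \<in> S"
    proof (rule Suc.hyps(1))
      show "n = card ?A" using cd ..
      show "y u \<in> S" if "u \<in> ?A" for u
      proof -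
        have "y u = x u + const (- e u) * x t" by (simp add: y_def falg.s_uminus)
        then show ?thesis using that Suc.prems(2) t(1) eK by (auto intro!: S_add S_scale K_uminus)
      qed
      have "(\<Sum>u\<in>?A. const (c u) * y u) = ?p - const e0 * x t" using p by simp
      then show "(\<Sum>u\<in>?A. const (c u) * y u) \<in> KA" using Suc.prems(3) xtS assms(3) by (auto intro: KA_diff)
    qed (use fin in auto)
    then show ?thesis unfolding p using xtS by (rule S_add[rotated])
  qed
qed

end

section \<open>Functionals and the regular representation of a quotient\<close>

interpretation falg_vs: vector_space "\<lambda>c (p :: 'g falg). const c * p"
  by standard (simp_all add: distrib_left distrib_right const_add const_mult mult.assoc)

interpretation complex_vs: vector_space "(*) :: complex \<Rightarrow> complex \<Rightarrow> complex"
  by standard (simp_all add: algebra_simps)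

interpretation falg_complex_vs: vector_space_pair "\<lambda>c (p :: 'g falg). const c * p" "(*) :: complex \<Rightarrow> complex \<Rightarrow> complex" ..

lemma separating_functional:
  assumes "falg_vs.subspace S" "x \<notin> S"
  shows "\<exists>f. (\<forall>y\<in>S. pair f y = 0) \<and> pair f x = 1"
proof -
  obtain B where B: "B \<subseteq> S" "falg_vs.independent B" "S \<subseteq> falg_vs.span B"
    using falg_vs.maximal_independent_subset[of S] by blast
  have S: "falg_vs.span B = S" using B assms(1) falg_vs.span_minimal[of B S] by blast
  have "falg_vs.independent (insert x B)"
    using B assms S falg_vs.independent_insertI by auto
  then obtain g where g: "Vector_Spaces.linear (\<lambda>c (p :: 'a falg). const c * p) (*) g" "\<forall>b\<in>insert x B. g b = (if b = x then 1 else 0)"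
    using falg_complex_vs.linear_independent_extend[of "insert x B" "\<lambda>b. if b = x then 1 else 0"] by blast
  interpret g: Vector_Spaces.linear "\<lambda>c (p :: 'a falg). const c * p" "(*)" g by (rule g(1))
  let ?f = "\<lambda>w. g (monomial w)"
  have gp: "pair ?f p = g p" for p
    by (induction p rule: falg_induct) (simp_all add: pair_add pair_single g.add g.scale)
  have "x \<notin> B" using assms(2) B(1) by blast
  then have "g b = 0" if "b \<in> B" for b using g(2) that by auto
  then have "g y = 0" if "y \<in> falg_vs.span B" for y
    using g.eq_0_on_span[of B y] that by blast
  then show ?thesis using g(2) S by (intro exI[of _ ?f]) (simp add: gp)
qed

interpretation fun_vs: vector_space "\<lambda>c (f :: 'k \<Rightarrow> complex). (\<lambda>k. c * f k)"
  by standard (simp_all add: fun_eq_iff algebra_simps)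

interpretation fun_vs_pair: vector_space_pair "\<lambda>c (f :: 'k \<Rightarrow> complex). (\<lambda>k. c * f k)" "\<lambda>c (f :: 'k \<Rightarrow> complex). (\<lambda>k. c * f k)" ..

lemma linear_projection:
  fixes V :: "('k \<Rightarrow> complex) set"
  assumes "(\<lambda>k. 0) \<in> V" "\<And>f g. f \<in> V \<Longrightarrow> g \<in> V \<Longrightarrow> (\<lambda>k. f k + g k) \<in> V" "\<And>c f. f \<in> V \<Longrightarrow> (\<lambda>k. c * f k) \<in> V"
  obtains e :: "'k rop" where "\<And>f. act e f \<in> V" "\<And>f. f \<in> V \<Longrightarrow> act e f = f"
proof -
  have "fun_vs.subspace V"
    using assms by (auto simp: fun_vs.subspace_def zero_fun_def plus_fun_def)
  then obtain g where g: "range g \<subseteq> V" "Vector_Spaces.linear (\<lambda>c (f :: 'k \<Rightarrow> complex). (\<lambda>k. c * f k)) (\<lambda>c f. (\<lambda>k. c * f k)) g" "\<forall>v\<in>V. g v = v"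
    using fun_vs_pair.linear_exists_left_inverse_on[of id V] fun_vs.linear_id by auto
  interpret g: Vector_Spaces.linear "\<lambda>c (f :: 'k \<Rightarrow> complex). (\<lambda>k. c * f k)" "\<lambda>c (f :: 'k \<Rightarrow> complex). (\<lambda>k. c * f k)" g by (rule g(2))
  have "act (Rop g) = g"
    using g.add g.scale by (intro act_Rop) (simp_all add: plus_fun_def)
  then show ?thesis using g by (intro that[of "Rop g"]) auto
qed

text \<open>
  The representation of the quotient by \<open>J\<close> on its dual space, extended to all functions on words. Let \<open>e\<close> be a projection
  onto the functionals vanishing on \<open>J\<close>. An element acts through left multiplication on the image of \<open>e\<close>, and
  on the kernel of \<open>e\<close> it acts through the character \<open>\<epsilon>\<close>. The character makes this a unital representation
  killing \<open>J\<close>; the image of \<open>e\<close> is where information about the quotient is kept.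
\<close>

lemma quotient_representation:
  fixes J :: "'g falg set" and \<epsilon> :: "'g \<Rightarrow> complex"
  assumes J: "0 \<in> J" "\<And>p q. p \<in> J \<Longrightarrow> q \<in> J \<Longrightarrow> p + q \<in> J" "\<And>p q. p \<in> J \<Longrightarrow> p * q \<in> J" "\<And>p q. p \<in> J \<Longrightarrow> q * p \<in> J"
    and eps: "\<And>p. p \<in> J \<Longrightarrow> pair (\<lambda>w. prod_list (map \<epsilon> w)) p = 0"
  obtains \<rho> :: "'g \<Rightarrow> 'g list rop" where
    "\<And>p. p \<in> J \<Longrightarrow> rop.ev \<rho> p = 0"
    "\<And>\<Psi> p. \<forall>y\<in>J. pair \<Psi> y = 0 \<Longrightarrow> act (rop.ev \<rho> p) \<Psi> = act (rop.ev ltrans p) \<Psi>"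
proof -
  define V where "V = {\<Psi>. \<forall>y\<in>J. pair \<Psi> y = 0}"
  obtain e where e: "\<And>f. act e f \<in> V" "\<And>f. f \<in> V \<Longrightarrow> act e f = f"
    by (rule linear_projection[of V]) (auto simp: V_def pair_linear_left, auto simp: pair_def)
  have V_ltrans: "act (rop.ev ltrans p) f \<in> V" if "f \<in> V" for f p
    using that J(4) by (auto simp: V_def pair_act_ev_ltrans)
  have J_V: "act (rop.ev ltrans p) f = (\<lambda>w. 0)" if "f \<in> V" "p \<in> J" for f p
    using that J(3) by (auto simp: V_def act_ev_ltrans fun_eq_iff)
  \<comment> \<open>Operators act from the right: \<open>e * ltrans g\<close> projects first.\<close>
  define \<rho> where "\<rho> g = e * ltrans g + rscalar (\<epsilon> g) * (1 - e)" for g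
  have ee: "e * e = e" by (rule rop_eqI) (simp add: act_simps e)
  have 1: "rop.ev \<rho> p = e * rop.ev ltrans p + rscalar (pair (\<lambda>w. prod_list (map \<epsilon> w)) p) * (1 - e)" for p
  proof (induction p rule: falg_induct)
    case (add c w p)
    have "prod_list (map \<rho> w) = e * prod_list (map ltrans w) + rscalar (prod_list (map \<epsilon> w)) * (1 - e)"
    proof (induction w)
      case (Cons g w)
      let ?P = "prod_list (map ltrans w)" and ?c = "prod_list (map \<epsilon> w)"
      have a: "e * ltrans g * e = e * ltrans g"
        by (rule rop_eqI) (use V_ltrans[OF e(1), of "gen g"] e(2) in \<open>simp add: act_simps\<close>)
      have b: "(1 - e) * e = 0" "(1 - e) * (1 - e) = 1 - e" by (simp_all add: algebra_simps ee)
      have c: "e * ltrans g * (1 - e) = 0" using a by (simp add: right_diff_distrib)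
      have "prod_list (map \<rho> (g # w)) = (e * ltrans g + rscalar (\<epsilon> g) * (1 - e)) * (e * ?P + rscalar ?c * (1 - e))"
        by (simp only: list.map prod_list.Cons Cons.IH) (simp only: \<rho>_def)
      also have "\<dots> = (e * ltrans g * e) * ?P + rscalar ?c * (e * ltrans g * (1 - e))
          + rscalar (\<epsilon> g) * (((1 - e) * e) * ?P) + rscalar (\<epsilon> g) * (rscalar ?c * ((1 - e) * (1 - e)))"
        by (simp only: distrib_left distrib_right mult.assoc rop.s_left_commute[of e] rop.s_left_commute[of "ltrans g"] rop.s_left_commute[of "1 - e"] ac_simps)
      also have "\<dots> = e * (ltrans g * ?P) + rscalar (\<epsilon> g * ?c) * (1 - e)"
        unfolding a b c by (simp add: mult.assoc rop.s_mult)
      finally show ?case by simp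
    qed simp
    with add show ?case
      by (simp add: rop.ev_add rop.ev_single pair_add pair_single rop.s_add rop.s_mult distrib_left distrib_right rop.s_left_commute[of e] mult.assoc)
  qed simp
  show ?thesis
  proof (rule that[of \<rho>])
    fix p assume "p \<in> J"
    then show "rop.ev \<rho> p = 0" using J_V e(1) eps unfolding 1 by (intro rop_eqI) (simp add: act_simps)
  next
    fix \<Psi> p assume "\<forall>y\<in>J. pair \<Psi> y = 0"
    then have "\<Psi> \<in> V" by (simp add: V_def)
    then show "act (rop.ev \<rho> p) \<Psi> = act (rop.ev ltrans p) \<Psi>"
      unfolding 1 by (intro ext) (simp add: act_simps act_diff act_scale e(2))
  qed
qed

section \<open>Quantum groups without Serre relations\<close>

text \<open>
  What is used of the root system: a symmetrised Cartan matrix with a positive definite form, the simple roots being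
  linearly independent.
\<close>

locale cartan_datum =
  fixes \<alpha> :: "'i::{finite,linorder} \<Rightarrow> 'v::euclidean_space" and q :: complex
  assumes half_norm_pos: "0 < half_norm \<alpha> i"
    and inner_roots: "\<alpha> i \<bullet> \<alpha> j = of_int (half_norm \<alpha> i * cartan_int \<alpha> i j)"
    and cartan_diag: "cartan_int \<alpha> i i = 2"
    and cartan_offdiag: "i \<noteq> j \<Longrightarrow> cartan_int \<alpha> i j \<le> 0"
    and roots_independent: "inj \<alpha>" "independent (range \<alpha>)"
    and q_generic: "generic_param q"
begin

definition bil :: "'i \<Rightarrow> 'i \<Rightarrow> int" where "bil i j = half_norm \<alpha> i * cartan_int \<alpha> i j"

lemma bil_sym: "bil i j = bil j i"
  using inner_roots[of i j] inner_roots[of j i] by (simp add: bil_def inner_commute flip: of_int_mult)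

abbreviation "qq i \<equiv> qi \<alpha> q i"

lemma q_nonzero: "q \<noteq> 0" using q_generic by (simp add: generic_param_def)

lemma qq_generic: "generic_param (qq i)"
proof -
  have "qq i = q ^ nat (half_norm \<alpha> i)" using half_norm_pos[of i] by (simp add: qi_def power_int_def)
  moreover have "0 < nat (half_norm \<alpha> i)" using half_norm_pos[of i] by simp
  ultimately show ?thesis
    using q_generic by (simp add: generic_param_def flip: power_mult)
qed

lemma qq_power: "qq i powi cartan_int \<alpha> i j = q powi bil i j"
  by (simp add: qi_def bil_def power_int_mult)

definition neg_cartan :: "'i \<Rightarrow> 'i \<Rightarrow> nat" where "neg_cartan i j = nat (- cartan_int \<alpha> i j)"

lemma serre_len: "i \<noteq> j \<Longrightarrow> nat (1 - cartan_int \<alpha> i j) = Suc (neg_cartan i j)"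
  using cartan_offdiag[of i j] by (simp add: neg_cartan_def nat_diff_distrib Suc_nat_eq_nat_zadd1)

lemma qq_neg_cartan:
  assumes "i \<noteq> j"
  shows "inverse (qq i) ^ neg_cartan i j = q powi bil i j" "qq i ^ neg_cartan i j = q powi (- bil i j)"
proof -
  have c: "cartan_int \<alpha> i j = - int (neg_cartan i j)" using cartan_offdiag[OF assms] by (simp add: neg_cartan_def)
  have "q powi bil i j = inverse (qq i ^ neg_cartan i j)"
    unfolding qq_power[symmetric] c by (simp add: power_int_minus)
  then show "inverse (qq i) ^ neg_cartan i j = q powi bil i j" "qq i ^ neg_cartan i j = q powi (- bil i j)"
    by (simp_all add: power_inverse power_int_minus)
qed

lemma qq_square: "(qq i)\<^sup>2 = q powi bil i i"
  using qq_power[of i i] by (simp add: cartan_diag)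

end

text \<open>
  Elements of an algebra satisfying all relations of the quantum group with the exception of the Serre relations. The
  Serre elements are studied in such algebras before they are set to zero.
\<close>

locale pre_quantum = cartan_datum \<alpha> q + scalars s
  for \<alpha> :: "'i::{finite,linorder} \<Rightarrow> 'v::euclidean_space" and q and s :: "complex \<Rightarrow> 'a::ring_1" +
  fixes E F K Ki :: "'i \<Rightarrow> 'a"
  assumes K_Ki: "K i * Ki i = 1" and Ki_K: "Ki i * K i = 1"
    and K_K: "K i * K j = K j * K i"
    and K_E: "K i * E j * Ki i = s (q powi bil i j) * E j"
    and K_F: "K i * F j * Ki i = s (q powi (- bil i j)) * F j"
    and E_F: "E i * F j - F j * E i = (if i = j then s (inverse (qq i - inverse (qq i))) * (K i - Ki i) else 0)"
begin

lemma powi_cancel: "s (q powi n) * (s (q powi (- n)) * x) = x" "s (q powi (- n)) * (s (q powi n) * x) = x"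
proof -
  have "q powi n * q powi (- n) = 1" using q_nonzero by (simp add: power_int_minus)
  then have "s (q powi n) * s (q powi (- n)) = 1" "s (q powi (- n)) * s (q powi n) = 1"
    by (simp_all flip: s_mult add: mult.commute)
  then show "s (q powi n) * (s (q powi (- n)) * x) = x" "s (q powi (- n)) * (s (q powi n) * x) = x"
    by (simp_all flip: mult.assoc)
qed

lemma Ki_F: "Ki i * F j = s (q powi bil i j) * F j * Ki i"
proof -
  have "F j * Ki i = Ki i * (K i * F j * Ki i)" by (simp add: Ki_K flip: mult.assoc)
  also have "\<dots> = s (q powi (- bil i j)) * (Ki i * F j)" unfolding K_F s_left_commute[of "Ki i"] ..
  finally have "s (q powi bil i j) * (F j * Ki i) = Ki i * F j" by (simp only: powi_cancel)
  then show ?thesis by (simp only: mult.assoc)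
qed

lemma F_K: "F j * K i = s (q powi bil i j) * K i * F j"
proof -
  have "K i * F j = (K i * F j * Ki i) * K i" by (simp add: Ki_K mult.assoc)
  also have "\<dots> = s (q powi (- bil i j)) * (F j * K i)" unfolding K_F by (simp add: mult.assoc)
  finally have "s (q powi bil i j) * (K i * F j) = F j * K i" by (simp only: powi_cancel)
  then show ?thesis by (simp only: mult.assoc)
qed

lemma F_Ki: "F j * Ki i = s (q powi (- bil i j)) * Ki i * F j"
  unfolding mult.assoc Ki_F powi_cancel ..

lemma Ki_E: "Ki i * E j = s (q powi (- bil i j)) * E j * Ki i"
proof -
  have "E j * Ki i = Ki i * (K i * E j * Ki i)" by (simp add: Ki_K flip: mult.assoc)
  also have "\<dots> = s (q powi bil i j) * (Ki i * E j)" unfolding K_E s_left_commute[of "Ki i"] ..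
  finally have "s (q powi (- bil i j)) * (E j * Ki i) = Ki i * E j" by (simp only: powi_cancel)
  then show ?thesis by (simp only: mult.assoc)
qed

lemma Ki_Ki: "Ki i * Ki j = Ki j * Ki i"
proof -
  have "Ki i * Ki j = Ki i * Ki j * (K i * K j) * (Ki j * Ki i)"
    by (simp add: mult.assoc) (simp add: K_Ki flip: mult.assoc[of "K j"])
  also have "K i * K j = K j * K i" by (rule K_K)
  also have "Ki i * Ki j * (K j * K i) = 1"
    by (simp add: mult.assoc) (simp add: Ki_K flip: mult.assoc[of "Ki j"])
  finally show ?thesis by simp
qed

text \<open>
  Chevalley involution: every fact about the \<open>F\<^sub>i\<close> also holds for the \<open>E\<^sub>i\<close>.
\<close>

lemma mirror: "pre_quantum \<alpha> q s F E Ki K"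
proof (unfold_locales)
  fix i j
  show "Ki i * K i = 1" "K i * Ki i = 1" by (fact Ki_K K_Ki)+
  show "Ki i * Ki j = Ki j * Ki i" by (rule Ki_Ki)
  show "Ki i * F j * K i = s (q powi bil i j) * F j" by (simp add: Ki_F Ki_K mult.assoc)
  show "Ki i * E j * K i = s (q powi (- bil i j)) * E j" by (simp add: Ki_E Ki_K mult.assoc)
  show "F i * E j - E j * F i = (if i = j then s (inverse (qq i - inverse (qq i))) * (Ki i - K i) else 0)"
    using E_F[of j i] by (auto simp: algebra_simps)
qed

definition SF :: "'i \<Rightarrow> 'i \<Rightarrow> 'a" where "SF i j = serre_sum (qq i) (nat (1 - cartan_int \<alpha> i j)) (F i) (F j)"

lemma serre_sum_commute:
  assumes "x * P = P * x" "x * Q = Q * x" shows "x * serre_sum v m P Q = serre_sum v m P Q * x"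
proof -
  have p: "x * P ^ k = P ^ k * x" for k
    by (induction k) (simp_all add: mult.assoc assms(1), metis assms(1) mult.assoc)
  have "x * (s c * P ^ k * Q * P ^ l) = s c * P ^ k * Q * P ^ l * x" for c k l
    by (metis (no_types, lifting) assms(2) mult.assoc p s_central)
  then show ?thesis unfolding serre_sum_def sum_distrib_left sum_distrib_right by simp
qed

text \<open>
  This is why the Serre elements generate a proper ideal: in a Verma module they are singular vectors.
\<close>

lemma E_commutes_SF:
  assumes "i \<noteq> j" shows "E k * SF i j = SF i j * E k"
proof -
  have EF0: "E a * F b = F b * E a" if "a \<noteq> b" for a b using E_F[of a b] that by simp
  note n = serre_len[OF assms] and t = qq_neg_cartan[OF assms]
  consider "k = i" | "k = j" | "k \<noteq> i" "k \<noteq> j" by blast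
  then show ?thesis
  proof cases
    case 1
    show ?thesis unfolding SF_def n 1
      by (rule raising_commutes_with_serre_same[OF qq_generic K_Ki Ki_K])
         (use Ki_F[of i i] Ki_F[of i j] E_F[of i i] EF0[of i j] assms in \<open>simp_all add: qq_square t\<close>)
  next
    case 2
    have b: "bil j i = bil i j" by (rule bil_sym)
    show ?thesis unfolding SF_def n 2
      by (rule raising_commutes_with_serre_other[OF qq_generic, where K = "K j" and Ki = "Ki j" and c = "inverse (qq j - inverse (qq j))"])
         (use F_K[of i j] F_Ki[of i j] E_F[of j j] EF0[of j i] assms in \<open>simp_all add: t b\<close>)
  next
    case 3
    then show ?thesis unfolding SF_def by (intro serre_sum_commute EF0)
  qed
qed

lemma Ki_SF: "\<exists>c. c \<noteq> 0 \<and> Ki k * SF i j = s c * SF i j * Ki k"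
proof -
  let ?m = "nat (1 - cartan_int \<alpha> i j)"
  have Fn: "Ki k * F i ^ n = s ((q powi bil k i) ^ n) * (F i ^ n * Ki k)" for n
  proof (induction n)
    case (Suc n)
    have "Ki k * F i ^ Suc n = (s (q powi bil k i) * F i * Ki k) * F i ^ n" by (simp only: power_Suc Ki_F flip: mult.assoc)
    also have "\<dots> = s (q powi bil k i) * (F i * (s ((q powi bil k i) ^ n) * (F i ^ n * Ki k)))" by (simp only: Suc mult.assoc)
    also have "\<dots> = s ((q powi bil k i) ^ Suc n) * (F i ^ Suc n * Ki k)"
      by (simp add: s_left_commute[of "F i"] s_mult mult.assoc)
    finally show ?case .
  qed simp
  let ?a = "q powi bil k i" and ?b = "q powi bil k j"
  have "Ki k * (s c * F i ^ (?m - l) * F j * F i ^ l) = s (?a ^ ?m * ?b) * (s c * F i ^ (?m - l) * F j * F i ^ l) * Ki k"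
    if "l \<le> ?m" for c l
  proof -
    have cc: "s a * (s b * x) = s (a * b) * x" for a b x by (simp add: s_mult mult.assoc)
    have FjK: "Ki k * (F j * x) = s ?b * (F j * (Ki k * x))" for x
      using arg_cong[OF Ki_F[of k j], of "\<lambda>y. y * x"] by (simp only: mult.assoc)
    have FnK: "Ki k * (F i ^ n * x) = s (?a ^ n) * (F i ^ n * (Ki k * x))" for x n
      using arg_cong[OF Fn[of n], of "\<lambda>y. y * x"] by (simp only: mult.assoc)
    have "Ki k * (s c * F i ^ (?m - l) * F j * F i ^ l) = s c * (s (?a ^ (?m - l)) * (F i ^ (?m - l) * (s ?b * (F j * (s (?a ^ l) * (F i ^ l * Ki k))))))"
      by (simp only: mult.assoc s_left_commute[of "Ki k"] FnK FjK Fn)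
    also have "\<dots> = s (c * ?a ^ (?m - l) * ?b * ?a ^ l) * (F i ^ (?m - l) * (F j * (F i ^ l * Ki k)))"
      by (simp only: s_left_commute[of "F j"] s_left_commute[of "F i ^ (?m - l)"] cc mult.assoc)
    also have "c * ?a ^ (?m - l) * ?b * ?a ^ l = (?a ^ ?m * ?b) * c"
      using that by (simp add: power_add[symmetric])
    finally show ?thesis by (simp add: s_mult mult.assoc)
  qed
  then have "Ki k * SF i j = s (?a ^ ?m * ?b) * SF i j * Ki k"
    unfolding SF_def serre_sum_def sum_distrib_left sum_distrib_right by (intro sum.cong) auto
  moreover have "?a ^ ?m * ?b \<noteq> 0" using q_nonzero by simp
  ultimately show ?thesis by blast
qed

lemma K_SF: "\<exists>c. K k * SF i j = s c * SF i j * K k"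
proof -
  obtain c where c: "c \<noteq> 0" "Ki k * SF i j = s c * SF i j * Ki k" using Ki_SF by blast
  have "SF i j * K k = K k * (Ki k * SF i j) * K k" by (simp add: K_Ki flip: mult.assoc)
  also have "\<dots> = s c * (K k * SF i j)" unfolding c(2) by (simp add: mult.assoc Ki_K s_left_commute[of "K k"])
  finally have "s (inverse c) * (SF i j * K k) = s (inverse c * c) * (K k * SF i j)" by (simp only: s_mult mult.assoc)
  then have "K k * SF i j = s (inverse c) * SF i j * K k" using c(1) by (simp add: mult.assoc)
  then show ?thesis by blast
qed

end

section \<open>The dual Verma module\<close>

context cartan_datum
begin

definition wt :: "'i \<Rightarrow> 'i list \<Rightarrow> int" where "wt i w = sum_list (map (bil i) w)"

lemma wt_simps [simp]: "wt i [] = 0" "wt i (x # w) = bil i x + wt i w" "wt i (u @ v) = wt i u + wt i v"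
  by (simp_all add: wt_def)

definition vK :: "int \<Rightarrow> 'i \<Rightarrow> 'i list rop" where "vK e i = Rop (\<lambda>f w. q powi (e * wt i w) * f w)"

lemma act_vK [simp]: "act (vK e i) f = (\<lambda>w. q powi (e * wt i w) * f w)"
  unfolding vK_def by (subst act_Rop) (simp_all add: algebra_simps)

definition weight_coef :: "'i \<Rightarrow> 'i list \<Rightarrow> complex"
  where "weight_coef i w = inverse (qq i - inverse (qq i)) * (q powi (- wt i w) - q powi wt i w)"

text \<open>
  The value at \<open>w\<close> of \<open>E\<^sub>i\<close> applied to \<open>f\<close>. In the Verma module with trivial highest weight, \<open>E\<^sub>i\<close> moves
  from left to right through \<open>w\<close>; at each letter \<open>i\<close> the commutator of \<open>E\<^sub>i\<close> and \<open>F\<^sub>i\<close> removes this letter and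
  contributes a scalar depending on the weight of the letters to its right.
\<close>

primrec lower_at :: "'i list \<Rightarrow> 'i \<Rightarrow> ('i list \<Rightarrow> complex) \<Rightarrow> complex" where
  "lower_at [] i f = 0"
| "lower_at (x # w) i f = (if x = i then weight_coef i w * f w else 0) + lower_at w i (\<lambda>u. f (x # u))"

definition vE :: "'i \<Rightarrow> 'i list rop" where "vE i = Rop (\<lambda>f w. lower_at w i f)"

lemma lower_at_add: "lower_at w i (\<lambda>u. f u + g u) = lower_at w i f + lower_at w i g"
  by (induction w arbitrary: f g) (simp_all add: algebra_simps)

lemma lower_at_scale: "lower_at w i (\<lambda>u. c * f u) = c * lower_at w i f"
  by (induction w arbitrary: f) (simp_all add: algebra_simps)

lemma act_vE [simp]: "act (vE i) f = (\<lambda>w. lower_at w i f)"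
  unfolding vE_def by (subst act_Rop) (simp_all add: lower_at_add lower_at_scale)

lemma lower_at_weight:
  "lower_at w j (\<lambda>u. q powi (c - wt i u) * f u) = q powi (c + bil i j - wt i w) * lower_at w j f"
proof (induction w arbitrary: c f)
  case (Cons x w)
  have e: "c - (bil i x + wt i u) = (c - bil i x) - wt i u" for u by simp
  have "lower_at w j (\<lambda>u. q powi (c - wt i (x # u)) * f (x # u)) = q powi (c - bil i x + bil i j - wt i w) * lower_at w j (\<lambda>u. f (x # u))"
    using Cons[of "c - bil i x" "\<lambda>u. f (x # u)"] by (simp only: wt_simps e)
  moreover have "c - bil i x + bil i j - wt i w = c + bil i j - wt i (x # w)" by simp
  moreover have "x = j \<Longrightarrow> c + bil i j - wt i (x # w) = c - wt i w" by simp
  ultimately show ?case by (simp only: lower_at.simps) (simp add: algebra_simps)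
qed simp

lemma powi_add: "q powi (a + b) = q powi a * q powi b"
  using q_nonzero by (simp add: power_int_add)

text \<open>
  The dual of the Verma module whose vectors are the words themselves, before the Serre relations are imposed.
\<close>

sublocale verma: pre_quantum \<alpha> q "rscalar :: complex \<Rightarrow> 'i list rop" vE ltrans "vK (- 1)" "vK 1"
proof unfold_locales
  fix i j :: 'i
  have 0: "q powi (- n) * (q powi n * x) = x" "q powi n * (q powi (- n) * x) = x" for n x
    using q_nonzero by (simp_all add: power_int_minus)
  show "vK (- 1) i * vK 1 i = 1" "vK 1 i * vK (- 1) i = 1"
    by (rule rop_eqI, simp add: act_simps 0)+
  show "vK (- 1) i * vK (- 1) j = vK (- 1) j * vK (- 1) i"
    by (rule rop_eqI) (simp add: act_simps ac_simps)
  show "vK (- 1) i * vE j * vK 1 i = rscalar (q powi bil i j) * vE j"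
  proof (rule rop_eqI)
    fix f w
    have "act (vK (- 1) i * vE j * vK 1 i) f w = q powi wt i w * lower_at w j (\<lambda>u. q powi (0 - wt i u) * f u)"
      by (simp add: act_simps)
    also have "\<dots> = q powi wt i w * (q powi (bil i j - wt i w) * lower_at w j f)"
      unfolding lower_at_weight by simp
    also have "\<dots> = q powi bil i j * lower_at w j f"
      by (simp flip: mult.assoc powi_add)
    finally show "act (vK (- 1) i * vE j * vK 1 i) f w = act (rscalar (q powi bil i j) * vE j) f w"
      by (simp add: act_simps lower_at_scale)
  qed
  show "vK (- 1) i * ltrans j * vK 1 i = rscalar (q powi (- bil i j)) * ltrans j"
  proof (rule rop_eqI)
    fix f w
    have "q powi wt i w * (q powi (- bil i j - wt i w) * f (j # w)) = q powi (- bil i j) * f (j # w)"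
      by (simp flip: mult.assoc powi_add)
    then show "act (vK (- 1) i * ltrans j * vK 1 i) f w = act (rscalar (q powi (- bil i j)) * ltrans j) f w"
      by (simp add: act_simps)
  qed
  show "vE i * ltrans j - ltrans j * vE i
      = (if i = j then rscalar (inverse (qq i - inverse (qq i))) * (vK (- 1) i - vK 1 i) else 0)"
    by (rule rop_eqI) (simp add: act_simps weight_coef_def act_diff algebra_simps)
qed

text \<open>
  The Serre functionals. Left multiples are accounted for by \<open>u\<close>; right multiples are accounted for because the
  resulting function has to vanish at every word.
\<close>

definition serre_dual :: "('i list \<Rightarrow> complex) set"
  where "serre_dual = {f. \<forall>u i j. i \<noteq> j \<longrightarrow> act (prod_list (map ltrans u) * verma.SF i j) f = (\<lambda>_. 0)}"

lemma serre_dual_zero: "(\<lambda>_. 0) \<in> serre_dual"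
  by (simp add: serre_dual_def)

lemma serre_dual_add: "f \<in> serre_dual \<Longrightarrow> g \<in> serre_dual \<Longrightarrow> (\<lambda>w. f w + g w) \<in> serre_dual"
  by (simp add: serre_dual_def act_add)

lemma serre_dual_scale: "f \<in> serre_dual \<Longrightarrow> (\<lambda>w. c * f w) \<in> serre_dual"
  by (simp add: serre_dual_def act_scale)

lemma serre_dual_ltrans: "f \<in> serre_dual \<Longrightarrow> act (ltrans x) f \<in> serre_dual"
proof -
  assume f: "f \<in> serre_dual"
  have "act (prod_list (map ltrans u) * verma.SF i j) (act (ltrans x) f) = (\<lambda>_. 0)" if "i \<noteq> j" for u i j
  proof -
    have "act (prod_list (map ltrans (x # u)) * verma.SF i j) f = (\<lambda>_. 0)"
      using f that unfolding serre_dual_def by blast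
    then show ?thesis by (simp only: list.map prod_list.Cons act_simps)
  qed
  then show ?thesis unfolding serre_dual_def by blast
qed

lemma serre_dual_SF: "f \<in> serre_dual \<Longrightarrow> i \<noteq> j \<Longrightarrow> act (verma.SF i j) f = (\<lambda>_. 0)"
proof -
  assume "f \<in> serre_dual" "i \<noteq> j"
  then have "act (prod_list (map ltrans []) * verma.SF i j) f = (\<lambda>_. 0)"
    unfolding serre_dual_def by blast
  then show ?thesis by simp
qed

text \<open>
  An operator that commutes with the letters up to scalars and up to operators preserving the Serre functionals only has to be
  tested against the Serre elements themselves.
\<close>

lemma serre_dual_stable:
  assumes base: "\<And>f i j. f \<in> serre_dual \<Longrightarrow> i \<noteq> j \<Longrightarrow> act (verma.SF i j) (act T f) = (\<lambda>_. 0)"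
    and step: "\<And>x. \<exists>c D. T * ltrans x = rscalar c * (ltrans x * T) + D \<and> (\<forall>f\<in>serre_dual. act D f \<in> serre_dual)"
    and f: "f \<in> serre_dual"
  shows "act T f \<in> serre_dual"
proof -
  have "act (prod_list (map ltrans u) * verma.SF i j) (act T f) = (\<lambda>_. 0)" if "i \<noteq> j" for u i j
    using f
  proof (induction u arbitrary: f)
    case Nil
    then show ?case using base that by simp
  next
    case (Cons x u)
    obtain c D where cD: "T * ltrans x = rscalar c * (ltrans x * T) + D" "\<forall>f\<in>serre_dual. act D f \<in> serre_dual"
      using step by blast
    let ?P = "prod_list (map ltrans u) * verma.SF i j"
    have "act (ltrans x) (act T f) = (\<lambda>k. c * act T (act (ltrans x) f) k + act D f k)"
      using arg_cong[OF cD(1), of "\<lambda>g. act g f"] unfolding act_plus act_rscalar_mult act_simps(6)[of T "ltrans x"] act_simps(6)[of "ltrans x" T] .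
    then have "act ?P (act (ltrans x) (act T f)) = (\<lambda>k. c * act ?P (act T (act (ltrans x) f)) k + act ?P (act D f) k)"
      by (simp only: act_add act_scale)
    also have "\<dots> = (\<lambda>_. 0)"
      using Cons.IH[OF serre_dual_ltrans[OF Cons.prems, of x]] cD(2) Cons.prems that
      unfolding serre_dual_def by simp
    finally show ?case by (simp only: list.map prod_list.Cons act_simps)
  qed
  then show ?thesis unfolding serre_dual_def by blast
qed

lemma act_eq_zero:
  assumes "act S f = (\<lambda>_. 0)" "T * S = rscalar c * S * T" shows "act S (act T f) = (\<lambda>_. 0)"
proof -
  have "act S (act T f) = act (T * S) f" by (simp only: act_simps(6))
  also have "\<dots> = act T (\<lambda>w. c * act S f w)" by (simp only: assms(2) act_simps(6)[of _ T] act_rscalar_mult)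
  finally show ?thesis by (simp add: assms(1))
qed

lemma serre_dual_Ki: "f \<in> serre_dual \<Longrightarrow> act (vK 1 k) f \<in> serre_dual"
proof (rule serre_dual_stable)
  fix f i j assume "f \<in> serre_dual" and ij: "(i :: 'i) \<noteq> j"
  then have "act (verma.SF i j) f = (\<lambda>_. 0)" by (rule serre_dual_SF)
  moreover obtain c where "vK 1 k * verma.SF i j = rscalar c * verma.SF i j * vK 1 k" using verma.Ki_SF by blast
  ultimately show "act (verma.SF i j) (act (vK 1 k) f) = (\<lambda>_. 0)" by (rule act_eq_zero)
next
  fix x
  show "\<exists>c D. vK 1 k * ltrans x = rscalar c * (ltrans x * vK 1 k) + D \<and> (\<forall>f\<in>serre_dual. act D f \<in> serre_dual)"
    by (rule exI[of _ "q powi bil k x"], rule exI[of _ 0])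
       (simp add: verma.Ki_F mult.assoc act_zero serre_dual_zero)
qed

lemma serre_dual_K: "f \<in> serre_dual \<Longrightarrow> act (vK (- 1) k) f \<in> serre_dual"
proof (rule serre_dual_stable)
  fix f i j assume f: "f \<in> serre_dual" and ij: "(i :: 'i) \<noteq> j"
  obtain c where c: "vK (- 1) k * verma.SF i j = rscalar c * verma.SF i j * vK (- 1) k" using verma.K_SF by blast
  show "act (verma.SF i j) (act (vK (- 1) k) f) = (\<lambda>_. 0)"
    using serre_dual_SF[OF f ij] c by (rule act_eq_zero)
next
  fix x
  have "vK (- 1) k * ltrans x = rscalar (q powi (- bil k x)) * (ltrans x * vK (- 1) k)"
    unfolding verma.F_K mult.assoc verma.powi_cancel ..
  then show "\<exists>c D. vK (- 1) k * ltrans x = rscalar c * (ltrans x * vK (- 1) k) + D \<and> (\<forall>f\<in>serre_dual. act D f \<in> serre_dual)"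
    by (intro exI[of _ "q powi (- bil k x)"] exI[of _ 0])
       (simp add: act_zero serre_dual_zero)
qed

lemma serre_dual_E: "f \<in> serre_dual \<Longrightarrow> act (vE k) f \<in> serre_dual"
proof (rule serre_dual_stable)
  fix f i j assume f: "f \<in> serre_dual" and ij: "(i :: 'i) \<noteq> j"
  have "act (verma.SF i j) (act (vE k) f) = act (vE k) (act (verma.SF i j) f)"
    using arg_cong[OF verma.E_commutes_SF[OF ij, of k], of "\<lambda>g. act g f"] by (simp only: act_simps)
  then show "act (verma.SF i j) (act (vE k) f) = (\<lambda>_. 0)"
    using serre_dual_SF[OF f ij] by simp
next
  fix x
  let ?D = "if k = x then rscalar (inverse (qq k - inverse (qq k))) * (vK (- 1) k - vK 1 k) else 0"
  have "vE k * ltrans x = rscalar 1 * (ltrans x * vE k) + ?D"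
    using verma.E_F[of k x] by (simp add: algebra_simps)
  moreover have "act ?D f \<in> serre_dual" if "f \<in> serre_dual" for f
  proof (cases "k = x")
    case True
    have "(\<lambda>w. act (vK (- 1) k) f w + - 1 * act (vK 1 k) f w) \<in> serre_dual"
      by (intro serre_dual_add serre_dual_scale serre_dual_K serre_dual_Ki that)
    from serre_dual_scale[OF this, of "inverse (qq k - inverse (qq k))"]
    show ?thesis unfolding if_P[OF True] act_rscalar_mult act_diff by simp
  qed (simp add: act_zero serre_dual_zero)
  ultimately show "\<exists>c D. vE k * ltrans x = rscalar c * (ltrans x * vE k) + D \<and> (\<forall>f\<in>serre_dual. act D f \<in> serre_dual)"
    by blast
qed

text \<open>
  The mirrored Serre element commutes with all letters, so its action is determined by its action on values at the
  empty word, where every \<open>E\<^sub>i\<close> gives zero.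
\<close>

lemma raising_serre_zero:
  assumes "i \<noteq> j"
  shows "act (pre_quantum.SF \<alpha> q rscalar vE i j) f = (\<lambda>_. 0)"
proof
  interpret m: pre_quantum \<alpha> q "rscalar :: complex \<Rightarrow> 'i list rop" ltrans vE "vK 1" "vK (- 1)" by (rule verma.mirror)
  fix w
  show "act (m.SF i j) f w = 0"
  proof (induction w arbitrary: f)
    case Nil
    have last: "act (P * vE k) f [] = 0" for P k by (simp add: act_simps)
    have "act (rscalar c * vE i ^ n * vE j * vE i ^ l) f [] = 0" for c n l
    proof (cases l)
      case 0
      then show ?thesis using last by simp
    next
      case (Suc l')
      then have "rscalar c * vE i ^ n * vE j * vE i ^ l = (rscalar c * vE i ^ n * vE j * vE i ^ l') * vE i"
        by (simp only: power_Suc2 mult.assoc)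
      then show ?thesis by (simp only: last)
    qed
    then show ?case unfolding m.SF_def rop.serre_sum_def by (simp add: act_sum)
  next
    case (Cons x w)
    have "act (m.SF i j) f (x # w) = act (m.SF i j * ltrans x) f w" by (simp add: act_simps)
    also have "m.SF i j * ltrans x = ltrans x * m.SF i j" by (rule m.E_commutes_SF[OF assms, symmetric])
    also have "act (ltrans x * m.SF i j) f w = 0" using Cons by (simp add: act_simps)
    finally show ?case .
  qed
qed

end

section \<open>Defining relations\<close>

context cartan_datum
begin

definition non_serre_relations :: "'i qgen falg set"
  where "non_serre_relations =
    (\<Union>i. {gen (GenK i) * gen (GenKinv i) - 1, gen (GenKinv i) * gen (GenK i) - 1}) \<union>
    (\<Union>i j. {gen (GenK i) * gen (GenK j) - gen (GenK j) * gen (GenK i),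
       gen (GenK i) * gen (GenE j) * gen (GenKinv i)
         - const (qi \<alpha> q i powi cartan_int \<alpha> i j) * gen (GenE j),
       gen (GenK i) * gen (GenF j) * gen (GenKinv i)
         - const (qi \<alpha> q i powi (- cartan_int \<alpha> i j)) * gen (GenF j),
       gen (GenE i) * gen (GenF j) - gen (GenF j) * gen (GenE i)
         - (if i = j then const (inverse (qi \<alpha> q i - inverse (qi \<alpha> q i)))
              * (gen (GenK i) - gen (GenKinv i)) else 0)})"

lemma U_relations_eq:
  "U_relations \<alpha> q = non_serre_relations \<union> (\<Union>i. \<Union>j\<in>-{i}. {serre \<alpha> q GenE i j, serre \<alpha> q GenF i j})"
  unfolding U_relations_def non_serre_relations_def ..

lemma serre_eq: "serre \<alpha> q x i j = falg.serre_sum (qq i) (nat (1 - cartan_int \<alpha> i j)) (gen (x i)) (gen (x j))"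
  by (simp add: serre_def falg.serre_sum_def Let_def)

lemma qq_power_minus: "qq i powi (- cartan_int \<alpha> i j) = q powi (- bil i j)"
  by (simp add: qi_def bil_def power_int_mult flip: power_int_mult)

end

context pre_quantum
begin

primrec gmap :: "'i qgen \<Rightarrow> 'a" where
  "gmap (GenE i) = E i" | "gmap (GenF i) = F i" | "gmap (GenK i) = K i" | "gmap (GenKinv i) = Ki i"

lemma ev_non_serre_relations:
  assumes "r \<in> non_serre_relations" shows "ev gmap r = 0"
  using assms unfolding non_serre_relations_def
  by (auto simp: ev_diff ev_mult ev_const_mult K_Ki Ki_K K_K K_E K_F E_F qq_power qq_power_minus)

end

lemma (in cartan_datum) pre_quantumI:
  fixes s :: "complex \<Rightarrow> 'a::ring_1"
  assumes "scalars s" and rel: "\<And>r. r \<in> non_serre_relations \<Longrightarrow> scalars.ev s h r = 0"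
  shows "pre_quantum \<alpha> q s (\<lambda>i. h (GenE i)) (\<lambda>i. h (GenF i)) (\<lambda>i. h (GenK i)) (\<lambda>i. h (GenKinv i))"
proof -
  interpret scalars s by fact
  note ev = ev_diff ev_mult ev_const_mult ev_gen ev_1
  show ?thesis
  proof unfold_locales
    fix i j
    have "ev h (gen (GenK i) * gen (GenKinv i) - 1) = 0" by (rule rel) (auto simp: non_serre_relations_def)
    then show "h (GenK i) * h (GenKinv i) = 1" by (simp add: ev)
    have "ev h (gen (GenKinv i) * gen (GenK i) - 1) = 0" by (rule rel) (auto simp: non_serre_relations_def)
    then show "h (GenKinv i) * h (GenK i) = 1" by (simp add: ev)
    have "ev h (gen (GenK i) * gen (GenK j) - gen (GenK j) * gen (GenK i)) = 0"
      by (rule rel) (unfold non_serre_relations_def, blast)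
    then show "h (GenK i) * h (GenK j) = h (GenK j) * h (GenK i)" by (simp add: ev)
    have "ev h (gen (GenK i) * gen (GenE j) * gen (GenKinv i) - const (qi \<alpha> q i powi cartan_int \<alpha> i j) * gen (GenE j)) = 0"
      by (rule rel) (unfold non_serre_relations_def, blast)
    then show "h (GenK i) * h (GenE j) * h (GenKinv i) = s (q powi bil i j) * h (GenE j)" by (simp add: ev qq_power)
    have "ev h (gen (GenK i) * gen (GenF j) * gen (GenKinv i) - const (qi \<alpha> q i powi (- cartan_int \<alpha> i j)) * gen (GenF j)) = 0"
      by (rule rel) (unfold non_serre_relations_def, blast)
    then show "h (GenK i) * h (GenF j) * h (GenKinv i) = s (q powi (- bil i j)) * h (GenF j)" by (simp add: ev qq_power_minus)
    have "ev h (gen (GenE i) * gen (GenF j) - gen (GenF j) * gen (GenE i)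
         - (if i = j then const (inverse (qi \<alpha> q i - inverse (qi \<alpha> q i)))
              * (gen (GenK i) - gen (GenKinv i)) else 0)) = 0"
      by (rule rel) (unfold non_serre_relations_def, blast)
    then show "h (GenE i) * h (GenF j) - h (GenF j) * h (GenE i)
        = (if i = j then s (inverse (qq i - inverse (qq i))) * (h (GenK i) - h (GenKinv i)) else 0)"
      by (cases "i = j") (simp_all add: ev)
  qed
qed

text \<open>
  A named identity, so that the general lemmas on scalars have recognisable instances for the complex numbers.
\<close>

definition complex_scalar :: "complex \<Rightarrow> complex" where "complex_scalar c = c"

interpretation cscal: scalars complex_scalar
  by standard (simp_all add: complex_scalar_def)

context cartan_datum
begin

text \<open>
  The counit, a character of the quantum group: it serves as \<open>\<epsilon>\<close> in the representation of the quotient.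
\<close>

sublocale counit: pre_quantum \<alpha> q complex_scalar "\<lambda>_. 0" "\<lambda>_. 0" "\<lambda>_. 1" "\<lambda>_. 1"
  by unfold_locales simp_all

lemma pair_counit: "pair (\<lambda>w. prod_list (map counit.gmap w)) p = cscal.ev counit.gmap p"
  by (simp add: pair_def cscal.ev_def complex_scalar_def)

lemma counit_relations: "r \<in> U_relations \<alpha> q \<Longrightarrow> cscal.ev counit.gmap r = 0"
proof -
  have z: "cscal.serre_sum v (Suc n) 0 0 = 0" for v n
    unfolding cscal.serre_sum_def by (simp add: sum.neutral)
  assume "r \<in> U_relations \<alpha> q"
  then show ?thesis
    unfolding U_relations_eq
    by (auto simp: counit.ev_non_serre_relations serre_eq cscal.ev_serre_sum serre_len z)
qed

section \<open>The action on functionals vanishing on the Serre ideal\<close>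

lemma serre_dual_act: "f \<in> serre_dual \<Longrightarrow> act (rop.ev verma.gmap x) f \<in> serre_dual"
proof (induction x rule: falg_induct)
  case (add c w p)
  have g: "act (verma.gmap g) f \<in> serre_dual" if "f \<in> serre_dual" for f g
    by (cases g) (use that serre_dual_E serre_dual_ltrans serre_dual_K serre_dual_Ki in \<open>simp_all del: act_vE act_ltrans act_vK\<close>)
  have "act (prod_list (map verma.gmap w)) f \<in> serre_dual" using add.prems
    by (induction w arbitrary: f) (simp_all add: act_simps g)
  with add show ?case
    unfolding rop.ev_add rop.ev_single act_plus act_rscalar_mult by (intro serre_dual_add serre_dual_scale) auto
qed (simp add: act_zero serre_dual_zero)

text \<open>
  The elements that act as zero on the Serre functionals form a two-sided ideal containing all relations of the quantum group.
\<close>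

definition annihilator :: "'i qgen falg set"
  where "annihilator = {x. \<forall>f\<in>serre_dual. act (rop.ev verma.gmap x) f = (\<lambda>_. 0)}"

lemma annihilator_relations: "U_relations \<alpha> q \<subseteq> annihilator"
proof
  fix r assume r: "r \<in> U_relations \<alpha> q"
  have 1: "act (rop.ev verma.gmap (serre \<alpha> q GenF i j)) f = (\<lambda>_. 0)" if "f \<in> serre_dual" "i \<noteq> j" for f i j
    using serre_dual_SF[OF that] by (simp add: serre_eq rop.ev_serre_sum verma.SF_def)
  have 2: "act (rop.ev verma.gmap (serre \<alpha> q GenE i j)) f = (\<lambda>_. 0)" if "i \<noteq> j" for f i j
  proof -
    interpret m: pre_quantum \<alpha> q "rscalar :: complex \<Rightarrow> 'i list rop" ltrans vE "vK 1" "vK (- 1)" by (rule verma.mirror)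
    show ?thesis using raising_serre_zero[OF that, of f] by (simp add: serre_eq rop.ev_serre_sum m.SF_def)
  qed
  from r show "r \<in> annihilator"
    unfolding U_relations_eq annihilator_def
    by (auto simp: verma.ev_non_serre_relations act_zero 1 2)
qed

lemma annihilator_0: "0 \<in> annihilator"
  by (simp add: annihilator_def act_zero)

lemma annihilator_add: "x \<in> annihilator \<Longrightarrow> y \<in> annihilator \<Longrightarrow> x + y \<in> annihilator"
  by (simp add: annihilator_def rop.ev_add act_plus)

lemma annihilator_mult_left: "x \<in> annihilator \<Longrightarrow> y * x \<in> annihilator"
  using serre_dual_act by (simp add: annihilator_def rop.ev_mult act_simps(6))

lemma annihilator_mult_right: "x \<in> annihilator \<Longrightarrow> x * y \<in> annihilator"
  by (simp add: annihilator_def rop.ev_mult act_simps(6))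

definition Bgen :: "('i \<Rightarrow> complex) \<Rightarrow> 'i \<Rightarrow> 'i qgen falg"
  where "Bgen \<xi> i = gen (GenF i) + const (\<xi> i) * gen (GenE i) * gen (GenKinv i)"

abbreviation Bhat :: "('i \<Rightarrow> complex) \<Rightarrow> 'i falg \<Rightarrow> 'i qgen falg"
  where "Bhat \<xi> \<equiv> falg.ev (Bgen \<xi>)"

lemma lower_at_supported:
  "(\<And>u. Suc (length u) = length w \<Longrightarrow> f u = 0) \<Longrightarrow> lower_at w i f = 0"
proof (induction w arbitrary: f)
  case (Cons x w)
  have "lower_at w i (\<lambda>u. f (x # u)) = 0" by (rule Cons.IH) (use Cons.prems in auto)
  moreover have "f w = 0" using Cons.prems by simp
  ultimately show ?case by simp
qed simp

text \<open>
  On a function without values below length \<open>k\<close>, the summand \<open>\<xi>\<^sub>i E\<^sub>i K\<^sub>i\<^sup>-\<^sup>1\<close> of \<open>B\<^sub>i\<close> sees only words that are too short, so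
  each \<open>B\<^sub>i\<close> acts as \<open>F\<^sub>i\<close>, and the bound \<open>k\<close> drops by one.
\<close>

lemma act_B_word:
  assumes "\<And>w. length w < k \<Longrightarrow> f w = 0" "length u + length w \<le> k"
  shows "act (prod_list (map (\<lambda>i. rop.ev verma.gmap (Bgen \<xi> i)) u)) f w = f (u @ w)"
  using assms
proof (induction u arbitrary: f k)
  case (Cons i u)
  let ?b = "rop.ev verma.gmap (Bgen \<xi> i)"
  have b: "act ?b f v = f (i # v)" if "length v < k" for v
  proof -
    have "lower_at v i (\<lambda>u. \<xi> i * f u) = 0"
      by (rule lower_at_supported) (use Cons.prems(1) that in auto)
    then show ?thesis
      by (simp add: Bgen_def rop.ev_add rop.ev_mult act_simps lower_at_scale)
  qed
  have "act (prod_list (map (\<lambda>i. rop.ev verma.gmap (Bgen \<xi> i)) u)) (act ?b f) w = act ?b f (u @ w)"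
    by (rule Cons.IH[of "k - 1"]) (use Cons.prems b in auto)
  also have "\<dots> = f (i # u @ w)" by (rule b) (use Cons.prems(2) in simp)
  finally show ?case by (simp add: act_simps(6))
qed (simp add: act_simps)

text \<open>
  Evaluate the action of \<open>B\<^sub>p\<close> on \<open>f\<close> at the empty word.
\<close>

lemma serre_dual_annihilates_leading_part:
  assumes "f \<in> serre_dual" "\<And>w. length w < k \<Longrightarrow> f w = 0"
    and "\<And>w. w \<in> Poly_Mapping.keys p \<Longrightarrow> length (letters w) \<le> k" "Bhat \<xi> p \<in> annihilator"
  shows "pair f p = 0"
proof -
  let ?b = "\<lambda>i. rop.ev verma.gmap (Bgen \<xi> i)"
  have "0 = act (rop.ev ?b p) f []"
    using assms(1,4) by (simp add: annihilator_def rop.ev_ev)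
  also have "\<dots> = (\<Sum>w\<in>Poly_Mapping.keys p. Poly_Mapping.lookup p w * act (prod_list (map ?b (letters w))) f [])"
    unfolding rop.ev_def act_sum by (simp add: act_rscalar_mult)
  also have "\<dots> = (\<Sum>w\<in>Poly_Mapping.keys p. Poly_Mapping.lookup p w * f (letters w))"
    by (intro sum.cong refl arg_cong2[of _ _ _ _ "(*)"], subst act_B_word[OF assms(2)]) (use assms(3) in auto)
  finally show ?thesis by (simp add: pair_def)
qed

end

section \<open>Serre relations for the generators of the iquantum group\<close>

definition words_le :: "nat \<Rightarrow> 'g falg \<Rightarrow> bool"
  where "words_le n p \<longleftrightarrow> (\<forall>w\<in>Poly_Mapping.keys p. length (letters w) \<le> n)"

lemma words_le_0: "words_le n 0" by (simp add: words_le_def)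

lemma words_le_mono: "words_le m p \<Longrightarrow> m \<le> n \<Longrightarrow> words_le n p"
  by (auto simp: words_le_def)

lemma words_le_diff: "words_le n p \<Longrightarrow> words_le n r \<Longrightarrow> words_le n (p - r)"
  using keys_diff[of p r] by (auto simp: words_le_def)

lemma words_le_mult: "words_le m p \<Longrightarrow> words_le n r \<Longrightarrow> words_le (m + n) (p * r)"
  using keys_mult[of p r] by (fastforce simp: words_le_def plus_word_def)

lemma words_le_const_mult: "words_le n p \<Longrightarrow> words_le n (const c * p)"
  using keys_const_mult[of c p] by (auto simp: words_le_def)

lemma words_le_gen: "words_le 1 (gen g)"
  by (auto simp: words_le_def gen_def monomial_def)

lemma words_le_shiftop: "words_le n p \<Longrightarrow> words_le (Suc n) (falg.shiftop v t (gen g) k p)"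
  unfolding falg.shiftop_def
  using words_le_mult[OF words_le_gen, of n p g] words_le_mult[OF words_le_const_mult words_le_gen, of n p _ g]
  by (intro words_le_diff) (simp_all add: mult.assoc)

text \<open>
  The corrections \<open>d\<^sub>n\<close> multiply continuants whose words are two letters shorter.
\<close>

lemma cont_leading_term:
  "words_le n (cont (falg.shiftop v t (gen i)) (\<lambda>j. const (d j)) n (gen j) - falg.qad v t (gen i) (gen j) n)
   \<and> words_le (Suc n) (cont (falg.shiftop v t (gen i)) (\<lambda>j. const (d j)) n (gen j))"
proof (induction n rule: induct_nat_012)
  case 0
  then show ?case using words_le_gen[of j] by (simp add: words_le_0)
next
  case 1
  then show ?case using words_le_shiftop[OF words_le_gen, of v t i 0 j] by (simp add: words_le_0 falg.shiftop_def)
next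
  case (ge2 n)
  let ?b = "falg.shiftop v t (gen i)" and ?d = "\<lambda>j. const (d j)"
  let ?C = "\<lambda>n. cont ?b ?d n (gen j)" and ?Q = "falg.qad v t (gen i) (gen j)"
  have A: "?C (Suc (Suc n)) - ?Q (Suc (Suc n)) = ?b (Suc n) (?C (Suc n) - ?Q (Suc n)) - ?d (Suc n) * ?C n"
    by (simp add: falg.shiftop_def algebra_simps)
  have B: "words_le (Suc (Suc n)) (?b (Suc n) (?C (Suc n) - ?Q (Suc n)))"
    using ge2 by (intro words_le_shiftop) auto
  have C: "words_le (Suc (Suc n)) (?d (Suc n) * ?C n)"
    using ge2 by (intro words_le_const_mult) (auto intro: words_le_mono)
  have "words_le (Suc (Suc (Suc n))) (?b (Suc n) (?C (Suc n)))"
    using ge2 by (intro words_le_shiftop) blast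
  then have "words_le (Suc (Suc (Suc n))) (?C (Suc (Suc n)))"
    unfolding cont.simps using words_le_mono[OF C] by (intro words_le_diff) auto
  moreover have "words_le (Suc (Suc n)) (?C (Suc (Suc n)) - ?Q (Suc (Suc n)))"
    unfolding A using B C by (rule words_le_diff)
  ultimately show ?case by blast
qed

context pre_quantum
begin

text \<open>
  Up to scalars, the factors \<open>K\<^sup>-\<^sup>1\<close> can be collected on the right; so the elements \<open>E\<^sub>i K\<^sub>i\<^sup>-\<^sup>1\<close> satisfy the same Serre
  relations as the \<open>E\<^sub>i\<close>.
\<close>

lemma qad_mult_Ki:
  assumes "i \<noteq> j"
  defines "t \<equiv> q powi (- bil i j)" and "v \<equiv> inverse (qq i)"
  shows "\<exists>c. qad v t (s x * (E i * Ki i)) (s y * (E j * Ki j)) n = s c * (qad v t (E i) (E j) n * (Ki i ^ n * Ki j))"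
proof (induction n)
  case 0
  show ?case by (intro exI[of _ y]) (simp add: mult.assoc)
next
  case (Suc n)
  then obtain c where c: "qad v t (s x * (E i * Ki i)) (s y * (E j * Ki j)) n = s c * (qad v t (E i) (E j) n * (Ki i ^ n * Ki j))" ..
  define e where "e = qad v t (E i) (E j) n"
  define r where "r = t * v ^ (2 * n)"
  have v2: "v\<^sup>2 = q powi (- bil i i)"
    unfolding v_def power_inverse qq_square by (simp add: power_int_minus)
  have cc: "s a * (s b * z) = s (a * b) * z" for a b z by (simp add: s_mult mult.assoc)
  have KE: "Ki i * (E i * z) = s (v\<^sup>2) * (E i * (Ki i * z))" for z
    using arg_cong[OF Ki_E[of i i], of "\<lambda>y. y * z"] by (simp only: mult.assoc v2)
  have Ke: "Ki i * qad v t (E i) (E j) k = s (t * v ^ (2 * k)) * (qad v t (E i) (E j) k * Ki i)" for k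
  proof (induction k)
    case 0 then show ?case using Ki_E[of i j] by (simp add: t_def mult.assoc)
  next
    case (Suc k)
    define e where "e = qad v t (E i) (E j) k"
    define r where "r = t * v ^ (2 * k)"
    have IH: "Ki i * e = s r * (e * Ki i)" using Suc by (simp add: e_def r_def)
    have IH': "Ki i * (e * z) = s r * (e * (Ki i * z))" for z
      using arg_cong[OF IH, of "\<lambda>y. y * z"] by (simp only: mult.assoc)
    have KE0: "Ki i * E i = s (v\<^sup>2) * (E i * Ki i)" using KE[of 1] by simp
    have r': "t * v ^ (2 * Suc k) = v\<^sup>2 * r" by (simp add: r_def power2_eq_square)
    have "Ki i * (E i * e - s r * (e * E i)) = s (v\<^sup>2 * r) * ((E i * e - s r * (e * E i)) * Ki i)"
      by (simp add: right_diff_distrib left_diff_distrib KE KE0 IH IH' s_left_commute[of "E i"] s_left_commute[of e] s_left_commute[of "Ki i"] mult.assoc cc)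
        (simp add: ac_simps)
    then show ?case unfolding r' by (simp add: e_def r_def mult.assoc)
  qed
  have KnE: "Ki i ^ k * (E i * z) = s ((v\<^sup>2) ^ k) * (E i * (Ki i ^ k * z))" for k z
  proof (induction k arbitrary: z)
    case (Suc k)
    have "Ki i ^ Suc k * (E i * z) = Ki i ^ k * (Ki i * (E i * z))" by (simp only: power_Suc2 mult.assoc)
    also have "\<dots> = s (v\<^sup>2) * (s ((v\<^sup>2) ^ k) * (E i * (Ki i ^ k * (Ki i * z))))"
      unfolding KE s_left_commute[of "Ki i ^ k"] Suc ..
    also have "\<dots> = s ((v\<^sup>2) ^ Suc k) * (E i * (Ki i ^ Suc k * z))"
      by (simp only: cc power_Suc2[of "Ki i"] power_Suc[of "v\<^sup>2"] mult.assoc)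
    finally show ?case .
  qed simp
  have KjE: "Ki j * (E i * z) = s t * (E i * (Ki j * z))" for z
    using arg_cong[OF Ki_E[of j i], of "\<lambda>y. y * z"] by (simp only: mult.assoc t_def bil_sym[of j i])
  have Kn: "Ki i ^ n * (Ki j * Ki i) = Ki i ^ Suc n * Ki j"
    by (simp only: Ki_Ki[of j i] power_Suc2 mult.assoc)
  have 1: "(s x * (E i * Ki i)) * (s c * (e * (Ki i ^ n * Ki j))) = s (x * c * r) * (E i * e * (Ki i ^ Suc n * Ki j))"
  proof -
    have "Ki i * (e * z) = s r * (e * (Ki i * z))" for z
      using arg_cong[OF Ke[of n], of "\<lambda>y. y * z"] by (simp only: mult.assoc e_def r_def)
    then show ?thesis
      by (simp add: s_left_commute[of "E i"] s_left_commute[of "Ki i"] mult.assoc cc)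
  qed
  have 2: "(s c * (e * (Ki i ^ n * Ki j))) * (s x * (E i * Ki i)) = s (x * c * r) * (e * E i * (Ki i ^ Suc n * Ki j))"
  proof -
    have "s c * (s x * (s t * (s ((v\<^sup>2) ^ n) * z))) = s (x * c * r) * z" for z
    proof -
      have "c * (x * (t * (v\<^sup>2) ^ n)) = x * c * r" unfolding r_def power_mult by (simp add: ac_simps)
      then show ?thesis by (simp only: cc)
    qed
    moreover have "(s c * (e * (Ki i ^ n * Ki j))) * (s x * (E i * Ki i))
        = s c * (s x * (s t * (s ((v\<^sup>2) ^ n) * (e * (E i * (Ki i ^ Suc n * Ki j))))))"
      by (simp only: mult.assoc s_left_commute[of "Ki j"] s_left_commute[of "Ki i ^ n"] s_left_commute[of e] KjE KnE Kn)
    ultimately show ?thesis by (simp only: mult.assoc)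
  qed
  have "qad v t (s x * (E i * Ki i)) (s y * (E j * Ki j)) (Suc n)
      = s (x * c * r) * ((E i * e - s r * e * E i) * (Ki i ^ Suc n * Ki j))"
    unfolding qad.simps c e_def[symmetric] r_def[symmetric] 1
    by (simp only: mult.assoc[of "s r"] 2) (simp add: left_diff_distrib right_diff_distrib cc mult.assoc ac_simps)
  then show ?case unfolding e_def r_def qad.simps by blast
qed

text \<open>
  The abstract relation for \<open>F = F\<^sub>i\<close>, \<open>Y = x E\<^sub>i K\<^sub>i\<^sup>-\<^sup>1\<close>, \<open>k = K\<^sub>i\<^sup>-\<^sup>2\<close>, \<open>G = F\<^sub>j\<close> and
  \<open>H = y E\<^sub>j K\<^sub>j\<^sup>-\<^sup>1\<close>.
\<close>

lemma iserre_relation: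
  assumes ij: "i \<noteq> j"
    and SF: "serre_sum (qq i) (Suc (neg_cartan i j)) (F i) (F j) = 0"
    and SE: "serre_sum (qq i) (Suc (neg_cartan i j)) (E i) (E j) = 0"
  shows "cont (shiftop (qq i) (inverse (qq i) ^ neg_cartan i j) (F i + s x * (E i * Ki i)))
      (\<lambda>k. s (dcoef (qq i) (inverse (qq i) ^ neg_cartan i j) (x * inverse (qq i - inverse (qq i))) k))
      (Suc (neg_cartan i j)) (F j + s y * (E j * Ki j)) = 0"
proof (rule iserre[OF qq_generic, where k = "Ki i * Ki i"])
  let ?v = "qq i" and ?n = "neg_cartan i j"
  have cc: "s a * (s b * z) = s (a * b) * z" for a b z by (simp add: s_mult mult.assoc)
  note t = qq_neg_cartan[OF ij]
  have v2: "q powi bil i i = ?v\<^sup>2" "q powi (- bil i i) = (inverse ?v)\<^sup>2"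
    using qq_square[of i] by (simp_all add: power_int_minus power_inverse)
  have KF: "Ki i * (F l * z) = s (q powi bil i l) * (F l * (Ki i * z))" for l z
    using arg_cong[OF Ki_F[of i l], of "\<lambda>y. y * z"] by (simp only: mult.assoc)
  have KE: "Ki l * (E k * z) = s (q powi (- bil l k)) * (E k * (Ki l * z))" for k l z
    using arg_cong[OF Ki_E[of l k], of "\<lambda>y. y * z"] by (simp only: mult.assoc)
  have KF0: "Ki i * F l = s (q powi bil i l) * (F l * Ki i)" for l using KF[of l 1] by simp
  have KKF: "(Ki i * Ki i) * F l = s ((q powi bil i l)\<^sup>2) * F l * (Ki i * Ki i)" for l
    by (simp add: KF KF0 mult.assoc s_left_commute[of "Ki i"] cc power2_eq_square)
  have KKE: "(Ki i * Ki i) * (E l * Ki k) = s ((q powi (- bil i l))\<^sup>2) * (E l * Ki k) * (Ki i * Ki i)" for l k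
    by (simp add: KE mult.assoc s_left_commute[of "Ki i"] cc power2_eq_square Ki_Ki[of i k])
       (metis Ki_Ki mult.assoc)
  show "Ki i * Ki i * F i = s (?v ^ 4) * F i * (Ki i * Ki i)"
    using KKF[of i] by (simp add: v2 flip: power_mult)
  show "Ki i * Ki i * F j = s ((inverse ?v ^ ?n)\<^sup>2) * F j * (Ki i * Ki i)"
    unfolding KKF t ..
  show "Ki i * Ki i * (s x * (E i * Ki i)) = s (inverse ?v ^ 4) * (s x * (E i * Ki i)) * (Ki i * Ki i)"
    unfolding s_left_commute[of "Ki i * Ki i"] KKE v2
    by (simp add: mult.assoc cc mult.commute[of x] flip: power_mult)
  show "Ki i * Ki i * (s y * (E j * Ki j)) = s ((?v ^ ?n)\<^sup>2) * (s y * (E j * Ki j)) * (Ki i * Ki i)"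
    unfolding s_left_commute[of "Ki i * Ki i"] KKE t
    by (simp add: mult.assoc cc mult.commute[of y])
  have EF: "E i * F j = F j * E i" "E j * F i = F i * E j" using E_F[of i j] E_F[of j i] ij by auto
  show "s x * (E i * Ki i) * F j = s (inverse ?v ^ ?n) * F j * (s x * (E i * Ki i))"
  proof -
    have "(E i * Ki i) * F j = s (q powi bil i j) * (E i * F j * Ki i)" by (simp add: mult.assoc KF0 s_left_commute[of "E i"])
    then have "s x * ((E i * Ki i) * F j) = s (q powi bil i j) * (s x * (F j * (E i * Ki i)))"
      unfolding EF by (simp add: mult.assoc cc mult.commute)
    then show ?thesis unfolding t by (simp only: mult.assoc s_left_commute[of "F j"])
  qed
  show "F i * (s y * (E j * Ki j)) = s (?v ^ ?n) * (s y * (E j * Ki j)) * F i"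
  proof -
    have "(E j * Ki j) * F i = s (q powi bil i j) * (F i * (E j * Ki j))"
      using Ki_F[of j i] EF(2) by (simp add: mult.assoc s_left_commute[of "E j"] bil_sym[of j i])
        (metis mult.assoc)
    then have "s (q powi (- bil i j)) * ((E j * Ki j) * F i) = F i * (E j * Ki j)" by (simp only: powi_cancel)
    then have "s y * (s (q powi (- bil i j)) * ((E j * Ki j) * F i)) = s y * (F i * (E j * Ki j))" by (rule arg_cong)
    then show ?thesis unfolding t s_left_commute[of "F i"] mult.assoc by (simp add: cc mult.commute)
  qed
  show "s x * (E i * Ki i) * F i = s (?v\<^sup>2) * (F i * (s x * (E i * Ki i)) + s (x * inverse (?v - inverse ?v)) * (1 - Ki i * Ki i))"
  proof -
    let ?c = "inverse (?v - inverse ?v)"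
    have EF': "E i * F i = F i * E i + s ?c * (K i - Ki i)" using E_F[of i i] by (simp add: algebra_simps)
    have "(E i * Ki i) * F i = s (?v\<^sup>2) * (E i * F i * Ki i)"
      by (simp add: mult.assoc KF0 v2 s_left_commute[of "E i"])
    also have "E i * F i * Ki i = F i * (E i * Ki i) + s ?c * (1 - Ki i * Ki i)"
      unfolding EF' by (simp add: distrib_right left_diff_distrib mult.assoc K_Ki)
    finally have e: "(E i * Ki i) * F i = s (?v\<^sup>2) * (F i * (E i * Ki i) + s ?c * (1 - Ki i * Ki i))" .
    have "s x * ((E i * Ki i) * F i) = s (?v\<^sup>2) * (s x * (F i * (E i * Ki i) + s ?c * (1 - Ki i * Ki i)))"
      unfolding e cc by (simp add: mult.commute)
    then have "s x * ((E i * Ki i) * F i) = s (?v\<^sup>2) * (s x * (F i * (E i * Ki i)) + s (x * ?c) * (1 - Ki i * Ki i))"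
      by (simp only: distrib_left cc)
    then show ?thesis by (simp only: mult.assoc s_left_commute[of "F i"])
  qed
  show "serre_sum ?v (Suc ?n) (F i) (F j) = 0" by (rule SF)
  have "qad (inverse ?v) (q powi (- bil i j)) (E i) (E j) (Suc ?n) = 0"
    using SE unfolding serre_sum_eq_qad'[OF qq_generic] t .
  then show "serre_sum ?v (Suc ?n) (s x * (E i * Ki i)) (s y * (E j * Ki j)) = 0"
    unfolding serre_sum_eq_qad'[OF qq_generic] t
    using qad_mult_Ki[OF ij, of x y "Suc ?n"] by (metis mult_zero_left mult_zero_right)
qed

end

section \<open>Quantum shuffles\<close>

text \<open>
  Together with its counterpart for the positions marked \<open>False\<close> this inverts \<open>interleave\<close>.
\<close>

fun sel :: "bool list \<Rightarrow> 'a list \<Rightarrow> 'a list" where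
  "sel (True # S) (x # w) = x # sel S w"
| "sel (False # S) (x # w) = sel S w"
| "sel _ _ = []"

abbreviation cosel :: "bool list \<Rightarrow> 'a list \<Rightarrow> 'a list" where "cosel S w \<equiv> sel (map Not S) w"

lemma length_sel: "length S = length w \<Longrightarrow> length (sel S w) = trues S"
  by (induction S w rule: sel.induct) auto

lemma length_cosel: "length S = length w \<Longrightarrow> length (cosel S w) = falses S"
  using length_sel[of "map Not S" w] by simp

lemma interleave_sel: "length S = length w \<Longrightarrow> interleave S (sel S w) (cosel S w) = w"
  by (induction S w rule: sel.induct) auto

lemma sel_interleave:
  "length a = trues S \<Longrightarrow> length b = falses S \<Longrightarrow> sel S (interleave S a b) = a \<and> cosel S (interleave S a b) = b"
  by (induction S a b rule: interleave.induct) (auto dest: no_trues_no_falses)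

context cartan_datum
begin

text \<open>
  A letter of the shuffle comes from the first word, or from the second; in the latter case it passes the remaining letters of
  the first word. These are the two summands of the coproduct of \<open>F\<^sub>x\<close>, and they q-commute.
\<close>

definition shL :: "'i \<Rightarrow> ('i list \<times> 'i list) rop" where "shL x = Rop (\<lambda>\<phi> (a, b). \<phi> (x # a, b))"
definition shR :: "'i \<Rightarrow> ('i list \<times> 'i list) rop" where "shR x = Rop (\<lambda>\<phi> (a, b). q powi wt x a * \<phi> (a, x # b))"

lemma act_shL [simp]: "act (shL x) \<phi> = (\<lambda>(a, b). \<phi> (x # a, b))"
  unfolding shL_def by (subst act_Rop) auto

lemma act_shR [simp]: "act (shR x) \<phi> = (\<lambda>(a, b). q powi wt x a * \<phi> (a, x # b))"
  unfolding shR_def by (subst act_Rop) (auto simp: algebra_simps)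

lemma shR_shL: "shR x * shL y = rscalar (q powi bil x y) * shL y * shR x"
  by (rule rop_eqI) (auto simp: act_simps powi_add)

lemma shL_shR: "shL y * shR x = rscalar (q powi (- bil x y)) * shR x * shL y"
proof -
  have "q powi (- bil x y) * q powi bil x y = 1" using q_nonzero by (simp add: power_int_minus)
  then have "rscalar (q powi (- bil x y)) * rscalar (q powi bil x y) = (1 :: ('i list \<times> 'i list) rop)"
    by (simp flip: rop.s_mult)
  then show ?thesis unfolding mult.assoc shR_shL by (simp flip: mult.assoc)
qed

definition shuffle :: "('i list \<times> 'i list \<Rightarrow> complex) \<Rightarrow> 'i list \<Rightarrow> complex"
  where "shuffle \<phi> w = act (prod_list (map (\<lambda>x. shL x + shR x) w)) \<phi> ([], [])"

lemma shuffle_Nil: "shuffle \<phi> [] = \<phi> ([], [])"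
  by (simp add: shuffle_def act_simps)

lemma shuffle_Cons: "shuffle \<phi> (x # w) = shuffle (act (shL x + shR x) \<phi>) w"
  by (simp add: shuffle_def act_simps(6))

lemma shuffle_linear: "shuffle (\<lambda>k. \<phi> k + \<psi> k) w = shuffle \<phi> w + shuffle \<psi> w" "shuffle (\<lambda>k. c * \<phi> k) w = c * shuffle \<phi> w"
  by (simp_all add: shuffle_def act_add act_scale)

lemma act_ev_shuffle: "act (rop.ev ltrans p) (shuffle \<phi>) = shuffle (act (rop.ev (\<lambda>x. shL x + shR x) p) \<phi>)"
proof (induction p rule: falg_induct)
  case zero
  have "shuffle (\<lambda>k. 0) w = 0" for w using shuffle_linear(2)[of 0 "\<lambda>_. 0" w] by simp
  then show ?case by (simp add: act_zero)
next
  case (add c u p)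
  have u: "act (prod_list (map ltrans u)) (shuffle \<phi>) = shuffle (act (prod_list (map (\<lambda>x. shL x + shR x) u)) \<phi>)" for \<phi>
  proof (induction u arbitrary: \<phi>)
    case (Cons x u)
    have "act (ltrans x) (shuffle \<phi>) = shuffle (act (shL x + shR x) \<phi>)" by (simp add: shuffle_Cons)
    with Cons show ?case by (simp only: list.map prod_list.Cons act_simps(6))
  qed (simp add: act_simps)
  show ?case
    unfolding rop.ev_add rop.ev_single act_plus act_rscalar_mult add u
    by (simp add: shuffle_linear fun_eq_iff)
qed

definition biserre :: "('i list \<times> 'i list \<Rightarrow> complex) set"
  where "biserre = {\<phi>. (\<forall>b. (\<lambda>a. \<phi> (a, b)) \<in> serre_dual) \<and> (\<forall>a. (\<lambda>b. \<phi> (a, b)) \<in> serre_dual)}"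

lemma biserre_step: "\<phi> \<in> biserre \<Longrightarrow> act (shL x + shR x) \<phi> \<in> biserre"
proof -
  assume "\<phi> \<in> biserre"
  then have 1: "(\<lambda>a. \<phi> (a, b)) \<in> serre_dual" and 2: "(\<lambda>b. \<phi> (a, b)) \<in> serre_dual" for a b
    by (simp_all add: biserre_def)
  have "(\<lambda>a. \<phi> (x # a, b) + q powi wt x a * \<phi> (a, x # b)) \<in> serre_dual" for b
    using serre_dual_add[OF serre_dual_ltrans[OF 1, of x b] serre_dual_Ki[OF 1, of x "x # b"]] by simp
  moreover have "(\<lambda>b. \<phi> (x # a, b) + q powi wt x a * \<phi> (a, x # b)) \<in> serre_dual" for a
    using serre_dual_add[OF 2[of "x # a"] serre_dual_scale[OF serre_dual_ltrans[OF 2, of x a], of "q powi wt x a"]] by simp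
  ultimately show ?thesis by (simp add: biserre_def act_plus)
qed

lemma act_shL_power: "act (shL x ^ n) \<phi> (a, b) = act (ltrans x ^ n) (\<lambda>a. \<phi> (a, b)) a"
  by (induction n arbitrary: \<phi>) (simp_all add: act_simps)

lemma act_shR_power: "act (shR x ^ n) \<phi> (a, b) = q powi (int n * wt x a) * act (ltrans x ^ n) (\<lambda>b. \<phi> (a, b)) b"
proof (induction n arbitrary: \<phi>)
  case (Suc n)
  have "act (shR x ^ Suc n) \<phi> (a, b) = act (shR x ^ n) (act (shR x) \<phi>) (a, b)" by (simp only: power_Suc act_simps(6))
  also have "\<dots> = q powi (int n * wt x a) * (q powi wt x a * act (ltrans x ^ n) (\<lambda>b. \<phi> (a, x # b)) b)"
    unfolding Suc by (simp add: act_scale)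
  finally show ?case by (simp add: act_simps algebra_simps powi_add)
qed (simp add: act_simps)

lemma act_serre_shL: "act (rop.serre_sum v m (shL i) (shL j)) \<phi> (a, b) = act (rop.serre_sum v m (ltrans i) (ltrans j)) (\<lambda>a. \<phi> (a, b)) a"
  unfolding rop.serre_sum_def act_sum
  by (intro sum.cong refl)
     (simp only: mult.assoc act_rscalar_mult act_simps(6) act_shL_power act_shL act_ltrans prod.case act_rscalar act_scale)

lemma act_serre_shR: "act (rop.serre_sum v m (shR i) (shR j)) \<phi> (a, b)
    = q powi (int m * wt i a + wt j a) * act (rop.serre_sum v m (ltrans i) (ltrans j)) (\<lambda>b. \<phi> (a, b)) b"
  unfolding rop.serre_sum_def act_sum sum_distrib_left
proof (intro sum.cong refl)
  fix k assume k: "k \<in> {0..m}"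
  let ?c = "(- 1) ^ k * qbinom v m k"
  have p: "int m * wt i a + wt j a = int (m - k) * wt i a + (wt j a + int k * wt i a)"
    using k by (simp add: of_nat_diff algebra_simps)
  have "act (rscalar ?c * shR i ^ (m - k) * shR j * shR i ^ k) \<phi> (a, b)
      = ?c * (q powi (int k * wt i a) * (q powi wt j a * (q powi (int (m - k) * wt i a) *
          act (ltrans i ^ k) (\<lambda>b. act (ltrans i ^ (m - k)) (\<lambda>b. \<phi> (a, b)) (j # b)) b)))"
    by (simp only: mult.assoc act_rscalar_mult act_simps(6) act_shR_power act_shR act_scale act_rscalar prod.case)
  also have "\<dots> = q powi (int m * wt i a + wt j a) * act (rscalar ?c * ltrans i ^ (m - k) * ltrans j * ltrans i ^ k) (\<lambda>b. \<phi> (a, b)) b"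
    unfolding p powi_add by (simp only: mult.assoc act_rscalar_mult act_simps(6) act_ltrans act_rscalar act_scale) (simp only: ac_simps)
  finally show "act (rscalar ?c * shR i ^ (m - k) * shR j * shR i ^ k) \<phi> (a, b)
      = q powi (int m * wt i a + wt j a) * act (rscalar ?c * ltrans i ^ (m - k) * ltrans j * ltrans i ^ k) (\<lambda>b. \<phi> (a, b)) b" .
qed

text \<open>
  The Serre elements are primitive up to a twist: \<open>serre_sum_coproduct\<close> separates the two tensor factors.
\<close>

lemma serre_coproduct_kills:
  assumes "\<phi> \<in> biserre" "i \<noteq> j"
  shows "act (rop.serre_sum (qq i) (nat (1 - cartan_int \<alpha> i j)) (shL i + shR i) (shL j + shR j)) \<phi> = (\<lambda>_. 0)"
proof -
  let ?S = "rop.serre_sum (qq i) (nat (1 - cartan_int \<alpha> i j))"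
  have "?S (shL i + shR i) (shL j + shR j) = ?S (shL i) (shL j) + ?S (shR i) (shR j)"
    unfolding serre_len[OF assms(2)]
    by (rule rop.serre_sum_coproduct[OF qq_generic])
       (simp_all only: qq_square qq_neg_cartan[OF assms(2)] shR_shL shL_shR bil_sym[of j i])
  moreover have "act (?S (shL i) (shL j)) \<phi> (a, b) = 0" for a b
    using serre_dual_SF[of "\<lambda>a. \<phi> (a, b)", OF _ assms(2)] assms(1)
    by (simp add: act_serre_shL biserre_def verma.SF_def)
  moreover have "act (?S (shR i) (shR j)) \<phi> (a, b) = 0" for a b
    using serre_dual_SF[of "\<lambda>b. \<phi> (a, b)", OF _ assms(2)] assms(1)
    by (simp add: act_serre_shR biserre_def verma.SF_def)
  ultimately show ?thesis by (auto simp: act_plus)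
qed

text \<open>
  Evaluating a shuffle at an element of the free algebra is evaluating the two factors at its coproduct.
\<close>

lemma shuffle_serre_dual:
  assumes "f \<in> serre_dual" "g \<in> serre_dual"
  shows "shuffle (\<lambda>(a, b). f a * g b) \<in> serre_dual"
proof -
  have "shuffle \<phi> \<in> serre_dual" if "\<phi> \<in> biserre" for \<phi>
  proof -
    have "act (prod_list (map ltrans u) * verma.SF i j) (shuffle \<phi>) = (\<lambda>_. 0)" if "i \<noteq> j" for u i j
    proof -
      let ?p = "falg.serre_sum (qq i) (nat (1 - cartan_int \<alpha> i j)) (gen i) (gen j)"
      have st: "act (prod_list (map (\<lambda>x. shL x + shR x) u)) \<phi> \<in> biserre" for u
        using \<open>\<phi> \<in> biserre\<close> by (induction u arbitrary: \<phi>) (simp_all add: act_simps(2,6) biserre_step)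
      have "act (prod_list (map ltrans u) * verma.SF i j) (shuffle \<phi>) = act (rop.ev ltrans (monomial u * ?p)) (shuffle \<phi>)"
        by (simp add: rop.ev_mult rop.ev_monomial rop.ev_serre_sum verma.SF_def)
      also have "\<dots> = shuffle (act (rop.serre_sum (qq i) (nat (1 - cartan_int \<alpha> i j)) (shL i + shR i) (shL j + shR j)) (act (prod_list (map (\<lambda>x. shL x + shR x) u)) \<phi>))"
        unfolding act_ev_shuffle by (simp add: rop.ev_mult rop.ev_monomial rop.ev_serre_sum act_simps(6))
      also have "\<dots> = (\<lambda>_. 0)"
        unfolding serre_coproduct_kills[OF st that] using shuffle_linear(2)[of 0 "\<lambda>_. 0"] by auto
      finally show ?thesis .
    qed
    then show ?thesis by (simp add: serre_dual_def)
  qed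
  moreover have "(\<lambda>(a, b). f a * g b) \<in> biserre"
    using serre_dual_scale[OF assms(2)] serre_dual_scale[OF assms(1), of "g _"] by (simp add: biserre_def mult.commute)
  ultimately show ?thesis by blast
qed

text \<open>
  The exponent of \<open>q\<close> with which a shuffle occurs: the pairings of all letters of the second word with the letters of the
  first word that they precede.
\<close>

fun inv_stat :: "bool list \<Rightarrow> 'i list \<Rightarrow> int" where
  "inv_stat (True # S) (x # w) = inv_stat S w"
| "inv_stat (False # S) (x # w) = wt x (sel S w) + inv_stat S w"
| "inv_stat _ _ = 0"

lemma shuffle_eq_sum:
  "shuffle \<phi> w = (\<Sum>S | length S = length w. q powi inv_stat S w * \<phi> (sel S w, cosel S w))"
proof (induction w arbitrary: \<phi>)
  case Nil
  then show ?case by (simp add: shuffle_Nil)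
next
  case (Cons x w)
  have fin: "finite {S :: bool list. length S = n}" for n
    using finite_lists_length_eq[of "UNIV :: bool set" n] by simp
  have split: "{S. length S = length (x # w)} = (#) True ` {S. length S = length w} \<union> (#) False ` {S. length S = length w}"
  proof (intro equalityI subsetI)
    fix S assume "S \<in> {S :: bool list. length S = length (x # w)}"
    then obtain b S' where "S = b # S'" "length S' = length w" by (cases S) auto
    then show "S \<in> (#) True ` {S. length S = length w} \<union> (#) False ` {S. length S = length w}" by (cases b) auto
  qed auto
  let ?g = "\<lambda>S. q powi inv_stat S (x # w) * \<phi> (sel S (x # w), cosel S (x # w))"
  have "shuffle \<phi> (x # w) = (\<Sum>S | length S = length w. q powi inv_stat S w * act (shL x + shR x) \<phi> (sel S w, cosel S w))"
    unfolding shuffle_Cons by (rule Cons)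
  also have "\<dots> = (\<Sum>S | length S = length w. ?g (True # S) + ?g (False # S))"
    by (intro sum.cong) (simp_all add: act_plus powi_add algebra_simps)
  also have "\<dots> = (\<Sum>S | length S = length w. ?g (True # S)) + (\<Sum>S | length S = length w. ?g (False # S))"
    by (rule sum.distrib)
  also have "\<dots> = sum ?g ((#) True ` {S. length S = length w}) + sum ?g ((#) False ` {S. length S = length w})"
    by (simp add: sum.reindex)
  also have "\<dots> = sum ?g {S. length S = length (x # w)}"
    unfolding split by (rule sum.union_disjoint[symmetric]) (use fin in auto)
  finally show ?case .
qed

section \<open>Leading words of shuffles\<close>

definition leads :: "('i list \<Rightarrow> complex) \<Rightarrow> 'i list \<Rightarrow> bool"
  where "leads f w \<longleftrightarrow> f w \<noteq> 0 \<and> (\<forall>u. f u \<noteq> 0 \<longrightarrow> length u = length w \<and> u \<le>\<^sub>l w)"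

lemma inv_stat_False: "inv_stat (replicate (length v) False @ S) (v @ w) = (\<Sum>x\<leftarrow>v. wt x (sel S w)) + inv_stat S w"
proof (induction v)
  case (Cons x v)
  have "sel (replicate (length v) False @ S) (v @ w) = sel S w" by (induction v) auto
  with Cons show ?case by simp
qed simp

lemma inv_stat_True: "inv_stat (replicate (length v) True @ S) (v @ w) = inv_stat S w"
  by (induction v) auto

lemma sel_False: "sel (replicate n False) w = []"
proof (induction n arbitrary: w)
  case (Suc n) then show ?case by (cases w) auto
qed simp

lemma sel_True_append: "sel (replicate (length v) True @ S) (v @ w) = v @ sel S w"
  by (induction v) auto

lemma inv_stat_False_only: "inv_stat (replicate n False) w = 0"
proof (induction n arbitrary: w)
  case (Suc n) then show ?case by (cases w) (simp_all add: sel_False)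
qed simp

definition self_pairing :: "'i list \<Rightarrow> int" where "self_pairing l = (\<Sum>x\<leftarrow>l. wt x l)"

lemma self_pairing_eq: "of_int (self_pairing l) = weight \<alpha> l \<bullet> weight \<alpha> l"
proof -
  have wt: "of_int (wt i w) = \<alpha> i \<bullet> weight \<alpha> w" for i w
    by (induction w) (simp_all add: weight_def inner_add_right inner_roots bil_def)
  have "of_int (\<Sum>x\<leftarrow>v. wt x l) = weight \<alpha> v \<bullet> weight \<alpha> l" for v
    by (induction v) (simp_all add: weight_def inner_add_left wt[unfolded weight_def])
  then show ?thesis by (simp add: self_pairing_def)
qed

text \<open>
  A nontrivial sum of linearly independent simple roots with nonnegative coefficients.
\<close>

lemma weight_nonzero:
  assumes "w \<noteq> []" shows "weight \<alpha> w \<noteq> 0"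
proof
  assume 0: "weight \<alpha> w = 0"
  have "weight \<alpha> w = (\<Sum>i\<in>UNIV. real (count_list w i) *\<^sub>R \<alpha> i)"
  proof (induction w)
    case (Cons x w)
    have "(\<Sum>i\<in>UNIV. real (count_list (x # w) i) *\<^sub>R \<alpha> i)
        = (\<Sum>i\<in>UNIV. (if i = x then \<alpha> i else 0) + real (count_list w i) *\<^sub>R \<alpha> i)"
      by (intro sum.cong) (auto simp: algebra_simps)
    also have "\<dots> = \<alpha> x + weight \<alpha> w" by (simp add: sum.distrib Cons)
    finally show ?case by (simp add: weight_def)
  qed (simp add: weight_def)
  also have "\<dots> = (\<Sum>v\<in>range \<alpha>. real (count_list w (inv_into UNIV \<alpha> v)) *\<^sub>R v)"
    using roots_independent(1) by (simp add: sum.reindex)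
  finally have sum0: "(\<Sum>v\<in>range \<alpha>. real (count_list w (inv_into UNIV \<alpha> v)) *\<^sub>R v) = 0" using 0 by simp
  define u where "u v = real (count_list w (inv_into UNIV \<alpha> v))" for v
  have "(\<Sum>v\<in>range \<alpha>. u v *\<^sub>R v) = 0" using sum0 by (simp add: u_def)
  moreover have "\<not> (\<exists>u. (\<exists>v\<in>range \<alpha>. u v \<noteq> 0) \<and> (\<Sum>v\<in>range \<alpha>. u v *\<^sub>R v) = 0)"
    using roots_independent(2) dependent_finite[of "range \<alpha>"] by simp
  ultimately have u0: "u v = 0" if "v \<in> range \<alpha>" for v using that by metis
  have "count_list w i = 0" for i using u0[of "\<alpha> i"] roots_independent(1) by (simp add: u_def)
  moreover have "hd w \<in> set w" using assms by simp
  ultimately show False by (metis count_list_0_iff)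
qed

lemma self_pairing_pos: "l \<noteq> [] \<Longrightarrow> 0 < self_pairing l"
proof -
  assume "l \<noteq> []"
  then have "0 < weight \<alpha> l \<bullet> weight \<alpha> l" using weight_nonzero by (simp only: inner_gt_zero_iff) simp
  then show ?thesis by (simp only: self_pairing_eq[symmetric] of_int_0_less_iff)
qed

lemma geometric_nonzero: "0 < n \<Longrightarrow> (\<Sum>t\<le>r. q powi (int t * n)) \<noteq> 0"
proof -
  assume n: "0 < n"
  define x where "x = q ^ nat n"
  have ne: "x ^ Suc k \<noteq> 1" for k
  proof -
    have "0 < nat n * Suc k" using n by simp
    then show ?thesis using q_generic unfolding x_def generic_param_def power_mult[symmetric] by blast
  qed
  have "q powi (int t * n) = x ^ t" for t
  proof -
    have "q powi (int t * n) = (q powi n) powi int t" by (metis mult.commute power_int_mult)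
    then show ?thesis using n by (simp add: x_def power_int_def)
  qed
  moreover have "(\<Sum>t\<le>r. x ^ t) * (1 - x) = 1 - x ^ Suc r"
    using one_diff_power_eq[of x "Suc r"] by (simp add: lessThan_Suc_atMost mult.commute)
  ultimately show ?thesis using ne[of r] by auto
qed

text \<open>
  The block \<open>l\<close> moves across \<open>t\<close> copies of itself, which leaves the word unchanged and contributes \<open>q^(l,l)\<close> for each copy.
\<close>

lemma block_pattern_interleave:
  assumes "t \<le> length (takeWhile ((=) l) ls)"
  shows "interleave (block_pattern (length l) (length (concat ls)) t) l (concat ls) = l @ concat ls"
    and "inv_stat (block_pattern (length l) (length (concat ls)) t) (l @ concat ls) = int t * self_pairing l"
    and "trues (block_pattern (length l) (length (concat ls)) t) = length l"
    and "falses (block_pattern (length l) (length (concat ls)) t) = length (concat ls)"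
proof -
  define k where "k = concat (replicate t l)"
  have "ls = replicate t l @ drop t ls"
    using assms
  proof (induction t arbitrary: ls)
    case (Suc t)
    then obtain ls' where ls: "ls = l # ls'" by (cases ls) (auto split: if_splits)
    with Suc show ?case by simp
  qed simp
  then obtain r where ls: "concat ls = k @ r" unfolding k_def by (metis concat_append)
  have len: "length k = t * length l" unfolding k_def by (induction t) auto
  have "l @ k = k @ l" unfolding k_def by (induction t) auto
  then have comm: "l @ k @ r = k @ l @ r" by (metis append.assoc)
  have bp: "block_pattern (length l) (length (concat ls)) t = replicate (length k) False @ replicate (length l) True @ replicate (length r) False"
    by (simp add: block_pattern_def len ls)
  have mF: "interleave (replicate (length y) False) x y = y" for x y :: "'i list" by (induction y) auto
  have mT: "interleave (replicate (length x) True) x y = x" for x y :: "'i list" by (induction x) auto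
  have c: "trues (replicate n True) = n" "falses (replicate n True) = 0" "trues (replicate n False) = 0" "falses (replicate n False) = n" for n
    by (induction n) auto
  show "trues (block_pattern (length l) (length (concat ls)) t) = length l"
    "falses (block_pattern (length l) (length (concat ls)) t) = length (concat ls)"
    unfolding bp by (simp_all add: c ls)
  have "interleave (replicate (length k) False @ replicate (length l) True @ replicate (length r) False) ([] @ l @ []) (k @ [] @ r) = k @ l @ r"
    by (subst interleave_append; (subst interleave_append)?; simp add: c mF mT)
  then show "interleave (block_pattern (length l) (length (concat ls)) t) l (concat ls) = l @ concat ls"
    unfolding bp unfolding ls using comm by simp
  have "inv_stat (replicate (length k) False @ replicate (length l) True @ replicate (length r) False) (k @ l @ r)
      = (\<Sum>x\<leftarrow>k. wt x l)"
    unfolding inv_stat_False inv_stat_True inv_stat_False_only sel_True_append sel_False by simp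
  also have "\<dots> = int t * self_pairing l" unfolding k_def self_pairing_def by (induction t) (simp_all add: algebra_simps)
  finally have st: "inv_stat (replicate (length k) False @ replicate (length l) True @ replicate (length r) False) (k @ l @ r)
      = int t * self_pairing l" .
  show "inv_stat (block_pattern (length l) (length (concat ls)) t) (l @ concat ls) = int t * self_pairing l"
    unfolding bp unfolding ls comm by (rule st)
qed

text \<open>
  By monotonicity of shuffles and \<open>interleave_lyndon_le\<close>, the word \<open>l @ concat ls\<close> is the largest one that occurs, and
  only the block patterns produce it. Its coefficient is a geometric sum in \<open>q^(l,l)\<close>.
\<close>

lemma shuffle_leads:
  assumes l: "lyndon l" and ls: "list_all lyndon ls" "nonincreasing (l # ls)"
    and f: "leads f l" and g: "leads g (concat ls)"
  shows "leads (shuffle (\<lambda>(a, b). f a * g b)) (l @ concat ls)"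
proof -
  let ?u = "concat ls" and ?\<phi> = "\<lambda>(a, b). f a * g b"
  let ?G = "\<lambda>w S. q powi inv_stat S w * ?\<phi> (sel S w, cosel S w)"
  let ?r = "length (takeWhile ((=) l) ls)"
  let ?bp = "block_pattern (length l) (length ?u)"
  have ls': "nonincreasing ls" "\<forall>x\<in>set ls. x \<le>\<^sub>l l" using ls(2) by auto
  have key: "length w = length (l @ ?u) \<and> w \<le>\<^sub>l l @ ?u \<and> (w = l @ ?u \<longrightarrow> (\<exists>t\<le>?r. S = ?bp t))"
    if S: "length S = length w" and nz: "?G w S \<noteq> 0" for w S
  proof -
    let ?a = "sel S w" and ?b = "cosel S w"
    have a: "length ?a = length l" "?a \<le>\<^sub>l l" and b: "length ?b = length ?u" "?b \<le>\<^sub>l ?u"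
    proof -
      have "f ?a \<noteq> 0" "g ?b \<noteq> 0" using nz by simp_all
      then show "length ?a = length l" "?a \<le>\<^sub>l l" "length ?b = length ?u" "?b \<le>\<^sub>l ?u"
        using f g unfolding leads_def by blast+
    qed
    have t: "trues S = length l" "falses S = length ?u" using a(1) b(1) length_sel[OF S] length_cosel[OF S] by auto
    have w: "interleave S ?a ?b = w" by (rule interleave_sel[OF S])
    have 1: "w \<le>\<^sub>l interleave S l ?u \<and> (w = interleave S l ?u \<longrightarrow> ?a = l \<and> ?b = ?u)"
    proof -
      have "interleave S ?a ?b \<le>\<^sub>l interleave S l ?u \<and> (interleave S ?a ?b = interleave S l ?u \<longrightarrow> ?a = l \<and> ?b = ?u)"
        by (rule interleave_mono) (use a b t in simp_all)
      then show ?thesis unfolding w .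
    qed
    have 2: "interleave S l ?u \<le>\<^sub>l l @ ?u \<and> (interleave S l ?u = l @ ?u \<longrightarrow> (\<exists>t\<le>?r. S = ?bp t))"
      by (rule interleave_lyndon_le[OF l ls(1) ls'(1,2) t])
    have "length w = length (l @ ?u)" using S t trues_falses[of S] by simp
    moreover have "w \<le>\<^sub>l l @ ?u" by (rule lex.order_trans[OF conjunct1[OF 1] conjunct1[OF 2]])
    moreover have "\<exists>t\<le>?r. S = ?bp t" if "w = l @ ?u"
    proof -
      have "l @ ?u \<le>\<^sub>l interleave S l ?u" using conjunct1[OF 1] unfolding that .
      then have "interleave S l ?u = l @ ?u" by (rule lex.order_antisym[OF conjunct1[OF 2]])
      with 2 show ?thesis by blast
    qed
    ultimately show ?thesis by blast
  qed
  have fin: "finite {S :: bool list. length S = n}" for n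
    using finite_lists_length_eq[of "UNIV :: bool set" n] by simp
  let ?w = "l @ ?u"
  have lpos: "l \<noteq> []" using l by (simp add: lyndon_def)
  have inj: "inj_on ?bp {..?r}"
  proof (rule inj_onI)
    fix s t assume "s \<in> {..?r}" "t \<in> {..?r}" "?bp s = ?bp t"
    then have "int s * self_pairing l = int t * self_pairing l"
      using block_pattern_interleave(2)[of s l ls] block_pattern_interleave(2)[of t l ls] by (metis atMost_iff)
    then show "s = t" using self_pairing_pos[OF lpos] by simp
  qed
  have "shuffle ?\<phi> ?w = (\<Sum>S | length S = length ?w. ?G ?w S)" by (rule shuffle_eq_sum)
  also have "\<dots> = sum (?G ?w) (?bp ` {..?r})"
  proof (rule sum.mono_neutral_right[OF fin])
    show "?bp ` {..?r} \<subseteq> {S. length S = length ?w}"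
      using block_pattern_interleave(3,4)[of _ l ls] trues_falses by (auto, metis)
    show "\<forall>S\<in>{S. length S = length ?w} - ?bp ` {..?r}. ?G ?w S = 0" using key[of _ ?w] by blast
  qed
  also have "\<dots> = (\<Sum>t\<le>?r. ?G ?w (?bp t))" by (simp add: sum.reindex[OF inj])
  also have "\<dots> = (\<Sum>t\<le>?r. q powi (int t * self_pairing l) * (f l * g ?u))"
  proof (intro sum.cong refl)
    fix t assume "t \<in> {..?r}"
    then have t: "t \<le> ?r" by simp
    have "sel (?bp t) ?w = l" "cosel (?bp t) ?w = ?u"
      using sel_interleave[of l "?bp t" ?u] block_pattern_interleave[OF t] by auto
    then show "?G ?w (?bp t) = q powi (int t * self_pairing l) * (f l * g ?u)"
      using block_pattern_interleave(2)[OF t] by simp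
  qed
  also have "\<dots> = (\<Sum>t\<le>?r. q powi (int t * self_pairing l)) * (f l * g ?u)" by (rule sum_distrib_right[symmetric])
  also have "\<dots> \<noteq> 0" using geometric_nonzero[OF self_pairing_pos[OF lpos]] f g by (simp add: leads_def)
  finally have "shuffle ?\<phi> ?w \<noteq> 0" .
  moreover have "length w = length ?w \<and> w \<le>\<^sub>l ?w" if "shuffle ?\<phi> w \<noteq> 0" for w
  proof -
    obtain S where "length S = length w" "?G w S \<noteq> 0"
      using \<open>shuffle ?\<phi> w \<noteq> 0\<close> unfolding shuffle_eq_sum by (auto elim: sum.not_neutral_contains_not_neutral)
    then show ?thesis using key by blast
  qed
  ultimately show ?thesis unfolding leads_def by blast
qed

lemma good_product_functional:
  assumes "list_all lyndon ls" "nonincreasing ls" "\<And>l. l \<in> set ls \<Longrightarrow> \<exists>f\<in>serre_dual. leads f l"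
  shows "\<exists>f\<in>serre_dual. leads f (concat ls)"
  using assms
proof (induction ls)
  case Nil
  \<comment> \<open>The counit of the free algebra: Serre elements have no constant term.\<close>
  let ?f = "\<lambda>w :: 'i list. if w = [] then 1 else 0 :: complex"
  have "leads ?f []" by (simp add: leads_def split: if_splits)
  moreover have "?f \<in> serre_dual"
  proof -
    have "act (rop.ev ltrans (monomial u * falg.serre_sum (qq i) (Suc n) (gen i) (gen j))) ?f w = 0" for u i j n w
    proof -
      have "pair ?f (monomial u * (const c * gen i ^ a * gen j * gen i ^ b) * monomial w) = 0" for c a b
      proof -
        have "gen i ^ a = monomial (replicate a i)" for a by (induction a) (simp_all add: gen_def flip: monomial_append)
        then have "monomial u * (const c * gen i ^ a * gen j * gen i ^ b) * monomial w
            = const c * monomial (u @ replicate a i @ [j] @ replicate b i @ w)"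
          by (simp only: gen_def monomial_append mult.assoc falg.s_left_commute[of "monomial u"])
        then show ?thesis by (simp only: pair_single) simp
      qed
      then show ?thesis
        unfolding act_ev_ltrans falg.serre_sum_def sum_distrib_left sum_distrib_right pair_sum by simp
    qed
    then show ?thesis
      unfolding serre_dual_def verma.SF_def
      by (auto simp: serre_len rop.ev_mult rop.ev_monomial rop.ev_serre_sum fun_eq_iff)
  qed
  ultimately show ?case by auto
next
  case (Cons l ls)
  obtain f where f: "f \<in> serre_dual" "leads f l" using Cons.prems(3)[of l] by auto
  obtain g where g: "g \<in> serre_dual" "leads g (concat ls)"
    using Cons.IH Cons.prems by auto
  show ?case
    using shuffle_leads[OF _ _ _ f(2) g(2)] shuffle_serre_dual[OF f(1) g(1)] Cons.prems
    by (intro bexI[of _ "shuffle (\<lambda>(a, b). f a * g b)"]) auto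
qed

end

section \<open>Cartan data of irreducible root systems\<close>

text \<open>
  Otherwise \<open>\<sigma>\<close> is orthogonal to the span of the roots of the length of \<open>\<beta>\<close>. A root \<open>\<gamma>\<close> not orthogonal to such a root
  \<open>x\<close> is a multiple of the difference between \<open>x\<close> and its reflection in \<open>\<gamma>\<close>, hence lies in the span; so the span
  and its orthogonal complement would split the root system.
\<close>

lemma root_nonorthogonal_same_length:
  assumes irr: "irreducible_root_system \<Phi>" and "\<sigma> \<in> \<Phi>" "\<beta> \<in> \<Phi>"
  obtains x where "x \<in> \<Phi>" "x \<bullet> x = \<beta> \<bullet> \<beta>" "x \<bullet> \<sigma> \<noteq> 0"
proof -
  have root: "root_system \<Phi>" using irr by (simp add: irreducible_root_system_def)
  define Orb where "Orb = {x \<in> \<Phi>. x \<bullet> x = \<beta> \<bullet> \<beta>}"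
  have perp: "\<gamma> \<bullet> a = 0" if \<gamma>: "\<gamma> \<in> \<Phi>" "\<gamma> \<notin> span Orb" and a: "a \<in> span Orb" for \<gamma> a
  proof -
    have "x \<bullet> \<gamma> = 0" if x: "x \<in> Orb" for x
    proof (rule ccontr)
      assume ne: "x \<bullet> \<gamma> \<noteq> 0"
      have g0: "\<gamma> \<bullet> \<gamma> \<noteq> 0" using root \<gamma>(1) by (auto simp: root_system_def)
      let ?c = "2 * (x \<bullet> \<gamma>) / (\<gamma> \<bullet> \<gamma>)"
      have "reflection \<gamma> x \<in> \<Phi>" using root \<gamma>(1) x by (auto simp: root_system_def Orb_def)
      moreover have "reflection \<gamma> x \<bullet> reflection \<gamma> x = x \<bullet> x"
        using g0 by (simp add: reflection_def inner_diff_left inner_diff_right inner_commute field_simps power2_eq_square)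
      ultimately have "reflection \<gamma> x \<in> Orb" using x by (simp add: Orb_def)
      then have "x - reflection \<gamma> x \<in> span Orb" using x by (intro span_diff span_base)
      then have "(1 / ?c) *\<^sub>R (x - reflection \<gamma> x) \<in> span Orb" by (rule span_scale)
      moreover have "(1 / ?c) *\<^sub>R (x - reflection \<gamma> x) = \<gamma>" using ne g0 by (simp add: reflection_def)
      ultimately show False using \<gamma>(2) by simp
    qed
    then have "orthogonal \<gamma> x" if "x \<in> Orb" for x using that by (simp add: orthogonal_def inner_commute[of \<gamma>])
    then show ?thesis using orthogonal_to_span[OF a] by (simp add: orthogonal_def)
  qed
  let ?A = "{\<gamma> \<in> \<Phi>. \<gamma> \<in> span Orb}" and ?B = "{\<gamma> \<in> \<Phi>. \<gamma> \<notin> span Orb}"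
  have "\<beta> \<in> ?A" using assms(3) by (auto simp: Orb_def intro: span_base)
  moreover have "?A \<union> ?B = \<Phi>" "?A \<inter> ?B = {}" by auto
  moreover have "\<forall>a\<in>?A. \<forall>b\<in>?B. a \<bullet> b = 0" by (subst inner_commute) (use perp in blast)
  ultimately have split: "?A \<noteq> {}" "?A \<union> ?B = \<Phi>" "?A \<inter> ?B = {}" "\<forall>a\<in>?A. \<forall>b\<in>?B. a \<bullet> b = 0" by auto
  have "?B = {}"
  proof (rule ccontr)
    assume ne: "?B \<noteq> {}"
    have "\<exists>A B. A \<noteq> {} \<and> B \<noteq> {} \<and> A \<union> B = \<Phi> \<and> A \<inter> B = {} \<and> (\<forall>a\<in>A. \<forall>b\<in>B. a \<bullet> b = 0)"
      by (rule exI[of _ ?A], rule exI[of _ ?B]) (intro conjI split ne)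
    then show False using irr unfolding irreducible_root_system_def
      by - (elim conjE, erule notE, assumption)
  qed
  then have \<sigma>: "\<sigma> \<in> span Orb" using assms(2) by auto
  have "\<exists>x\<in>Orb. x \<bullet> \<sigma> \<noteq> 0"
  proof (rule ccontr)
    assume "\<not> ?thesis"
    then have "orthogonal \<sigma> x" if "x \<in> Orb" for x using that by (simp add: orthogonal_def inner_commute[of \<sigma>])
    then have "orthogonal \<sigma> \<sigma>" using orthogonal_to_span[OF \<sigma>] by blast
    then show False using root assms(2) by (auto simp: orthogonal_def root_system_def)
  qed
  then show ?thesis using that by (auto simp: Orb_def)
qed

text \<open>
  Compare a root of the length of \<open>\<beta>\<close> with a short root \<open>\<sigma>\<close> that is not orthogonal to it. The two Cartan integers have
  product at most 4, and their quotient is the ratio of the squared lengths.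
\<close>

lemma root_length_even_integer:
  assumes irr: "irreducible_root_system \<Phi>" and nrm: "short_roots_normalised \<Phi>" and "\<beta> \<in> \<Phi>"
  obtains n :: int where "0 < n" "\<beta> \<bullet> \<beta> = 2 * of_int n"
proof -
  have int: "2 * (x \<bullet> y) / (y \<bullet> y) \<in> \<int>" if "x \<in> \<Phi>" "y \<in> \<Phi>" for x y
    using irr that by (auto simp: irreducible_root_system_def root_system_def)
  obtain \<sigma> where \<sigma>: "\<sigma> \<in> \<Phi>" "\<sigma> \<bullet> \<sigma> = 2" using nrm by (auto simp: short_roots_normalised_def)
  obtain x where x: "x \<in> \<Phi>" "x \<bullet> x = \<beta> \<bullet> \<beta>" "x \<bullet> \<sigma> \<noteq> 0"
    using root_nonorthogonal_same_length[OF irr \<sigma>(1) assms(3)] .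
  have N: "2 \<le> x \<bullet> x" using nrm x(1) by (auto simp: short_roots_normalised_def)
  obtain n where n: "x \<bullet> \<sigma> = of_int n" using int[OF x(1) \<sigma>(1)] \<sigma>(2) by (auto elim: Ints_cases)
  obtain m where m: "2 * (\<sigma> \<bullet> x) / (x \<bullet> x) = of_int m" using int[OF \<sigma>(1) x(1)] by (auto elim: Ints_cases)
  have nm: "2 * of_int n = of_int m * (x \<bullet> x)" using m N n by (simp add: inner_commute[of \<sigma> x] divide_eq_eq mult.commute split: if_splits)
  have n0: "n \<noteq> 0" using x(3) n by auto
  have m0: "m \<noteq> 0" using nm n0 by auto
  have "(x \<bullet> \<sigma>)\<^sup>2 \<le> (x \<bullet> x) * (\<sigma> \<bullet> \<sigma>)" by (rule Cauchy_Schwarz_ineq)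
  then have cs: "(of_int n)\<^sup>2 \<le> 2 * (x \<bullet> x)" using n \<sigma>(2) by simp
  have abs: "2 * \<bar>of_int n\<bar> = \<bar>of_int m\<bar> * (x \<bullet> x)"
    using arg_cong[OF nm, of abs] N by (simp add: abs_mult)
  have le: "\<bar>m\<bar> \<le> \<bar>n\<bar>"
  proof -
    have "\<bar>of_int m\<bar> * 2 \<le> \<bar>of_int m\<bar> * (x \<bullet> x)" using N by (intro mult_left_mono) auto
    then have "\<bar>of_int m\<bar> \<le> (\<bar>of_int n\<bar> :: real)" using abs by linarith
    then show ?thesis by linarith
  qed
  have "\<bar>m\<bar> = 1 \<or> x \<bullet> x = 2"
  proof (rule ccontr)
    assume *: "\<not> ?thesis"
    then have m2: "2 \<le> \<bar>m\<bar>" using m0 by linarith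
    have "of_int (n * n) * \<bar>of_int m\<bar> \<le> 2 * (x \<bullet> x) * \<bar>of_int m :: real\<bar>"
      using cs by (intro mult_right_mono) (auto simp: power2_eq_square)
    also have "\<dots> = 4 * \<bar>of_int n\<bar>" using abs by (simp add: algebra_simps)
    finally have "\<bar>of_int n\<bar> * (\<bar>of_int n\<bar> * \<bar>of_int m\<bar>) \<le> \<bar>of_int n\<bar> * (4 :: real)"
      by (simp add: algebra_simps)
    then have "\<bar>of_int n\<bar> * \<bar>of_int m\<bar> \<le> (4 :: real)" using n0 by simp
    then have nm4: "\<bar>n\<bar> * \<bar>m\<bar> \<le> 4" by (metis (mono_tags, opaque_lifting) of_int_abs of_int_le_numeral_iff of_int_mult)
    have "2 * 2 \<le> \<bar>n\<bar> * \<bar>m\<bar>" by (rule mult_mono) (use m2 le in auto)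
    then have "\<bar>n\<bar> * \<bar>m\<bar> = 4" using nm4 by simp
    moreover have "\<bar>n\<bar> * 2 \<le> \<bar>n\<bar> * \<bar>m\<bar>" using m2 by (intro mult_left_mono) auto
    ultimately have "\<bar>n\<bar> = 2" using m2 le by linarith
    then have "\<bar>m\<bar> = 2" using \<open>\<bar>n\<bar> * \<bar>m\<bar> = 4\<close> by simp
    then have "x \<bullet> x = 2" using abs \<open>\<bar>n\<bar> = 2\<close> by (simp flip: of_int_abs)
    with * show False by simp
  qed
  then show ?thesis
  proof
    assume "\<bar>m\<bar> = 1"
    then have "x \<bullet> x = 2 * of_int \<bar>n\<bar>" using abs by (simp flip: of_int_abs)
    then show ?thesis using x(2) n0 by (intro that[of "\<bar>n\<bar>"]) auto
  next
    assume "x \<bullet> x = 2"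
    then show ?thesis using x(2) by (intro that[of 1]) auto
  qed
qed

text \<open>
  The off-diagonal sign is read off the reflection of \<open>\<alpha>\<^sub>j\<close> in \<open>\<alpha>\<^sub>i\<close>: its coefficient at \<open>\<alpha>\<^sub>j\<close> is 1, so the
  coefficient \<open>- a\<^sub>i\<^sub>j\<close> at \<open>\<alpha>\<^sub>i\<close> is not negative.
\<close>

lemma cartan_datum_of_root_system:
  fixes \<alpha> :: "'i::{finite,linorder} \<Rightarrow> 'v::euclidean_space"
  assumes irr: "irreducible_root_system \<Phi>" and sr: "simple_roots \<Phi> \<alpha>" and nrm: "short_roots_normalised \<Phi>"
    and q: "q \<noteq> 0" "\<forall>n>0. q ^ n \<noteq> 1"
  shows "cartan_datum \<alpha> q"
proof
  have root: "root_system \<Phi>" using irr by (simp add: irreducible_root_system_def)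
  have mem: "\<alpha> i \<in> \<Phi>" for i using sr by (auto simp: simple_roots_def)
  have hn: "0 < half_norm \<alpha> i \<and> \<alpha> i \<bullet> \<alpha> i = 2 * of_int (half_norm \<alpha> i)" for i
  proof -
    obtain n :: int where "0 < n" "\<alpha> i \<bullet> \<alpha> i = 2 * of_int n"
      using root_length_even_integer[OF irr nrm mem[of i]] .
    then show ?thesis by (simp add: half_norm_def)
  qed
  have ci: "2 * (\<alpha> i \<bullet> \<alpha> j) / (\<alpha> i \<bullet> \<alpha> i) = of_int (cartan_int \<alpha> i j)" for i j
  proof -
    have "2 * (\<alpha> j \<bullet> \<alpha> i) / (\<alpha> i \<bullet> \<alpha> i) \<in> \<int>" using root mem by (auto simp: root_system_def)
    then show ?thesis by (auto simp: cartan_int_def inner_commute elim!: Ints_cases)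
  qed
  fix i j :: 'i
  show "0 < half_norm \<alpha> i" using hn by blast
  show "\<alpha> i \<bullet> \<alpha> j = of_int (half_norm \<alpha> i * cartan_int \<alpha> i j)"
    using ci[of i j] hn[of i] by (simp add: field_simps)
  show "cartan_int \<alpha> i i = 2" using hn[of i] by (simp add: cartan_int_def)
  show "inj \<alpha>" "independent (range \<alpha>)" using sr by (auto simp: simple_roots_def)
  show "generic_param q" using q by (simp add: generic_param_def)
  show "cartan_int \<alpha> i j \<le> 0" if ij: "i \<noteq> j"
  proof -
    let ?a = "cartan_int \<alpha> i j"
    have "reflection (\<alpha> i) (\<alpha> j) = \<alpha> j - of_int ?a *\<^sub>R \<alpha> i"
      unfolding reflection_def using ci[of i j] by (simp add: inner_commute)
    moreover have "reflection (\<alpha> i) (\<alpha> j) \<in> \<Phi>" using root mem by (auto simp: root_system_def)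
    ultimately obtain c :: "'i \<Rightarrow> int" where c: "\<alpha> j - of_int ?a *\<^sub>R \<alpha> i = (\<Sum>k\<in>UNIV. of_int (c k) *\<^sub>R \<alpha> k)"
      and sg: "(\<forall>k. 0 \<le> c k) \<or> (\<forall>k. c k \<le> 0)"
      using sr unfolding simple_roots_def by metis
    \<comment> \<open>The difference of the two expansions of the reflected root; it vanishes by linear independence.\<close>
    define u where "u k = real_of_int (c k) - (if k = j then 1 else 0) + (if k = i then of_int ?a else 0)" for k
    have "(\<Sum>k\<in>UNIV. u k *\<^sub>R \<alpha> k) = (\<Sum>k\<in>UNIV. of_int (c k) *\<^sub>R \<alpha> k - (if k = j then \<alpha> k else 0) + (if k = i then of_int ?a *\<^sub>R \<alpha> k else 0))"
      by (intro sum.cong) (auto simp: u_def algebra_simps)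
    also have "\<dots> = 0" by (simp add: sum.distrib sum_subtractf flip: c)
    finally have "(\<Sum>v\<in>range \<alpha>. u (inv_into UNIV \<alpha> v) *\<^sub>R v) = 0"
      using sr by (simp add: sum.reindex simple_roots_def)
    moreover have "\<not> (\<exists>u. (\<exists>v\<in>range \<alpha>. u v \<noteq> 0) \<and> (\<Sum>v\<in>range \<alpha>. u v *\<^sub>R v) = 0)"
      using sr dependent_finite[of "range \<alpha>"] by (simp add: simple_roots_def)
    ultimately have "u (inv_into UNIV \<alpha> v) = 0" if "v \<in> range \<alpha>" for v using that by metis
    then have u0: "u k = 0" for k using sr by (metis UNIV_I inv_into_f_f range_eqI simple_roots_def)
    have "c j = 1" using u0[of j] ij by (simp add: u_def)
    with sg have "0 \<le> c i" by (metis not_one_le_zero)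
    moreover have "c i = - ?a" using u0[of i] ij by (simp add: u_def)
    ultimately show ?thesis by simp
  qed
qed

section \<open>The base field and the free algebra over it\<close>

lemma type_algebra_simps:
  "carrier (ring_of_type_algebra :: complex ring) = UNIV"
  "x \<otimes>\<^bsub>ring_of_type_algebra\<^esub> y = x * (y :: complex)" "x \<oplus>\<^bsub>ring_of_type_algebra\<^esub> y = x + (y :: complex)"
  "\<one>\<^bsub>ring_of_type_algebra\<^esub> = (1 :: complex)" "\<zero>\<^bsub>ring_of_type_algebra\<^esub> = (0 :: complex)"
  by (simp_all add: ring_of_type_algebra_def)

lemma complex_subfield_Qq: "complex_subfield (Qq q)"
proof -
  interpret C: field "ring_of_type_algebra :: complex ring" by (rule field_from_type_algebra)
  have uminus: "\<ominus>\<^bsub>ring_of_type_algebra\<^esub> x = - (x :: complex)" for x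
    by (rule C.minus_equality) (simp_all add: type_algebra_simps)
  have inv: "inv\<^bsub>ring_of_type_algebra\<^esub> x = inverse x" if "x \<noteq> 0" for x :: complex
    using that by (intro C.comm_inv_char) (simp_all add: type_algebra_simps)
  show ?thesis
  proof
    show "1 \<in> Qq q" using generate_field.one[of "ring_of_type_algebra :: complex ring" "{q}"]
      by (simp add: Qq_def type_algebra_simps)
    fix a b assume a: "a \<in> Qq q"
    show "- a \<in> Qq q" using generate_field.a_inv[OF a[unfolded Qq_def]] by (simp add: Qq_def uminus)
    show "inverse a \<in> Qq q"
      using generate_field.m_inv[OF a[unfolded Qq_def]] a inv by (cases "a = 0") (simp_all add: Qq_def type_algebra_simps)
    assume b: "b \<in> Qq q"
    show "a + b \<in> Qq q" using generate_field.eng_add[OF a[unfolded Qq_def] b[unfolded Qq_def]] by (simp add: Qq_def type_algebra_simps)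
    show "a * b \<in> Qq q" using generate_field.eng_mult[OF a[unfolded Qq_def] b[unfolded Qq_def]] by (simp add: Qq_def type_algebra_simps)
  qed
qed

lemma q_in_Qq: "q \<in> Qq q"
  unfolding Qq_def by (rule generate_field.incl) simp

context complex_subfield
begin

abbreviation FA :: "'g falg ring" where "FA \<equiv> free_algebra K"

lemma FA_simps [simp]:
  "carrier FA = KA" "x \<otimes>\<^bsub>FA\<^esub> y = x * y" "x \<oplus>\<^bsub>FA\<^esub> y = x + y" "\<one>\<^bsub>FA\<^esub> = 1" "\<zero>\<^bsub>FA\<^esub> = 0"
  by (simp_all add: free_algebra_def ring_of_type_algebra_def KA_def)

lemma KA_uminus: "p \<in> KA \<Longrightarrow> - p \<in> KA"
  using KA_diff[OF KA_0] by simp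

lemma FA_ring: "ring FA"
proof (rule ringI)
  show "abelian_group FA"
  proof (rule abelian_groupI)
    fix x assume "x \<in> carrier FA"
    then show "\<exists>y\<in>carrier FA. y \<oplus>\<^bsub>FA\<^esub> x = \<zero>\<^bsub>FA\<^esub>" by (intro bexI[of _ "- x"]) (simp_all add: KA_uminus)
  qed (simp_all add: KA_add KA_0 add.assoc add.commute)
  show "Group.monoid FA" by (rule monoidI) (simp_all add: KA_mult KA_1 mult.assoc)
qed (simp_all add: distrib_left distrib_right)

lemma FA_minus: "p \<in> KA \<Longrightarrow> \<ominus>\<^bsub>FA\<^esub> p = - p"
proof -
  interpret ring FA by (rule FA_ring)
  assume "p \<in> KA"
  then show ?thesis by (intro minus_equality) (simp_all add: KA_uminus)
qed

text \<open>
  Spans over \<open>K\<close> of lists, as in the library's spans for subrings, but inside the free algebra.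
\<close>

fun lspan :: "'g falg list \<Rightarrow> 'g falg set" where
  "lspan [] = {0}"
| "lspan (u # us) = {const c * u + y | c y. c \<in> K \<and> y \<in> lspan us}"

lemma lspan_KA: "set us \<subseteq> KA \<Longrightarrow> lspan us \<subseteq> KA"
  by (induction us) (auto simp: KA_0 intro!: KA_add KA_const_mult)

lemma lspan_0: "0 \<in> lspan us"
  by (induction us) (auto intro!: exI[of _ 0] simp: K_0)

lemma lspan_append: "x \<in> lspan us \<Longrightarrow> y \<in> lspan vs \<Longrightarrow> x + y \<in> lspan (us @ vs)"
  by (induction us arbitrary: x) (auto simp: add.assoc, metis)

lemma lspan_scale: "c \<in> K \<Longrightarrow> x \<in> lspan us \<Longrightarrow> const c * x \<in> lspan us"
proof (induction us arbitrary: x)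
  case (Cons u us)
  from Cons.prems(2) obtain d y where x: "x = const d * u + y" "d \<in> K" "y \<in> lspan us" by auto
  have "const c * x = const (c * d) * u + const c * y" unfolding x(1) distrib_left const_mult mult.assoc ..
  moreover have "const c * y \<in> lspan us" using Cons.IH Cons.prems(1) x(3) by blast
  moreover have "c * d \<in> K" using Cons.prems(1) x(2) by (rule K_mult)
  ultimately show ?case unfolding lspan.simps mem_Collect_eq by blast
qed simp

lemma lspan_mem: "u \<in> set us \<Longrightarrow> u \<in> lspan us"
proof (induction us)
  case (Cons v us)
  show ?case
  proof (cases "u = v")
    case True
    show ?thesis unfolding lspan.simps mem_Collect_eq
      by (intro exI[of _ 1] exI[of _ 0]) (simp add: True K_1 lspan_0)
  next
    case False
    then have "u \<in> lspan us" using Cons by simp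
    then show ?thesis unfolding lspan.simps mem_Collect_eq
      by (intro exI[of _ 0] exI[of _ u]) (simp add: K_0)
  qed
qed simp

lemma lspan_linear_image:
  assumes "y \<in> lspan us" "\<And>x y. h (x + y) = h x + h y" "\<And>c x. h (const c * x) = const c * h x" "h 0 = 0"
  shows "h y \<in> lspan (map h us)"
  using assms(1)
proof (induction us arbitrary: y)
  case (Cons u us)
  then obtain d z where y: "y = const d * u + z" "d \<in> K" "z \<in> lspan us" by auto
  have "h y = const d * h u + h z" by (simp add: y assms)
  then show ?case using Cons.IH[OF y(3)] y(2) unfolding list.map lspan.simps mem_Collect_eq by blast
qed (simp add: assms)

lemma lspan_eq_sum: "distinct ss \<Longrightarrow> y \<in> lspan (map \<beta> ss) \<Longrightarrow> \<exists>c. y = (\<Sum>t\<in>set ss. const (c t) * \<beta> t)"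
proof (induction ss arbitrary: y)
  case (Cons s ss)
  then obtain d z c where y: "y = const d * \<beta> s + z" "z = (\<Sum>t\<in>set ss. const (c t) * \<beta> t)" by auto metis
  have "(\<Sum>t\<in>set ss. const (c t) * \<beta> t) = (\<Sum>t\<in>set ss. const ((c(s := d)) t) * \<beta> t)"
    using Cons.prems(1) by (intro sum.cong) auto
  then show ?case using y Cons.prems(1) by (intro exI[of _ "c(s := d)"]) simp
qed simp

definition kspan :: "'g falg set \<Rightarrow> 'g falg set" where "kspan G = (\<Union>us\<in>{us. set us \<subseteq> G}. lspan us)"

lemma kspan_add: "x \<in> kspan A \<Longrightarrow> y \<in> kspan A \<Longrightarrow> x + y \<in> kspan A"
proof -
  assume "x \<in> kspan A" "y \<in> kspan A"
  then obtain us vs where "set us \<subseteq> A" "x \<in> lspan us" "set vs \<subseteq> A" "y \<in> lspan vs" by (auto simp: kspan_def)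
  then show ?thesis using lspan_append[of x us y vs] by (auto simp: kspan_def intro!: exI[of _ "us @ vs"])
qed

lemma kspan_scale: "c \<in> K \<Longrightarrow> x \<in> kspan A \<Longrightarrow> const c * x \<in> kspan A"
  using lspan_scale by (auto simp: kspan_def)

lemma kspan_0: "0 \<in> kspan A"
  by (auto simp: kspan_def intro!: exI[of _ "[]"])

lemma kspan_mem: "x \<in> A \<Longrightarrow> x \<in> kspan A"
  unfolding kspan_def by (auto intro!: exI[of _ "[x]"] lspan_mem)

lemma kspan_KA: "A \<subseteq> KA \<Longrightarrow> kspan A \<subseteq> KA"
  using lspan_KA by (fastforce simp: kspan_def)

end

section \<open>The quantum group as a quotient\<close>

context cartan_datum
begin

sublocale Qq: complex_subfield "Qq q" by (rule complex_subfield_Qq)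

abbreviation "UI \<equiv> U_ideal \<alpha> q"

lemma powi_in_Qq: "q powi n \<in> Qq q"
  by (rule Qq.K_power_int[OF q_in_Qq])

lemma qbinom_in_Qq: "v \<in> Qq q \<Longrightarrow> qbinom v m k \<in> Qq q"
  unfolding qbinom_def qfact_def qint_def
  by (intro Qq.K_divide Qq.K_mult Qq.K_prod Qq.K_diff Qq.K_power Qq.K_inverse)

lemma relations_KA: "U_relations \<alpha> q \<subseteq> Qq.KA"
proof -
  have qq: "qq i \<in> Qq q" for i by (simp add: qi_def powi_in_Qq)
  have serre: "serre \<alpha> q x i j \<in> Qq.KA" for x i j
    unfolding serre_def Let_def
    by (intro Qq.KA_sum Qq.KA_mult Qq.KA_power Qq.KA_gen Qq.KA_const Qq.K_mult Qq.K_power Qq.K_uminus Qq.K_1 qbinom_in_Qq qq)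
  have gen: "gen g \<in> Qq.KA" for g :: "'i qgen" by (rule Qq.KA_gen)
  have "(if i = j then const (inverse (qq i - inverse (qq i))) * (gen (GenK i) - gen (GenKinv i)) else 0) \<in> Qq.KA" for i j
    by (simp add: Qq.KA_0 Qq.KA_const_mult Qq.K_inverse Qq.K_diff qq Qq.KA_diff gen)
  then show ?thesis
    unfolding U_relations_def
    by (auto intro!: serre Qq.KA_diff Qq.KA_mult gen Qq.KA_1 Qq.KA_const_mult Qq.K_power_int qq)
qed

lemma UI_ideal: "ideal UI Qq.FA"
  unfolding U_ideal_def by (rule ring.genideal_ideal[OF Qq.FA_ring]) (use relations_KA in simp)

lemma UI_relations: "U_relations \<alpha> q \<subseteq> UI"
  unfolding U_ideal_def by (rule ring.genideal_self[OF Qq.FA_ring]) (use relations_KA in simp)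

lemma UI_KA: "UI \<subseteq> Qq.KA"
  using ideal.Icarr[OF UI_ideal] by auto

lemma UI_0: "0 \<in> UI"
  using additive_subgroup.zero_closed[OF ideal.axioms(1)[OF UI_ideal]] by simp

lemma UI_add: "x \<in> UI \<Longrightarrow> y \<in> UI \<Longrightarrow> x + y \<in> UI"
  using additive_subgroup.a_closed[OF ideal.axioms(1)[OF UI_ideal]] by simp

lemma UI_mult_left: "x \<in> UI \<Longrightarrow> p \<in> Qq.KA \<Longrightarrow> p * x \<in> UI"
  using ideal.I_l_closed[OF UI_ideal] by simp

lemma UI_mult_right: "x \<in> UI \<Longrightarrow> p \<in> Qq.KA \<Longrightarrow> x * p \<in> UI"
  using ideal.I_r_closed[OF UI_ideal] by simp

lemma UI_scale: "x \<in> UI \<Longrightarrow> c \<in> Qq q \<Longrightarrow> const c * x \<in> UI"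
  by (intro UI_mult_left Qq.KA_const)

lemma UI_uminus: "x \<in> UI \<Longrightarrow> - x \<in> UI"
  using UI_scale[of x "- 1"] by (simp add: falg.s_uminus Qq.K_uminus Qq.K_1)

text \<open>
  Containment in \<open>N\<close> can be checked on generators even when \<open>N\<close> is an ideal of the complex free algebra.
\<close>

lemma UI_subset:
  assumes "U_relations \<alpha> q \<subseteq> N" "0 \<in> N" "\<And>x y. x \<in> N \<Longrightarrow> y \<in> N \<Longrightarrow> x + y \<in> N"
    "\<And>x y. x \<in> N \<Longrightarrow> x * y \<in> N" "\<And>x y. x \<in> N \<Longrightarrow> y * x \<in> N"
  shows "UI \<subseteq> N"
proof -
  interpret ring Qq.FA by (rule Qq.FA_ring)
  have "ideal (N \<inter> Qq.KA) Qq.FA"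
  proof (rule idealI[OF Qq.FA_ring])
    show "subgroup (N \<inter> Qq.KA) (add_monoid Qq.FA)"
    proof (rule add.subgroupI)
      fix a assume "a \<in> N \<inter> Qq.KA"
      moreover from this have "- 1 * a \<in> N" using assms(5)[of a "- 1"] by simp
      ultimately show "\<ominus>\<^bsub>Qq.FA\<^esub> a \<in> N \<inter> Qq.KA" by (simp add: Qq.FA_minus Qq.KA_uminus)
    qed (use assms Qq.KA_0 Qq.KA_add in auto)
  qed (use assms Qq.KA_mult in auto)
  then show ?thesis unfolding U_ideal_def
    using genideal_minimal[of "N \<inter> Qq.KA" "U_relations \<alpha> q"] assms(1) relations_KA by auto
qed

abbreviation "UU \<equiv> U \<alpha> q"
abbreviation "pr \<equiv> U_proj \<alpha> q"

lemma U_ring: "ring UU"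
  unfolding U_def by (rule ideal.quotient_is_ring[OF UI_ideal])

lemma U_hom: "ring_hom_ring Qq.FA UU pr"
  using ideal.rcos_ring_hom_ring[OF UI_ideal] by (simp add: U_def U_proj_def[abs_def])

lemma pr_mult: "x \<in> Qq.KA \<Longrightarrow> y \<in> Qq.KA \<Longrightarrow> pr x \<otimes>\<^bsub>UU\<^esub> pr y = pr (x * y)"
  and pr_add: "x \<in> Qq.KA \<Longrightarrow> y \<in> Qq.KA \<Longrightarrow> pr x \<oplus>\<^bsub>UU\<^esub> pr y = pr (x + y)"
  and pr_1: "\<one>\<^bsub>UU\<^esub> = pr 1" and pr_0: "\<zero>\<^bsub>UU\<^esub> = pr 0"
  and pr_closed: "x \<in> Qq.KA \<Longrightarrow> pr x \<in> carrier UU"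
proof -
  interpret ring_hom_ring Qq.FA UU pr by (rule U_hom)
  show "x \<in> Qq.KA \<Longrightarrow> y \<in> Qq.KA \<Longrightarrow> pr x \<otimes>\<^bsub>UU\<^esub> pr y = pr (x * y)" using hom_mult[of x y] by simp
  show "x \<in> Qq.KA \<Longrightarrow> y \<in> Qq.KA \<Longrightarrow> pr x \<oplus>\<^bsub>UU\<^esub> pr y = pr (x + y)" using hom_add[of x y] by simp
  show "\<one>\<^bsub>UU\<^esub> = pr 1" using hom_one by simp
  show "\<zero>\<^bsub>UU\<^esub> = pr 0" using hom_zero by simp
  show "x \<in> Qq.KA \<Longrightarrow> pr x \<in> carrier UU" using hom_closed[of x] by simp
qed

lemma pr_uminus: "x \<in> Qq.KA \<Longrightarrow> \<ominus>\<^bsub>UU\<^esub> pr x = pr (- x)"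
proof -
  interpret ring_hom_ring Qq.FA UU pr by (rule U_hom)
  show "x \<in> Qq.KA \<Longrightarrow> \<ominus>\<^bsub>UU\<^esub> pr x = pr (- x)" using hom_a_inv[of x] by (simp add: Qq.FA_minus)
qed

lemma pr_eq_iff:
  assumes "x \<in> Qq.KA" "y \<in> Qq.KA" shows "pr x = pr y \<longleftrightarrow> x - y \<in> UI"
proof -
  interpret ideal UI Qq.FA by (rule UI_ideal)
  have m: "x \<ominus>\<^bsub>Qq.FA\<^esub> y = x - y" using assms by (simp add: a_minus_def Qq.FA_minus)
  show ?thesis
    using quotient_eq_iff_same_a_r_cos[OF UI_ideal, of x y] assms unfolding U_proj_def m by simp
qed

lemma pr_sum:
  assumes "finite A" "\<And>a. a \<in> A \<Longrightarrow> f a \<in> Qq.KA"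
  shows "(\<Oplus>\<^bsub>UU\<^esub>a\<in>A. pr (f a)) = pr (\<Sum>a\<in>A. f a)"
proof -
  interpret ring UU by (rule U_ring)
  show ?thesis using assms
    by (induction A rule: finite_induct) (simp_all add: pr_0 pr_add pr_closed Qq.KA_sum Pi_def finsum_insert)
qed

lemma Span_eq_lspan:
  assumes "set us \<subseteq> Qq.KA"
  shows "ring.Span UU (U_scalars \<alpha> q) (map pr us) = pr ` Qq.lspan us"
proof -
  interpret ring UU by (rule U_ring)
  show ?thesis using assms
  proof (induction us)
    case Nil
    then show ?case by (simp add: pr_0)
  next
    case (Cons u us)
    have "Span (U_scalars \<alpha> q) (map pr (u # us)) = line_extension (U_scalars \<alpha> q) (pr u) (pr ` Qq.lspan us)"
      using Cons by simp
    also have "\<dots> = {pr (const c) \<otimes>\<^bsub>UU\<^esub> pr u \<oplus>\<^bsub>UU\<^esub> pr y | c y. c \<in> Qq q \<and> y \<in> Qq.lspan us}"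
      by (auto simp: line_extension_mem_iff U_scalars_def; blast)
    also have "\<dots> = {pr (const c * u + y) | c y. c \<in> Qq q \<and> y \<in> Qq.lspan us}"
    proof -
      have "pr (const c) \<otimes>\<^bsub>UU\<^esub> pr u \<oplus>\<^bsub>UU\<^esub> pr y = pr (const c * u + y)" if "c \<in> Qq q" "y \<in> Qq.lspan us" for c y
      proof -
        have "y \<in> Qq.KA" "u \<in> Qq.KA" using that Qq.lspan_KA Cons.prems by auto
        then show ?thesis using that by (simp add: pr_mult pr_add Qq.KA_const Qq.KA_mult)
      qed
      then show ?thesis by (auto, metis+)
    qed
    also have "\<dots> = pr ` Qq.lspan (u # us)" by auto
    finally show ?case .
  qed
qed

lemma mem_Span_iff:
  assumes "set us \<subseteq> Qq.KA" "x \<in> Qq.KA"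
  shows "pr x \<in> ring.Span UU (U_scalars \<alpha> q) (map pr us) \<longleftrightarrow> (\<exists>y\<in>Qq.lspan us. x - y \<in> UI)"
  unfolding Span_eq_lspan[OF assms(1)] using Qq.lspan_KA[OF assms(1)] assms(2) pr_eq_iff by blast

lemma independentI:
  assumes "\<And>s. s \<in> S \<Longrightarrow> \<beta> s \<in> Qq.KA"
    and "\<And>A c s. finite A \<Longrightarrow> A \<subseteq> S \<Longrightarrow> s \<in> A \<Longrightarrow> c s \<noteq> 0 \<Longrightarrow> (\<Sum>t\<in>A. const (c t) * \<beta> t) \<notin> UI"
    and "distinct ss" "set ss \<subseteq> S"
  shows "ring.independent UU (U_scalars \<alpha> q) (map (\<lambda>s. pr (\<beta> s)) ss)"
proof -
  interpret ring UU by (rule U_ring)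
  show ?thesis using assms(3,4)
  proof (induction ss)
    case (Cons s ss)
    have "pr (\<beta> s) \<notin> Span (U_scalars \<alpha> q) (map pr (map \<beta> ss))"
    proof
      assume "pr (\<beta> s) \<in> Span (U_scalars \<alpha> q) (map pr (map \<beta> ss))"
      then obtain y where y: "y \<in> Qq.lspan (map \<beta> ss)" "\<beta> s - y \<in> UI"
        using mem_Span_iff[of "map \<beta> ss" "\<beta> s"] assms(1) Cons.prems by auto
      obtain c where c: "y = (\<Sum>t\<in>set ss. const (c t) * \<beta> t)"
        using Qq.lspan_eq_sum[OF _ y(1)] Cons.prems by auto
      define d where "d t = (if t = s then 1 else - c t)" for t
      have "(\<Sum>t\<in>set (s # ss). const (d t) * \<beta> t) = const (d s) * \<beta> s + (\<Sum>t\<in>set ss. const (d t) * \<beta> t)"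
        using Cons.prems by simp
      also have "(\<Sum>t\<in>set ss. const (d t) * \<beta> t) = (\<Sum>t\<in>set ss. - (const (c t) * \<beta> t))"
        using Cons.prems by (intro sum.cong) (auto simp: d_def falg.s_uminus)
      finally have "(\<Sum>t\<in>set (s # ss). const (d t) * \<beta> t) = \<beta> s - y" by (simp add: d_def c sum_negf)
      moreover have "(\<Sum>t\<in>set (s # ss). const (d t) * \<beta> t) \<notin> UI"
        by (rule assms(2)[of _ s]) (use Cons.prems in \<open>auto simp: d_def\<close>)
      ultimately show False using y(2) by simp
    qed
    then show ?case using Cons assms(1) by (simp add: li_Cons pr_closed comp_def)
  qed simp
qed

end

section \<open>Leading words of bracketings\<close>

definition above :: "'i::linorder list \<Rightarrow> 'i falg \<Rightarrow> bool"
  where "above w p \<longleftrightarrow> (\<forall>u\<in>Poly_Mapping.keys p. length (letters u) = length w \<and> w <\<^sub>l letters u)"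

definition leadword :: "'i::linorder falg \<Rightarrow> 'i list \<Rightarrow> bool"
  where "leadword p w \<longleftrightarrow> above w (p - monomial w)"

lemma above_0: "above w 0" by (simp add: above_def)

lemma above_add: "above w p \<Longrightarrow> above w r \<Longrightarrow> above w (p + r)"
  using Poly_Mapping.keys_add[of p r] by (auto simp: above_def)

lemma above_diff: "above w p \<Longrightarrow> above w r \<Longrightarrow> above w (p - r)"
  using keys_diff[of p r] by (auto simp: above_def)

lemma above_sum: "(\<And>a. a \<in> A \<Longrightarrow> above w (f a)) \<Longrightarrow> above w (sum f A)"
  by (induction A rule: infinite_finite_induct) (simp_all add: above_0 above_add)

lemma above_const_mult: "above w p \<Longrightarrow> above w (const c * p)"
  using keys_const_mult[of c p] by (auto simp: above_def)

lemma above_monomial: "length u = length w \<Longrightarrow> w <\<^sub>l u \<Longrightarrow> above w (monomial u)"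
  by (simp add: above_def monomial_def)

lemma keys_mult_word:
  "k \<in> Poly_Mapping.keys (p * r) \<Longrightarrow> \<exists>u\<in>Poly_Mapping.keys p. \<exists>v\<in>Poly_Mapping.keys r. letters k = letters u @ letters v"
  using keys_mult[of p r] by (fastforce simp: plus_word_def)

lemma above_monomial_mult: "above v r \<Longrightarrow> above (w @ v) (monomial w * r)"
  unfolding above_def by (auto dest!: keys_mult_word simp: monomial_def lex_append_cancel)

lemma leadword_keys: "leadword p w \<Longrightarrow> k \<in> Poly_Mapping.keys p \<Longrightarrow> length (letters k) = length w \<and> w \<le>\<^sub>l letters k"
proof -
  assume p: "leadword p w" and k: "k \<in> Poly_Mapping.keys p"
  show ?thesis
  proof (cases "k = Word w")
    case False
    then have "k \<in> Poly_Mapping.keys (p - monomial w)"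
      using k by (simp add: in_keys_iff lookup_minus lookup_monomial)
    then show ?thesis using p by (auto simp: leadword_def above_def lex.less_imp_le)
  qed simp
qed

lemma above_mult_leadword:
  assumes "above w p" "leadword r v" shows "above (w @ v) (p * r)"
  unfolding above_def
proof
  fix k assume "k \<in> Poly_Mapping.keys (p * r)"
  then obtain a b where ab: "a \<in> Poly_Mapping.keys p" "b \<in> Poly_Mapping.keys r" "letters k = letters a @ letters b"
    using keys_mult_word by blast
  then show "length (letters k) = length (w @ v) \<and> w @ v <\<^sub>l letters k"
    using assms(1) leadword_keys[OF assms(2) ab(2)] lex_less_same_length_append[of w "letters a" v "letters b"]
    by (auto simp: above_def)
qed

lemma leadword_mult:
  assumes "leadword p w" "leadword r v" shows "leadword (p * r) (w @ v)"
proof -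
  have "p * r - monomial (w @ v) = monomial w * (r - monomial v) + (p - monomial w) * r"
    by (simp add: monomial_append algebra_simps)
  then show ?thesis
    using above_monomial_mult[of v "r - monomial v" w] above_mult_leadword[of w "p - monomial w" r v] assms
    by (simp add: leadword_def above_add)
qed

lemma leadword_monomial: "leadword (monomial w) w"
  by (simp add: leadword_def above_0)

text \<open>
  The q-commutator differs from the plain product only by products in the opposite order.
\<close>

lemma qcommutator_eq:
  fixes x y :: "'i falg"
  shows "qcommutator \<alpha> q x y = x * y - (\<Sum>u\<in>Poly_Mapping.keys x. \<Sum>v\<in>Poly_Mapping.keys y.
      const (Poly_Mapping.lookup x u * Poly_Mapping.lookup y v * q powi (- \<lfloor>weight \<alpha> (letters u) \<bullet> weight \<alpha> (letters v)\<rfloor>))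
        * monomial (letters v @ letters u))"
proof -
  have xy: "x * y = (\<Sum>u\<in>Poly_Mapping.keys x. \<Sum>v\<in>Poly_Mapping.keys y.
      const (Poly_Mapping.lookup x u * Poly_Mapping.lookup y v) * (monomial (letters u) * monomial (letters v)))"
  proof -
    have "x * y = (\<Sum>u\<in>Poly_Mapping.keys x. \<Sum>v\<in>Poly_Mapping.keys y.
        (const (Poly_Mapping.lookup x u) * monomial (letters u)) * (const (Poly_Mapping.lookup y v) * monomial (letters v)))"
      unfolding sum_product[symmetric] by (rule arg_cong2[OF falg_eq_sum falg_eq_sum])
    moreover have "(const a * monomial u) * (const b * monomial v) = const (a * b) * (monomial u * monomial v)" for a b and u v :: "'i list"
      by (simp only: const_mult mult.assoc falg.s_left_commute[of "monomial u"])
    ultimately show ?thesis by (simp only:)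
  qed
  show ?thesis
    unfolding qcommutator_def xy sum_subtractf[symmetric]
    by (intro sum.cong refl) (simp only: right_diff_distrib const_mult monomial_append mult.assoc)
qed

lemma leadword_qcommutator:
  assumes "leadword x u" "leadword y v" "u @ v <\<^sub>l v @ u"
  shows "leadword (qcommutator \<alpha> q x y) (u @ v)"
proof -
  let ?c = "\<lambda>a b. Poly_Mapping.lookup x a * Poly_Mapping.lookup y b * q powi (- \<lfloor>weight \<alpha> (letters a) \<bullet> weight \<alpha> (letters b)\<rfloor>)"
  have "above (u @ v) (monomial (letters b @ letters a))" if "a \<in> Poly_Mapping.keys x" "b \<in> Poly_Mapping.keys y" for a b
  proof (rule above_monomial)
    have a: "length (letters a) = length u \<and> u \<le>\<^sub>l letters a" and b: "length (letters b) = length v \<and> v \<le>\<^sub>l letters b"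
      using leadword_keys assms that by blast+
    then show "length (letters b @ letters a) = length (u @ v)" by simp
    note assms(3)
    also have "v @ u \<le>\<^sub>l letters b @ letters a" using a b by (intro lex_le_same_length_append) auto
    finally show "u @ v <\<^sub>l letters b @ letters a" .
  qed
  then have "above (u @ v) (\<Sum>a\<in>Poly_Mapping.keys x. \<Sum>b\<in>Poly_Mapping.keys y. const (?c a b) * monomial (letters b @ letters a))"
    by (intro above_sum above_const_mult)
  moreover have "above (u @ v) (x * y - monomial (u @ v))"
    using leadword_mult[OF assms(1,2)] by (simp add: leadword_def)
  ultimately have "above (u @ v) (x * y - monomial (u @ v)
      - (\<Sum>a\<in>Poly_Mapping.keys x. \<Sum>b\<in>Poly_Mapping.keys y. const (?c a b) * monomial (letters b @ letters a)))"
    using above_diff by blast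
  then show ?thesis
    unfolding leadword_def qcommutator_eq by (simp add: algebra_simps)
qed

text \<open>
  For the standard factorisation \<open>l = uv\<close> the Lyndon property gives \<open>uv < vu\<close>, so the reversed product in the q-commutator
  contributes larger words only.
\<close>

lemma leadword_bracketing: "lyndon l \<Longrightarrow> leadword (bracketing \<alpha> q l) l"
proof (induction "length l" arbitrary: l rule: less_induct)
  case less
  show ?case
  proof (cases "length l < 2")
    case True
    then show ?thesis by (simp add: bracketing.simps leadword_monomial)
  next
    case False
    let ?k = "longest_lyndon_prefix l"
    let ?u = "take ?k l" and ?v = "drop ?k l"
    have k: "0 < ?k" "?k < length l" using longest_lyndon_prefix_bounds[of l] False by auto
    have ly: "lyndon ?u" "lyndon ?v" using lyndon_standard_factor[of l] less.prems False by auto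
    have ne: "?u \<noteq> []" "?v \<noteq> []" using k by auto
    have "lex_diff (?u @ ?v) ?v" by (rule lyndon_suffix_diff) (use less.prems ne in auto)
    then have lt: "?u @ ?v <\<^sub>l ?v @ ?u" using lex_diff_append[of "?u @ ?v" ?v "[]" ?u] by simp
    have "leadword (bracketing \<alpha> q ?u) ?u" by (rule less.hyps) (use k ly in auto)
    moreover have "leadword (bracketing \<alpha> q ?v) ?v" by (rule less.hyps) (use k ly in auto)
    ultimately have "leadword (qcommutator \<alpha> q (bracketing \<alpha> q ?u) (bracketing \<alpha> q ?v)) (?u @ ?v)"
      using lt by (rule leadword_qcommutator)
    then show ?thesis using False by (subst bracketing.simps) simp
  qed
qed

lemma leadword_prod_bracketing:
  "list_all lyndon ls \<Longrightarrow> leadword (prod_list (map (bracketing \<alpha> q) ls)) (concat ls)"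
proof (induction ls)
  case Nil
  then show ?case using leadword_monomial[of "[]"] by simp
qed (simp add: leadword_mult leadword_bracketing)

section \<open>Words in the generators of the iquantum group\<close>

locale iquantum = cartan_datum \<alpha> q for \<alpha> :: "'i::{finite,linorder} \<Rightarrow> 'v::euclidean_space" and q +
  fixes \<xi> :: "'i \<Rightarrow> complex"
  assumes \<xi>_Qq: "\<xi> i \<in> Qq q"
begin

abbreviation Bw :: "'i list \<Rightarrow> 'i qgen falg" where "Bw w \<equiv> Bhat \<xi> (monomial w)"

lemma Bgen_KA: "Bgen \<xi> i \<in> Qq.KA"
  unfolding Bgen_def by (intro Qq.KA_add Qq.KA_mult Qq.KA_gen Qq.KA_const \<xi>_Qq)

lemma Bw_Cons: "Bw (x # w) = Bgen \<xi> x * Bw w"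
  by (simp add: falg.ev_monomial)

lemma Bw_append: "Bw (u @ v) = Bw u * Bw v"
  by (simp add: monomial_append falg.ev_mult)

lemma Bw_KA: "Bw w \<in> Qq.KA"
  by (induction w) (simp_all add: Bw_Cons Bgen_KA Qq.KA_mult Qq.KA_1 falg.ev_1)

lemma Bhat_KA: "p \<in> Qq.KA \<Longrightarrow> Bhat \<xi> p \<in> Qq.KA"
  by (induction p rule: Qq.KA_induct) (simp_all add: falg.ev_add falg.ev_const_mult Qq.KA_add Qq.KA_const_mult Qq.KA_0 Bw_KA falg.ev_0)

lemma B_gen_eq: "B_gen \<alpha> q \<xi> i = pr (Bgen \<xi> i)"
  by (simp add: B_gen_def Bgen_def)

lemma B_word_eq: "B_word \<alpha> q \<xi> w = pr (Bw w)"
  by (induction w) (simp_all add: B_word_def B_gen_eq pr_1 pr_mult Bgen_KA Bw_KA Bw_Cons falg.ev_1)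

lemma B_lin_eq:
  assumes "p \<in> Qq.KA" shows "B_lin \<alpha> q \<xi> p = pr (Bhat \<xi> p)"
proof -
  have l: "Poly_Mapping.lookup p w \<in> Qq q" for w using assms by (simp add: Qq.KA_def)
  have "B_lin \<alpha> q \<xi> p = (\<Oplus>\<^bsub>UU\<^esub>w\<in>Poly_Mapping.keys p. pr (const (Poly_Mapping.lookup p w) * Bw (letters w)))"
    unfolding B_lin_def by (simp add: B_word_eq pr_mult Qq.KA_const l Bw_KA)
  also have "\<dots> = pr (\<Sum>w\<in>Poly_Mapping.keys p. const (Poly_Mapping.lookup p w) * Bw (letters w))"
    by (rule pr_sum) (simp_all add: Qq.KA_const_mult l Bw_KA)
  also have "(\<Sum>w\<in>Poly_Mapping.keys p. const (Poly_Mapping.lookup p w) * Bw (letters w)) = Bhat \<xi> p"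
    by (subst (3) falg_eq_sum) (simp add: falg.ev_sum falg.ev_const_mult)
  finally show ?thesis .
qed

lemma pr_Bhat_in_iota: "p \<in> Qq.KA \<Longrightarrow> pr (Bhat \<xi> p) \<in> U_iota \<alpha> q \<xi>"
proof -
  let ?G = "generate_ring UU (U_scalars \<alpha> q \<union> range (B_gen \<alpha> q \<xi>))"
  have Bw: "pr (Bw w) \<in> ?G" for w
  proof (induction w)
    case Nil
    then show ?case using generate_ring.one[of UU] by (simp add: pr_1 falg.ev_1)
  next
    case (Cons x w)
    have "pr (Bgen \<xi> x) \<in> ?G" by (rule generate_ring.incl) (auto simp: B_gen_eq[symmetric])
    from generate_ring.eng_mult[OF this Cons] show ?case by (simp add: pr_mult Bgen_KA Bw_KA Bw_Cons)
  qed
  have sc: "pr (const c) \<in> ?G" if "c \<in> Qq q" for c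
    using that by (intro generate_ring.incl) (auto simp: U_scalars_def)
  assume "p \<in> Qq.KA"
  then have "p \<in> Qq.KA \<and> pr (Bhat \<xi> p) \<in> ?G"
  proof (induction p rule: Qq.KA_induct)
    case zero
    then show ?case using sc[OF Qq.K_0] by (simp add: falg.ev_0 Qq.KA_0)
  next
    case (add c w p)
    have "pr (const c) \<otimes>\<^bsub>UU\<^esub> pr (Bw w) \<oplus>\<^bsub>UU\<^esub> pr (Bhat \<xi> p) \<in> ?G"
      using add by (intro generate_ring.eng_add generate_ring.eng_mult sc Bw) auto
    then have "pr (const c * Bw w + Bhat \<xi> p) \<in> ?G"
      using add by (simp add: pr_mult pr_add Qq.KA_const Qq.KA_const_mult Bw_KA Bhat_KA)
    then show ?case using add by (simp add: falg.ev_add falg.ev_const_mult Qq.KA_add Qq.KA_const_mult Qq.KA_monomial)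
  qed
  then show ?thesis by (simp add: U_iota_def)
qed

lemma iota_eq_image: "x \<in> U_iota \<alpha> q \<xi> \<Longrightarrow> \<exists>p\<in>Qq.KA. x = pr (Bhat \<xi> p)"
  unfolding U_iota_def
proof (induction rule: generate_ring.induct)
  case one
  then show ?case by (intro bexI[of _ 1]) (simp_all add: pr_1 Qq.KA_1 falg.ev_1)
next
  case (incl h)
  then consider c where "c \<in> Qq q" "h = pr (const c)" | i where "h = B_gen \<alpha> q \<xi> i" by (auto simp: U_scalars_def)
  then show ?case
  proof cases
    case 1 then show ?thesis by (intro bexI[of _ "const c"]) (simp_all add: Qq.KA_const falg.ev_const)
  next
    case 2 then show ?thesis by (intro bexI[of _ "gen i"]) (simp_all add: B_gen_eq Qq.KA_gen falg.ev_gen)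
  qed
next
  case (a_inv h)
  then obtain p where "p \<in> Qq.KA" "h = pr (Bhat \<xi> p)" by blast
  then show ?case by (intro bexI[of _ "- p"]) (simp_all add: pr_uminus Bhat_KA falg.ev_uminus Qq.KA_uminus)
next
  case (eng_add h1 h2)
  then obtain p r where "p \<in> Qq.KA" "h1 = pr (Bhat \<xi> p)" "r \<in> Qq.KA" "h2 = pr (Bhat \<xi> r)" by blast
  then show ?case by (intro bexI[of _ "p + r"]) (simp_all add: pr_add Bhat_KA falg.ev_add Qq.KA_add)
next
  case (eng_mult h1 h2)
  then obtain p r where "p \<in> Qq.KA" "h1 = pr (Bhat \<xi> p)" "r \<in> Qq.KA" "h2 = pr (Bhat \<xi> r)" by blast
  then show ?case by (intro bexI[of _ "p * r"]) (simp_all add: pr_mult Bhat_KA falg.ev_mult Qq.KA_mult)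
qed

lemma iota_good_iff:
  "iota_good \<alpha> q \<xi> g \<longleftrightarrow> g \<noteq> [] \<and> \<not> (\<exists>ws. (\<forall>w\<in>set ws. w \<prec>\<^sub>w g) \<and> (\<exists>y\<in>Qq.lspan (map Bw ws). Bw g - y \<in> UI))"
proof -
  have "B_word \<alpha> q \<xi> g \<in> ring.Span UU (U_scalars \<alpha> q) (map (B_word \<alpha> q \<xi>) ws) \<longleftrightarrow> (\<exists>y\<in>Qq.lspan (map Bw ws). Bw g - y \<in> UI)" for ws
  proof -
    have "map (\<lambda>w. pr (Bw w)) ws = map pr (map Bw ws)" by simp
    moreover have "set (map Bw ws) \<subseteq> Qq.KA" using Bw_KA by auto
    ultimately show ?thesis using mem_Span_iff[of "map Bw ws" "Bw g"] Bw_KA unfolding B_word_eq by metis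
  qed
  then show ?thesis by (simp add: iota_good_def)
qed

section \<open>Good Lyndon words as leading words of functionals\<close>

definition serre_word :: "'i \<Rightarrow> 'i \<Rightarrow> 'i falg"
  where "serre_word i j = falg.serre_sum (qq i) (nat (1 - cartan_int \<alpha> i j)) (gen i) (gen j)"

definition homogeneous :: "nat \<Rightarrow> 'i falg \<Rightarrow> bool"
  where "homogeneous n p \<longleftrightarrow> (\<forall>w\<in>Poly_Mapping.keys p. length (letters w) = n)"

lemma homogeneous_mult: "homogeneous m p \<Longrightarrow> homogeneous n r \<Longrightarrow> homogeneous (m + n) (p * r)"
  by (auto simp: homogeneous_def dest!: keys_mult_word)

lemma homogeneous_monomial: "homogeneous (length w) (monomial w)"
  by (simp add: homogeneous_def monomial_def)

lemma homogeneous_serre_word: "i \<noteq> j \<Longrightarrow> homogeneous (Suc (Suc (neg_cartan i j))) (serre_word i j)"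
proof -
  assume ij: "i \<noteq> j"
  have pow: "gen i ^ a = monomial (replicate a i)" for a by (induction a) (simp_all add: gen_def flip: monomial_append)
  have summand: "homogeneous (Suc (Suc (neg_cartan i j))) (const c * gen i ^ a * gen j * gen i ^ b)" if "a + b = Suc (neg_cartan i j)" for a b c
  proof -
    have "const c * gen i ^ a * gen j * gen i ^ b = const c * monomial (replicate a i @ [j] @ replicate b i)"
      unfolding pow unfolding gen_def by (simp only: monomial_append mult.assoc)
    then show ?thesis using that by (auto simp: homogeneous_def const_monomial split: if_splits)
  qed
  have hsum: "homogeneous n (sum f A)" if "\<And>a. a \<in> A \<Longrightarrow> homogeneous n (f a)" for n f and A :: "nat set"
    using that
  proof (induction A rule: infinite_finite_induct)
    case (insert x F)
    then show ?case using Poly_Mapping.keys_add[of "f x" "sum f F"] by (fastforce simp: homogeneous_def)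
  qed (simp_all add: homogeneous_def)
  show ?thesis unfolding serre_word_def falg.serre_sum_def serre_len[OF ij] by (intro hsum summand) auto
qed

text \<open>
  The ideal of relations with complex coefficients.
\<close>

definition complex_ideal :: "'i qgen falg set" where "complex_ideal = falg_vs.span UI"

lemma complex_ideal_mult_left: "x \<in> complex_ideal \<Longrightarrow> p * x \<in> complex_ideal"
  unfolding complex_ideal_def
proof (induction x rule: falg_vs.span_induct_alt)
  case base
  then show ?case by (simp add: falg_vs.span_zero)
next
  case (step c x y)
  have "p * x \<in> falg_vs.span UI"
  proof (induction p rule: falg_induct)
    case zero then show ?case by (simp add: falg_vs.span_zero)
  next
    case (add d w p)
    have "monomial w * x \<in> UI" by (rule UI_mult_left[OF step(1) Qq.KA_monomial])
    then have "const d * (monomial w * x) \<in> falg_vs.span UI" by (intro falg_vs.span_scale falg_vs.span_base)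
    with add show ?case by (simp add: distrib_right mult.assoc falg_vs.span_add)
  qed
  then have "const c * (p * x) + p * y \<in> falg_vs.span UI" using step by (intro falg_vs.span_add falg_vs.span_scale)
  then show ?case by (simp add: distrib_left falg.s_left_commute[of p])
qed

lemma complex_ideal_mult_right: "x \<in> complex_ideal \<Longrightarrow> x * p \<in> complex_ideal"
  unfolding complex_ideal_def
proof (induction x rule: falg_vs.span_induct_alt)
  case base
  then show ?case by (simp add: falg_vs.span_zero)
next
  case (step c x y)
  have "x * p \<in> falg_vs.span UI"
  proof (induction p rule: falg_induct)
    case zero then show ?case by (simp add: falg_vs.span_zero)
  next
    case (add d w p)
    have "x * monomial w \<in> UI" by (rule UI_mult_right[OF step(1) Qq.KA_monomial])
    then have "const d * (x * monomial w) \<in> falg_vs.span UI" by (intro falg_vs.span_scale falg_vs.span_base)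
    with add show ?case by (simp add: distrib_left falg.s_left_commute[of x] falg_vs.span_add)
  qed
  then have "const c * (x * p) + y * p \<in> falg_vs.span UI" using step by (intro falg_vs.span_add falg_vs.span_scale)
  then show ?case by (simp add: distrib_right mult.assoc)
qed

lemma complex_ideal_subset:
  assumes "U_relations \<alpha> q \<subseteq> N" "0 \<in> N" "\<And>x y. x \<in> N \<Longrightarrow> y \<in> N \<Longrightarrow> x + y \<in> N"
    "\<And>x y. x \<in> N \<Longrightarrow> x * y \<in> N" "\<And>x y. x \<in> N \<Longrightarrow> y * x \<in> N"
  shows "complex_ideal \<subseteq> N"
  unfolding complex_ideal_def
  by (rule falg_vs.span_minimal[OF UI_subset[OF assms]]) (use assms in \<open>auto simp: falg_vs.subspace_def\<close>)

lemma complex_ideal_annihilator: "complex_ideal \<subseteq> annihilator"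
  by (rule complex_ideal_subset) (use annihilator_relations annihilator_0 annihilator_add annihilator_mult_left annihilator_mult_right in auto)

lemma complex_ideal_counit: "p \<in> complex_ideal \<Longrightarrow> pair (\<lambda>w. prod_list (map counit.gmap w)) p = 0"
proof -
  have "complex_ideal \<subseteq> {p. cscal.ev counit.gmap p = 0}"
    by (rule complex_ideal_subset) (auto simp: counit_relations cscal.ev_0 cscal.ev_add cscal.ev_mult)
  then show "p \<in> complex_ideal \<Longrightarrow> ?thesis" by (auto simp: pair_counit)
qed

text \<open>
  \<open>W\<close> is the continuant of \<open>iserre_relation\<close>, written in the free algebra on the letters. It vanishes in the quotient by the
  complex ideal, and its leading part is the Serre element.
\<close>

lemma serre_word_reduces:
  assumes ij: "i \<noteq> j"
  obtains W where "words_le (Suc (neg_cartan i j)) (serre_word i j - W)"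
    "\<And>\<Psi> x y. \<forall>z\<in>complex_ideal. pair \<Psi> z = 0 \<Longrightarrow> pair \<Psi> (x * Bhat \<xi> W * y) = 0"
proof -
  obtain \<rho> :: "'i qgen \<Rightarrow> 'i qgen list rop" where
    \<rho>0: "\<And>p. p \<in> complex_ideal \<Longrightarrow> rop.ev \<rho> p = 0"
    and \<rho>1: "\<And>\<Psi> p. \<forall>y\<in>complex_ideal. pair \<Psi> y = 0 \<Longrightarrow> act (rop.ev \<rho> p) \<Psi> = act (rop.ev ltrans p) \<Psi>"
    by (rule quotient_representation[of complex_ideal counit.gmap])
       (use complex_ideal_mult_left complex_ideal_mult_right complex_ideal_counit in \<open>auto simp: complex_ideal_def falg_vs.span_zero falg_vs.span_add\<close>)
  have rel: "rop.ev \<rho> r = 0" if "r \<in> U_relations \<alpha> q" for r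
    using \<rho>0 UI_relations falg_vs.span_base that unfolding complex_ideal_def by blast
  interpret P: pre_quantum \<alpha> q "rscalar :: complex \<Rightarrow> 'i qgen list rop"
    "\<lambda>i. \<rho> (GenE i)" "\<lambda>i. \<rho> (GenF i)" "\<lambda>i. \<rho> (GenK i)" "\<lambda>i. \<rho> (GenKinv i)"
    by (rule pre_quantumI[OF rop.scalars_axioms]) (use rel in \<open>auto simp: U_relations_eq\<close>)
  have "{serre \<alpha> q GenE i j, serre \<alpha> q GenF i j} \<subseteq> U_relations \<alpha> q"
    unfolding U_relations_eq by (intro le_supI2 SUP_upper2[of i UNIV] SUP_upper2[of j]) (use ij in simp_all)
  then have ser: "rop.ev \<rho> (serre \<alpha> q GenF i j) = 0" "rop.ev \<rho> (serre \<alpha> q GenE i j) = 0"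
    using rel by simp_all
  let ?v = "qq i" and ?n = "neg_cartan i j"
  let ?d = "dcoef ?v (inverse ?v ^ ?n) (\<xi> i * inverse (?v - inverse ?v))"
  define W where "W = cont (falg.shiftop ?v (inverse ?v ^ ?n) (gen i)) (\<lambda>k. const (?d k)) (Suc ?n) (gen j)"
  have "words_le (Suc ?n) (W - serre_word i j)"
    unfolding W_def serre_word_def serre_len[OF ij] falg.serre_sum_eq_qad[OF qq_generic]
    using cont_leading_term[of "Suc ?n" ?v "inverse ?v ^ ?n" i ?d j] by blast
  from words_le_diff[OF words_le_0 this] have le: "words_le (Suc ?n) (serre_word i j - W)" by simp
  have B: "rop.ev \<rho> (Bgen \<xi> k) = \<rho> (GenF k) + rscalar (\<xi> k) * (\<rho> (GenE k) * \<rho> (GenKinv k))" for k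
    by (simp add: Bgen_def rop.ev_add rop.ev_mult mult.assoc)
  have "rop.ev \<rho> (Bhat \<xi> W) = 0"
    unfolding rop.ev_ev W_def rop.ev_cont rop.ev_gen B
    by (rule P.iserre_relation[OF ij]) (use ser in \<open>simp_all add: serre_eq rop.ev_serre_sum serre_len[OF ij]\<close>)
  then have "pair \<Psi> (x * Bhat \<xi> W * y) = 0" if \<Psi>: "\<forall>z\<in>complex_ideal. pair \<Psi> z = 0" for \<Psi> x y
  proof -
    let ?\<Phi> = "act (rop.ev ltrans x) \<Psi>"
    have \<Phi>: "\<forall>z\<in>complex_ideal. pair ?\<Phi> z = 0" using \<Psi> complex_ideal_mult_left by (simp add: pair_act_ev_ltrans)
    have "pair \<Psi> (x * Bhat \<xi> W * y) = pair (act (rop.ev ltrans (Bhat \<xi> W)) ?\<Phi>) y"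
      by (simp add: pair_act_ev_ltrans mult.assoc)
    also have "\<dots> = 0" unfolding \<rho>1[OF \<Phi>, symmetric] \<open>rop.ev \<rho> (Bhat \<xi> W) = 0\<close> by (simp add: act_zero pair_def)
    finally show ?thesis .
  qed
  with le show ?thesis by (rule that)
qed

text \<open>
  Let \<open>S\<close> be the sum of the ideal and the \<open>K\<close>-span of all \<open>B\<^sub>w\<close> with \<open>w \<prec> l\<close>. Goodness says \<open>B\<^sub>l \<notin> S\<close>, and by flatness
  \<open>B\<^sub>l\<close> is not in the complex span of \<open>S\<close> either; hence there is a complex functional \<open>\<Psi>\<close> with \<open>\<Psi>(S) = 0\<close> and
  \<open>\<Psi>(B\<^sub>l) = 1\<close>. Put \<open>f(w) = \<Psi>(B\<^sub>w)\<close> for words of the length of \<open>l\<close>. On a multiple of a Serre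
  element of this length, \<open>f\<close> agrees with \<open>\<Psi>\<close> at a combination of shorter words, which lies in \<open>S\<close>.
\<close>

lemma good_lyndon_functional:
  assumes "iota_good \<alpha> q \<xi> l"
  shows "\<exists>f\<in>serre_dual. leads f l"
proof -
  define S where "S = {y + j | y j. y \<in> Qq.kspan {Bw w | w. w \<prec>\<^sub>w l} \<and> j \<in> UI}"
  have BwS: "Bw w \<in> S" if "w \<prec>\<^sub>w l" for w
  proof -
    have "Bw w \<in> Qq.kspan {Bw w | w. w \<prec>\<^sub>w l}" by (rule Qq.kspan_mem) (use that in blast)
    moreover have "Bw w = Bw w + 0" by simp
    ultimately show ?thesis unfolding S_def using UI_0 by blast
  qed
  have UIS: "UI \<subseteq> S"
  proof
    fix j assume "j \<in> UI"
    moreover have "j = 0 + j" by simp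
    ultimately show "j \<in> S" unfolding S_def using Qq.kspan_0 by blast
  qed
  have S_KA: "S \<subseteq> Qq.KA"
  proof -
    have "Qq.kspan {Bw w | w. w \<prec>\<^sub>w l} \<subseteq> Qq.KA" by (rule Qq.kspan_KA) (auto simp: Bw_KA)
    then show ?thesis unfolding S_def using UI_KA Qq.KA_add by blast
  qed
  have not_S: "Bw l \<notin> S"
  proof
    assume "Bw l \<in> S"
    then obtain y j us where "Bw l = y + j" "j \<in> UI" and us: "y \<in> Qq.lspan us" "set us \<subseteq> {Bw w | w. w \<prec>\<^sub>w l}"
      unfolding S_def Qq.kspan_def by blast
    then have y: "Bw l - y \<in> UI" "y \<in> Qq.lspan us" "set us \<subseteq> {Bw w | w. w \<prec>\<^sub>w l}" by simp_all
    have "\<exists>ws. us = map Bw ws \<and> (\<forall>w\<in>set ws. w \<prec>\<^sub>w l)"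
      using y(3)
    proof (induction us)
      case (Cons u us)
      then obtain ws w where "us = map Bw ws" "\<forall>w\<in>set ws. w \<prec>\<^sub>w l" "u = Bw w" "w \<prec>\<^sub>w l" by auto
      then show ?case by (intro exI[of _ "w # ws"]) simp
    qed simp
    with y(1,2) assms show False unfolding iota_good_iff by blast
  qed
  have "Bw l \<notin> falg_vs.span S"
  proof
    assume "Bw l \<in> falg_vs.span S"
    then obtain A r where A: "finite A" "A \<subseteq> S" "Bw l = (\<Sum>a\<in>A. const (r a) * a)"
      unfolding falg_vs.span_explicit by blast
    have "(\<Sum>a\<in>A. const (r a) * a) \<in> S"
    proof (rule Qq.flatness[OF A(1)])
      show "S \<subseteq> Qq.KA" by (rule S_KA)
      show "0 \<in> S" using UIS UI_0 by blast
      show "p + p' \<in> S" if pS: "p \<in> S" "p' \<in> S" for p p'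
      proof -
        obtain y j y' j' where "p = y + j" "p' = y' + j'" "y \<in> Qq.kspan {Bw w | w. w \<prec>\<^sub>w l}" "y' \<in> Qq.kspan {Bw w | w. w \<prec>\<^sub>w l}" "j \<in> UI" "j' \<in> UI"
          using pS unfolding S_def by blast
        then show ?thesis unfolding S_def using Qq.kspan_add UI_add
          by (intro CollectI exI[of _ "y + y'"] exI[of _ "j + j'"]) (auto simp: algebra_simps)
      qed
      show "const c * p \<in> S" if cp: "c \<in> Qq q" "p \<in> S" for c p
      proof -
        obtain y j where "p = y + j" "y \<in> Qq.kspan {Bw w | w. w \<prec>\<^sub>w l}" "j \<in> UI"
          using cp unfolding S_def by blast
        then show ?thesis unfolding S_def using Qq.kspan_scale UI_scale cp(1)
          by (intro CollectI exI[of _ "const c * y"] exI[of _ "const c * j"]) (auto simp: distrib_left)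
      qed
      show "(\<Sum>a\<in>A. const (r a) * a) \<in> Qq.KA" using Bw_KA[of l] A(3) by simp
    qed (use A(2) in auto)
    then show False using not_S A(3) by simp
  qed
  then obtain \<Psi> where \<Psi>: "\<forall>y\<in>falg_vs.span S. pair \<Psi> y = 0" "pair \<Psi> (Bw l) = 1"
    using separating_functional[OF falg_vs.subspace_span] by blast
  have \<Psi>S: "pair \<Psi> y = 0" if "y \<in> S" for y using \<Psi>(1) that falg_vs.span_base by blast
  have \<Psi>J: "\<forall>z\<in>complex_ideal. pair \<Psi> z = 0" using \<Psi>(1) falg_vs.span_mono[OF UIS] unfolding complex_ideal_def by blast
  let ?L = "length l"
  define f where "f w = (if length w = ?L then pair \<Psi> (Bw w) else 0)" for w
  have "leads f l"
    unfolding leads_def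
  proof (intro conjI allI impI)
    show "f l \<noteq> 0" using \<Psi>(2) by (simp add: f_def)
    fix u assume u: "f u \<noteq> 0"
    then show "length u = ?L" by (auto simp: f_def split: if_splits)
    show "u \<le>\<^sub>l l"
    proof (rule ccontr)
      assume "\<not> u \<le>\<^sub>l l"
      then have "u \<prec>\<^sub>w l" using \<open>length u = ?L\<close> by (simp add: word_prec_def lex.not_le)
      then have "pair \<Psi> (Bw u) = 0" using \<Psi>S BwS by blast
      then show False using u by (simp add: f_def split: if_splits)
    qed
  qed
  moreover have "f \<in> serre_dual"
  proof -
    have "pair f (monomial u * serre_word i j * monomial v) = 0" if ij: "i \<noteq> j" for u v i j
    proof -
      let ?x = "monomial u * serre_word i j * monomial v"
      let ?N = "length u + Suc (Suc (neg_cartan i j)) + length v"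
      have hom: "homogeneous ?N ?x"
        by (intro homogeneous_mult homogeneous_monomial homogeneous_serre_word ij)
      show ?thesis
      proof (cases "?N = ?L")
        case False
        then show ?thesis using hom by (auto simp: pair_def homogeneous_def f_def intro!: sum.neutral)
      next
        case True
        have pB: "pair \<Psi> (Bhat \<xi> p) = (\<Sum>w\<in>Poly_Mapping.keys p. Poly_Mapping.lookup p w * pair \<Psi> (Bw (letters w)))" for p
          by (subst falg_eq_sum[of p]) (simp add: falg.ev_sum falg.ev_const_mult pair_sum pair_const_mult)
        have "pair f ?x = pair \<Psi> (Bhat \<xi> ?x)"
          unfolding pB[of ?x] pair_def[of f]
        proof (intro sum.cong refl)
          fix w assume "w \<in> Poly_Mapping.keys ?x"
          then have "length (letters w) = ?L" using hom True unfolding homogeneous_def by metis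
          then have "f (letters w) = pair \<Psi> (Bw (letters w))" by (simp add: f_def)
          then show "Poly_Mapping.lookup ?x w * f (letters w) = Poly_Mapping.lookup ?x w * pair \<Psi> (Bw (letters w))" by (rule arg_cong)
        qed
        also obtain W where W: "words_le (Suc (neg_cartan i j)) (serre_word i j - W)"
          "\<And>\<Psi> x y. \<forall>z\<in>complex_ideal. pair \<Psi> z = 0 \<Longrightarrow> pair \<Psi> (x * Bhat \<xi> W * y) = 0"
          using serre_word_reduces[OF ij] by blast
        let ?y = "monomial u * (serre_word i j - W) * monomial v"
        have "?x = ?y + monomial u * W * monomial v" by (simp add: algebra_simps)
        then have "pair \<Psi> (Bhat \<xi> ?x) = pair \<Psi> (Bhat \<xi> ?y) + pair \<Psi> (Bw u * Bhat \<xi> W * Bw v)"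
          by (simp add: falg.ev_add falg.ev_mult pair_add)
        also have "pair \<Psi> (Bw u * Bhat \<xi> W * Bw v) = 0" by (rule W(2)[OF \<Psi>J])
        also have "pair \<Psi> (Bhat \<xi> ?y) = 0"
          unfolding pB[of ?y]
        proof (rule sum.neutral, intro ballI)
          fix w assume "w \<in> Poly_Mapping.keys ?y"
          moreover have "words_le (length u + Suc (neg_cartan i j) + length v) ?y"
            by (intro words_le_mult W(1)) (simp_all add: words_le_def monomial_def)
          ultimately have "length (letters w) < ?L" using True by (auto simp: words_le_def)
          then have "pair \<Psi> (Bw (letters w)) = 0" using \<Psi>S BwS by (simp add: word_prec_def)
          then show "Poly_Mapping.lookup ?y w * pair \<Psi> (Bw (letters w)) = 0" by simp
        qed
        finally show ?thesis by simp
      qed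
    qed
    then have "act (rop.ev ltrans (monomial u * serre_word i j)) f = (\<lambda>_. 0)" if "i \<noteq> j" for u i j
      using that by (simp add: act_ev_ltrans fun_eq_iff)
    then show ?thesis
      by (simp add: serre_dual_def rop.ev_mult rop.ev_monomial serre_word_def rop.ev_serre_sum verma.SF_def)
  qed
  ultimately show ?thesis by blast
qed

section \<open>Bases\<close>

lemma GL_sequencesD:
  assumes "ls \<in> GL_sequences \<alpha> q \<xi>"
  shows "list_all lyndon ls" "nonincreasing ls" "\<And>l. l \<in> set ls \<Longrightarrow> iota_good \<alpha> q \<xi> l"
  using assms by (auto simp: GL_sequences_def GL_def list_all_iff)

text \<open>
  Among the indices with nonzero coefficient take those with the longest words, and among them the one, \<open>t0\<close>, with the
  smallest word. The Serre functional belonging to it vanishes on words of other lengths and on words larger than that of \<open>t0\<close>, hence on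
  all other members of the family, but not on the member \<open>t0\<close>.
\<close>

lemma family_independent:
  assumes lead: "\<And>ls. ls \<in> GL_sequences \<alpha> q \<xi> \<Longrightarrow> leadword (\<beta> ls) (concat ls)"
    and A: "finite A" "A \<subseteq> GL_sequences \<alpha> q \<xi>" "s \<in> A" "c s \<noteq> 0"
  shows "(\<Sum>t\<in>A. const (c t) * Bhat \<xi> (\<beta> t)) \<notin> UI"
proof
  assume inUI: "(\<Sum>t\<in>A. const (c t) * Bhat \<xi> (\<beta> t)) \<in> UI"
  define A' where "A' = {t \<in> A. c t \<noteq> 0}"
  have A': "finite A'" "A' \<noteq> {}" using A by (auto simp: A'_def)
  define k where "k = Max (length ` concat ` A')"
  have k_le: "length (concat t) \<le> k" if "t \<in> A'" for t
    unfolding k_def by (rule Max_ge) (use A' that in auto)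
  have "k \<in> length ` concat ` A'" unfolding k_def by (rule Max_in) (use A' in auto)
  then obtain t1 where t1: "t1 \<in> A'" "length (concat t1) = k" by auto
  define T where "T = concat ` {t \<in> A'. length (concat t) = k}"
  have T: "finite T" "T \<noteq> {}" using A' t1 by (auto simp: T_def)
  have minT: "\<exists>w\<in>T. \<forall>u\<in>T. w \<le>\<^sub>l u"
    using lex.Min_in[OF T] lex.Min_le[OF T(1)] by blast
  then obtain t0 where t0: "t0 \<in> A'" "length (concat t0) = k" "\<And>t. t \<in> A' \<Longrightarrow> length (concat t) = k \<Longrightarrow> concat t0 \<le>\<^sub>l concat t"
    unfolding T_def by auto
  have t0S: "t0 \<in> GL_sequences \<alpha> q \<xi>" using t0(1) A(2) by (auto simp: A'_def)
  obtain f where f: "f \<in> serre_dual" "leads f (concat t0)"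
    using good_product_functional[of t0] good_lyndon_functional GL_sequencesD[OF t0S] by blast
  define p where "p = (\<Sum>t\<in>A'. const (c t) * \<beta> t)"
  have leadA: "leadword (\<beta> t) (concat t)" if "t \<in> A'" for t using lead A(2) that by (auto simp: A'_def)
  have "Bhat \<xi> p = (\<Sum>t\<in>A'. const (c t) * Bhat \<xi> (\<beta> t))"
    by (simp add: p_def falg.ev_sum falg.ev_const_mult)
  also have "\<dots> = (\<Sum>t\<in>A. const (c t) * Bhat \<xi> (\<beta> t))"
    unfolding A'_def by (rule sum.mono_neutral_left) (use A in auto)
  finally have "Bhat \<xi> p \<in> annihilator"
    using inUI complex_ideal_annihilator falg_vs.span_base[of _ UI] by (auto simp: complex_ideal_def)
  moreover have "length (letters w) \<le> k" if "w \<in> Poly_Mapping.keys p" for w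
  proof -
    have "(\<Sum>t\<in>A'. Poly_Mapping.lookup (const (c t) * \<beta> t) w) \<noteq> 0"
      using that by (simp add: p_def in_keys_iff lookup_sum)
    then obtain t where "t \<in> A'" "Poly_Mapping.lookup (const (c t) * \<beta> t) w \<noteq> 0"
      by (rule sum.not_neutral_contains_not_neutral)
    then have "t \<in> A'" "w \<in> Poly_Mapping.keys (const (c t) * \<beta> t)" by (simp_all add: in_keys_iff)
    then have "w \<in> Poly_Mapping.keys (\<beta> t)" using keys_const_mult by blast
    then show ?thesis using leadword_keys[OF leadA[OF \<open>t \<in> A'\<close>]] k_le[OF \<open>t \<in> A'\<close>] by simp
  qed
  moreover have "f w = 0" if "length w < k" for w
    using f(2) that t0(2) by (auto simp: leads_def)
  ultimately have "pair f p = 0" using serre_dual_annihilates_leading_part[OF f(1)] by blast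
  have zero: "pair f (\<beta> t) = 0" if t: "t \<in> A'" "t \<noteq> t0" for t
  proof -
    have "f (letters w) = 0" if w: "w \<in> Poly_Mapping.keys (\<beta> t)" for w
    proof (rule ccontr)
      assume "f (letters w) \<noteq> 0"
      then have fw: "length (letters w) = k" "letters w \<le>\<^sub>l concat t0" using f(2) t0(2) by (auto simp: leads_def)
      have tw: "length (letters w) = length (concat t)" "concat t \<le>\<^sub>l letters w" using leadword_keys[OF leadA[OF t(1)] w] by auto
      have "concat t0 \<le>\<^sub>l concat t" using t0(3)[OF t(1)] fw tw by simp
      then have "concat t = concat t0" using fw(2) tw(2) by (meson lex.order_antisym lex.order_trans)
      then have "t = t0"
        using t(1) A(2) GL_sequencesD[OF t0S] GL_sequencesD[of t]
        by (intro lyndon_factorization_unique) (auto simp: A'_def)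
      with t(2) show False by simp
    qed
    then show ?thesis by (simp add: pair_def)
  qed
  have "pair f (\<beta> t0 - monomial (concat t0)) = 0"
  proof -
    have "f (letters w) = 0" if w: "w \<in> Poly_Mapping.keys (\<beta> t0 - monomial (concat t0))" for w
    proof -
      have "concat t0 <\<^sub>l letters w" using leadA[OF t0(1)] w by (auto simp: leadword_def above_def)
      then have "\<not> letters w \<le>\<^sub>l concat t0" by (simp add: lex.not_le)
      then show ?thesis using f(2) by (auto simp: leads_def)
    qed
    then show ?thesis by (simp add: pair_def)
  qed
  then have "pair f (\<beta> t0) = f (concat t0)" by (simp add: pair_diff)
  moreover have "pair f p = (\<Sum>t\<in>A'. c t * pair f (\<beta> t))"
    by (simp add: p_def pair_sum pair_const_mult)
  moreover have "\<dots> = c t0 * pair f (\<beta> t0) + (\<Sum>t\<in>A' - {t0}. c t * pair f (\<beta> t))"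
    by (rule sum.remove) (use A' t0 in auto)
  moreover have "(\<Sum>t\<in>A' - {t0}. c t * pair f (\<beta> t)) = 0"
    by (rule sum.neutral) (use zero in auto)
  ultimately have "c t0 * f (concat t0) = 0" using \<open>pair f p = 0\<close> by simp
  then show False using t0(1) f(2) by (auto simp: A'_def leads_def)
qed

text \<open>
  There are finitely many words of each length.
\<close>

lemma word_prec_wf: "wfP (word_prec :: 'i list \<Rightarrow> 'i list \<Rightarrow> bool)"
proof -
  let ?rank = "\<lambda>w :: 'i list. card {u. length u = length w \<and> w <\<^sub>l u}"
  have "(x, y) \<in> measures [length, ?rank]" if "x \<prec>\<^sub>w y" for x y :: "'i list"
  proof (cases "length x = length y")
    case True
    with that have lt: "y <\<^sub>l x" by (simp add: word_prec_def)
    have fin: "finite {u :: 'i list. length u = length y \<and> y <\<^sub>l u}"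
      by (rule finite_subset[OF _ finite_lists_length_eq[of "UNIV :: 'i set" "length y"]]) auto
    have "{u. length u = length x \<and> x <\<^sub>l u} \<subset> {u. length u = length y \<and> y <\<^sub>l u}"
      using True lt lex.less_trans by (auto simp: psubset_eq)
    from psubset_card_mono[OF fin this] show ?thesis using True by simp
  next
    case False
    with that show ?thesis by (auto simp: word_prec_def)
  qed
  then have "{(x, y). x \<prec>\<^sub>w y} \<subseteq> measures [length, ?rank]" by blast
  then show ?thesis unfolding wfp_def by (rule wf_subset[OF wf_measures])
qed

lemma word_prec_append: "w \<prec>\<^sub>w l \<Longrightarrow> a @ w @ b \<prec>\<^sub>w a @ l @ b"
  by (auto simp: word_prec_def lex_append_cancel lex_less_same_length_append)

text \<open>
  The elements of the free algebra whose images lie in the span of the family.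
\<close>

definition reachable :: "('i list list \<Rightarrow> 'i falg) \<Rightarrow> 'i qgen falg set"
  where "reachable \<beta> = {y + j | y j. y \<in> Qq.kspan ((\<lambda>ls. Bhat \<xi> (\<beta> ls)) ` GL_sequences \<alpha> q \<xi>) \<and> j \<in> UI}"

lemma reachable_UI: "j \<in> UI \<Longrightarrow> j \<in> reachable \<beta>"
  unfolding reachable_def using Qq.kspan_0 by force

lemma reachable_add: "x \<in> reachable \<beta> \<Longrightarrow> y \<in> reachable \<beta> \<Longrightarrow> x + y \<in> reachable \<beta>"
  unfolding reachable_def
proof clarify
  fix y j y' j'
  assume "y \<in> Qq.kspan ((\<lambda>ls. Bhat \<xi> (\<beta> ls)) ` GL_sequences \<alpha> q \<xi>)" "j \<in> UI"
    "y' \<in> Qq.kspan ((\<lambda>ls. Bhat \<xi> (\<beta> ls)) ` GL_sequences \<alpha> q \<xi>)" "j' \<in> UI"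
  then show "\<exists>ya ja. y + j + (y' + j') = ya + ja \<and> ya \<in> Qq.kspan ((\<lambda>ls. Bhat \<xi> (\<beta> ls)) ` GL_sequences \<alpha> q \<xi>) \<and> ja \<in> UI"
    using Qq.kspan_add UI_add by (intro exI[of _ "y + y'"] exI[of _ "j + j'"]) (auto simp: algebra_simps)
qed

lemma reachable_scale: "c \<in> Qq q \<Longrightarrow> x \<in> reachable \<beta> \<Longrightarrow> const c * x \<in> reachable \<beta>"
  unfolding reachable_def
proof clarify
  fix y j
  assume "c \<in> Qq q" "y \<in> Qq.kspan ((\<lambda>ls. Bhat \<xi> (\<beta> ls)) ` GL_sequences \<alpha> q \<xi>)" "j \<in> UI"
  then show "\<exists>ya ja. const c * (y + j) = ya + ja \<and> ya \<in> Qq.kspan ((\<lambda>ls. Bhat \<xi> (\<beta> ls)) ` GL_sequences \<alpha> q \<xi>) \<and> ja \<in> UI"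
    using Qq.kspan_scale UI_scale by (intro exI[of _ "const c * y"] exI[of _ "const c * j"]) (auto simp: distrib_left)
qed

lemma reachable_lspan: "set us \<subseteq> reachable \<beta> \<Longrightarrow> y \<in> Qq.lspan us \<Longrightarrow> y \<in> reachable \<beta>"
proof (induction us arbitrary: y)
  case Nil
  then show ?case using reachable_UI[OF UI_0] by simp
next
  case (Cons u us)
  from Cons.prems(2) obtain c z where y: "y = const c * u + z" "c \<in> Qq q" "z \<in> Qq.lspan us" by auto
  have "z \<in> reachable \<beta>" using Cons.IH Cons.prems(1) y(3) by auto
  moreover have "const c * u \<in> reachable \<beta>" using Cons.prems(1) y(2) reachable_scale by auto
  ultimately show ?case unfolding y(1) by (intro reachable_add)
qed

text \<open>
  Induction along \<open>\<prec>\<close>, according to whether all factors of the Lyndon factorisation are good.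
\<close>

lemma Bw_reachable:
  assumes lead: "\<And>ls. ls \<in> GL_sequences \<alpha> q \<xi> \<Longrightarrow> leadword (\<beta> ls) (concat ls) \<and> \<beta> ls \<in> Qq.KA"
  shows "Bw w \<in> reachable \<beta>"
proof (induction w rule: wfp_induct_rule[OF word_prec_wf])
  case (1 w)
  obtain ls where ls: "list_all lyndon ls" "nonincreasing ls" "concat ls = w"
    using lyndon_factorization_exists by blast
  show ?case
  proof (cases "\<forall>l\<in>set ls. iota_good \<alpha> q \<xi> l")
    case True
    then have seq: "ls \<in> GL_sequences \<alpha> q \<xi>" using ls by (auto simp: GL_sequences_def GL_def list_all_iff)
    define r where "r = monomial w - \<beta> ls"
    have rK: "r \<in> Qq.KA" using lead[OF seq] by (simp add: r_def Qq.KA_diff Qq.KA_monomial)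
    have ab: "above w (monomial w - r - monomial w)" using lead[OF seq] ls(3) by (simp add: r_def leadword_def)
    have rkeys: "letters u \<prec>\<^sub>w w" if "u \<in> Poly_Mapping.keys r" for u
    proof -
      have "u \<in> Poly_Mapping.keys (monomial w - r - monomial w)" using that by (simp add: in_keys_iff lookup_minus)
      then show ?thesis using ab by (auto simp: above_def word_prec_def)
    qed
    have "Bhat \<xi> r = (\<Sum>u\<in>Poly_Mapping.keys r. const (Poly_Mapping.lookup r u) * Bw (letters u))"
      by (subst falg_eq_sum[of r]) (simp add: falg.ev_sum falg.ev_const_mult)
    also have "\<dots> \<in> reachable \<beta>"
    proof -
      have "(\<Sum>u\<in>B. const (Poly_Mapping.lookup r u) * Bw (letters u)) \<in> reachable \<beta>" if "B \<subseteq> Poly_Mapping.keys r" "finite B" for B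
        using that(2,1)
        by (induction B rule: finite_induct)
           (use rK rkeys 1 in \<open>auto simp: reachable_UI[OF UI_0] Qq.KA_def intro!: reachable_add reachable_scale\<close>)
      then show ?thesis by simp
    qed
    finally have "Bhat \<xi> r \<in> reachable \<beta>" .
    moreover have "Bhat \<xi> (\<beta> ls) \<in> reachable \<beta>"
    proof -
      have "Bhat \<xi> (\<beta> ls) \<in> Qq.kspan ((\<lambda>ls. Bhat \<xi> (\<beta> ls)) ` GL_sequences \<alpha> q \<xi>)" using seq by (intro Qq.kspan_mem) auto
      then have "Bhat \<xi> (\<beta> ls) + 0 \<in> reachable \<beta>" unfolding reachable_def using UI_0 by blast
      then show ?thesis by simp
    qed
    ultimately have "Bhat \<xi> (r + \<beta> ls) \<in> reachable \<beta>" by (simp add: falg.ev_add reachable_add)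
    then show ?thesis by (simp add: r_def)
  next
    case False
    then obtain l where l: "l \<in> set ls" "\<not> iota_good \<alpha> q \<xi> l" by blast
    then have "l \<noteq> []" using ls(1) by (auto simp: list_all_iff lyndon_def)
    with l(2) obtain ws y where ws: "\<forall>v\<in>set ws. v \<prec>\<^sub>w l" "y \<in> Qq.lspan (map Bw ws)" "Bw l - y \<in> UI"
      unfolding iota_good_iff by blast
    obtain a b where "ls = a @ l # b" using l(1) by (meson split_list)
    then have w: "w = concat a @ l @ concat b" using ls(3) by simp
    \<comment> \<open>Replace the bad factor by smaller words inside the whole product.\<close>
    let ?h = "\<lambda>x. Bw (concat a) * x * Bw (concat b)"
    have "?h y \<in> Qq.lspan (map ?h (map Bw ws))"
      by (rule Qq.lspan_linear_image[OF ws(2)]) (simp_all add: distrib_left distrib_right falg.s_left_commute[of "Bw _"] mult.assoc)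
    moreover have "set (map ?h (map Bw ws)) \<subseteq> reachable \<beta>"
    proof
      fix x assume "x \<in> set (map ?h (map Bw ws))"
      then obtain v where v: "v \<in> set ws" "x = ?h (Bw v)" by auto
      have "x = Bw (concat a @ v @ concat b)" by (simp add: v Bw_append mult.assoc)
      moreover have "concat a @ v @ concat b \<prec>\<^sub>w w" unfolding w using ws(1) v(1) by (intro word_prec_append) auto
      ultimately show "x \<in> reachable \<beta>" using 1 by simp
    qed
    ultimately have "?h y \<in> reachable \<beta>" using reachable_lspan by blast
    moreover have "?h (Bw l - y) \<in> reachable \<beta>"
      by (intro reachable_UI UI_mult_right UI_mult_left ws(3) Bw_KA)
    ultimately have "?h (Bw l - y) + ?h y \<in> reachable \<beta>" by (intro reachable_add)
    then show ?thesis by (simp add: w Bw_append algebra_simps)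
  qed
qed

lemma family_basis:
  assumes lead: "\<And>ls. ls \<in> GL_sequences \<alpha> q \<xi> \<Longrightarrow> leadword (\<beta> ls) (concat ls) \<and> \<beta> ls \<in> Qq.KA"
    and b: "\<And>ls. ls \<in> GL_sequences \<alpha> q \<xi> \<Longrightarrow> b ls = pr (Bhat \<xi> (\<beta> ls))"
  shows "indexed_basis UU (U_scalars \<alpha> q) (U_iota \<alpha> q \<xi>) (GL_sequences \<alpha> q \<xi>) b"
  unfolding indexed_basis_def
proof (intro conjI allI impI ballI)
  let ?S = "GL_sequences \<alpha> q \<xi>"
  show "b ` ?S \<subseteq> U_iota \<alpha> q \<xi>" using lead b pr_Bhat_in_iota by auto
  have mapb: "map b ss = map (\<lambda>ls. pr (Bhat \<xi> (\<beta> ls))) ss" if "set ss \<subseteq> ?S" for ss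
    using b that by auto
  fix ss assume ss: "distinct ss \<and> set ss \<subseteq> ?S"
  have "ring.independent UU (U_scalars \<alpha> q) (map (\<lambda>ls. pr (Bhat \<xi> (\<beta> ls))) ss)"
  proof (rule independentI[of ?S])
    show "Bhat \<xi> (\<beta> s) \<in> Qq.KA" if "s \<in> ?S" for s using lead[OF that] by (auto intro: Bhat_KA)
    show "(\<Sum>t\<in>A. const (c t) * Bhat \<xi> (\<beta> t)) \<notin> UI" if "finite A" "A \<subseteq> ?S" "s \<in> A" "c s \<noteq> 0" for A c s
      by (rule family_independent) (use lead that in auto)
  qed (use ss in auto)
  then show "ring.independent UU (U_scalars \<alpha> q) (map b ss)" unfolding mapb[OF conjunct2[OF ss]] .
next
  let ?S = "GL_sequences \<alpha> q \<xi>"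
  fix x assume "x \<in> U_iota \<alpha> q \<xi>"
  then obtain p where p: "p \<in> Qq.KA" "x = pr (Bhat \<xi> p)" using iota_eq_image by blast
  have "Bhat \<xi> p \<in> reachable \<beta>" using p(1)
  proof (induction p rule: Qq.KA_induct)
    case zero
    then show ?case using reachable_UI[OF UI_0] by (simp add: falg.ev_0)
  next
    case (add c w p)
    then show ?case by (simp add: falg.ev_add falg.ev_const_mult reachable_add reachable_scale Bw_reachable[OF lead])
  qed
  then obtain y us where y: "y \<in> Qq.lspan us" "set us \<subseteq> (\<lambda>ls. Bhat \<xi> (\<beta> ls)) ` ?S" "Bhat \<xi> p - y \<in> UI"
    unfolding reachable_def Qq.kspan_def by (auto simp: algebra_simps)
  have "\<exists>ss. set ss \<subseteq> ?S \<and> us = map (\<lambda>ls. Bhat \<xi> (\<beta> ls)) ss"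
    using y(2)
  proof (induction us)
    case (Cons u us)
    then obtain ss s where "set ss \<subseteq> ?S" "us = map (\<lambda>ls. Bhat \<xi> (\<beta> ls)) ss" "s \<in> ?S" "u = Bhat \<xi> (\<beta> s)" by auto
    then show ?case by (intro exI[of _ "s # ss"]) simp
  qed simp
  then obtain ss where ss: "set ss \<subseteq> ?S" "us = map (\<lambda>ls. Bhat \<xi> (\<beta> ls)) ss" by blast
  have "set us \<subseteq> Qq.KA" using ss lead Bhat_KA by auto
  then have "pr (Bhat \<xi> p) \<in> ring.Span UU (U_scalars \<alpha> q) (map pr us)"
    using mem_Span_iff[of us "Bhat \<xi> p"] Bhat_KA[OF p(1)] y by blast
  moreover have "map pr us = map b ss" using ss b by auto
  ultimately show "\<exists>ss. set ss \<subseteq> ?S \<and> x \<in> ring.Span UU (U_scalars \<alpha> q) (map b ss)"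
    using ss(1) p(2) by auto
qed

lemma qcommutator_KA: "x \<in> Qq.KA \<Longrightarrow> y \<in> Qq.KA \<Longrightarrow> qcommutator \<alpha> q x y \<in> Qq.KA"
  unfolding qcommutator_def
  by (intro Qq.KA_sum Qq.KA_mult Qq.KA_diff Qq.KA_const Qq.KA_monomial Qq.K_mult powi_in_Qq) (simp_all add: Qq.KA_def)

lemma bracketing_KA: "bracketing \<alpha> q l \<in> Qq.KA"
proof (induction "length l" arbitrary: l rule: less_induct)
  case less
  show ?case
  proof (cases "length l < 2")
    case True
    then show ?thesis by (simp add: bracketing.simps Qq.KA_monomial)
  next
    case False
    then show ?thesis using longest_lyndon_prefix_bounds[of l]
      by (subst bracketing.simps) (auto intro!: qcommutator_KA less)
  qed
qed

lemma prod_bracketing_KA: "prod_list (map (bracketing \<alpha> q) ls) \<in> Qq.KA"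
  by (induction ls) (simp_all add: Qq.KA_1 Qq.KA_mult bracketing_KA)

end

theorem theorem4p1p5:
  fixes \<Phi> :: "'v::euclidean_space set"
    and \<alpha> :: "'i::{finite,linorder} \<Rightarrow> 'v"
    and q :: complex
    and \<xi> :: "'i \<Rightarrow> complex"
  assumes "irreducible_root_system \<Phi>"
    and "simple_roots \<Phi> \<alpha>"
    and "short_roots_normalised \<Phi>"
    and "q \<noteq> 0"
    and "\<forall>n>0. q ^ n \<noteq> 1"
    and "\<forall>i. \<xi> i \<in> Qq q \<and> \<xi> i \<noteq> 0"
  shows "indexed_basis (U \<alpha> q) (U_scalars \<alpha> q) (U_iota \<alpha> q \<xi>) (GL_sequences \<alpha> q \<xi>)
           (\<lambda>ls. B_word \<alpha> q \<xi> (concat ls))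
       \<and> indexed_basis (U \<alpha> q) (U_scalars \<alpha> q) (U_iota \<alpha> q \<xi>) (GL_sequences \<alpha> q \<xi>)
           (\<lambda>ls. B_lin \<alpha> q \<xi> (prod_list (map (bracketing \<alpha> q) ls)))"
proof -
  interpret cartan_datum \<alpha> q by (rule cartan_datum_of_root_system) (fact assms)+
  interpret iquantum \<alpha> q \<xi> by unfold_locales (use assms(6) in blast)
  show ?thesis
  proof (intro conjI)
    show "indexed_basis (U \<alpha> q) (U_scalars \<alpha> q) (U_iota \<alpha> q \<xi>) (GL_sequences \<alpha> q \<xi>) (\<lambda>ls. B_word \<alpha> q \<xi> (concat ls))"
      by (rule family_basis[of "\<lambda>ls. monomial (concat ls)"]) (simp_all add: leadword_monomial Qq.KA_monomial B_word_eq)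
    show "indexed_basis (U \<alpha> q) (U_scalars \<alpha> q) (U_iota \<alpha> q \<xi>) (GL_sequences \<alpha> q \<xi>)
           (\<lambda>ls. B_lin \<alpha> q \<xi> (prod_list (map (bracketing \<alpha> q) ls)))"
      by (rule family_basis[of "\<lambda>ls. prod_list (map (bracketing \<alpha> q) ls)"])
         (use GL_sequencesD(1) in \<open>simp_all add: leadword_prod_bracketing prod_bracketing_KA B_lin_eq\<close>)
  qed
qed

end
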